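(* Let $\mathcal I=[0,b)$, $X=\{x_n\}_{n=1}^\infty$, $d_n=x_n-x_{n-1}>0$ and $\alpha=\{\alpha_n\}_{n=1}^\infty\subset\mathbb R$ be as in the context. Suppose that $\{d_n\}_{n=1}^\infty\in l_2$ and $$d_{n-1}d_{n+1}\ge d_n^2,\qquad n\ge2 .$$ If, in addition, $$\sum_{n=1}^\infty d_{n+1}\left|\alpha_n+\frac1{d_n}+\frac1{d_{n+1}}\right|<\infty,$$ then the operator $\mathrm H_{X,\alpha}$ is symmetric with $\mathrm n_\pm(\mathrm H_{X,\alpha})=1$.
   Context: Let $\mathcal I=[0,b)$, $0<b\le+\infty$, and $X=\{x_n\}_{n=1}^\infty$, $x_0=0$, with $0=x_0<x_1<x_2<\dots<b$ and $\lim_nx_n=b$; $d_n=x_n-x_{n-1}$. $W^{2,2}(\mathcal I\setminus X)=\{f\in L^2(\mathcal I): f,f'\in AC_{loc}(\mathcal I\setminus X),\ f''\in L^2(\mathcal I)\}$, and $W^{2,2}_{\mathrm{comp}}(\mathcal I\setminus X)$ is the set of its elements whose support is compact in $\mathcal I=[0,b)$. $\mathrm H_{X,\alpha}$ is the closure in $L^2(\mathcal I)$ of the symmetric operator $-\mathrm d^2/\mathrm dx^2$ with domain $$\{f\in W^{2,2}_{\mathrm{comp}}(\mathcal I\setminus X): f'(0)=0,\ f(x_n+)=f(x_n-),\ f'(x_n+)-f'(x_n-)=\alpha_nf(x_n),\ n\in\mathbb N\}.$$ $\mathrm n_\pm(T)=\dim\ker(T^*\mp\mathrm i)$ are the deficiency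 indices. *)

theory Defs
  imports "HOL-Analysis.Analysis"
begin

section \<open>The complex Hilbert space of square integrable functions on the line\<close>

definition sq_integrable :: "(real \<Rightarrow> complex) \<Rightarrow> bool" where
  "sq_integrable f \<longleftrightarrow>
     f \<in> borel_measurable lebesgue \<and> integrable lebesgue (\<lambda>t. (cmod (f t))\<^sup>2)"

definition L2_rel :: "(real \<Rightarrow> complex) \<Rightarrow> (real \<Rightarrow> complex) \<Rightarrow> bool" where
  "L2_rel f g \<longleftrightarrow> sq_integrable f \<and> sq_integrable g \<and> (AE t in lebesgue. f t = g t)"

lemma sq_integrable_zero [simp]: "sq_integrable (\<lambda>t. 0)"
  by (simp add: sq_integrable_def)

lemma sq_integrable_cmult:
  assumes "sq_integrable f"
  shows "sq_integrable (\<lambda>t. c * f t)"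
  using assms by (auto simp: sq_integrable_def norm_mult power_mult_distrib)

lemma sq_integrable_add:
  assumes "sq_integrable f" "sq_integrable g"
  shows "sq_integrable (\<lambda>t. f t + g t)"
proof -
  have [measurable]: "f \<in> borel_measurable lebesgue" "g \<in> borel_measurable lebesgue"
    using assms by (auto simp: sq_integrable_def)
  have "integrable lebesgue (\<lambda>t. (cmod (f t + g t))\<^sup>2)"
  proof (rule Bochner_Integration.integrable_bound)
    show "integrable lebesgue (\<lambda>t. 2 * (cmod (f t))\<^sup>2 + 2 * (cmod (g t))\<^sup>2)"
      using assms by (auto simp: sq_integrable_def)
    have "(cmod (f t + g t))\<^sup>2 \<le> 2 * (cmod (f t))\<^sup>2 + 2 * (cmod (g t))\<^sup>2" for t
    proof -
      have "(cmod (f t + g t))\<^sup>2 \<le> (cmod (f t) + cmod (g t))\<^sup>2"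
        by (intro power_mono norm_triangle_ineq) auto
      also have "\<dots> \<le> 2 * (cmod (f t))\<^sup>2 + 2 * (cmod (g t))\<^sup>2"
        using zero_le_power2[of "cmod (f t) - cmod (g t)"]
        by (simp add: power2_sum power2_diff)
      finally show ?thesis .
    qed
    then show "AE t in lebesgue. norm ((cmod (f t + g t))\<^sup>2)
        \<le> norm (2 * (cmod (f t))\<^sup>2 + 2 * (cmod (g t))\<^sup>2)"
      by auto
  qed measurable
  then show ?thesis by (simp add: sq_integrable_def)
qed

lemma sq_integrable_prod_integrable:
  assumes "sq_integrable f" "sq_integrable g"
  shows "integrable lebesgue (\<lambda>t. f t * cnj (g t))"
proof (rule Bochner_Integration.integrable_bound)
  have [measurable]: "f \<in> borel_measurable lebesgue" "g \<in> borel_measurable lebesgue"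
    using assms by (auto simp: sq_integrable_def)
  have [measurable]: "cnj \<in> borel_measurable borel"
    by (intro borel_measurable_continuous_onI continuous_intros)
  show "(\<lambda>t. f t * cnj (g t)) \<in> borel_measurable lebesgue"
    by measurable
  show "integrable lebesgue (\<lambda>t. (cmod (f t))\<^sup>2 + (cmod (g t))\<^sup>2)"
    using assms by (auto simp: sq_integrable_def)
  have "cmod (f t) * cmod (g t) \<le> (cmod (f t))\<^sup>2 + (cmod (g t))\<^sup>2" for t
  proof -
    have "2 * (cmod (f t) * cmod (g t)) \<le> (cmod (f t))\<^sup>2 + (cmod (g t))\<^sup>2"
      using zero_le_power2[of "cmod (f t) - cmod (g t)"] by (simp add: power2_diff)
    moreover have "0 \<le> cmod (f t) * cmod (g t)" by simp
    ultimately show ?thesis by linarith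
  qed
  then show "AE t in lebesgue. norm (f t * cnj (g t)) \<le> norm ((cmod (f t))\<^sup>2 + (cmod (g t))\<^sup>2)"
    by (auto simp: norm_mult)
qed

lemma part_equivp_L2_rel: "part_equivp L2_rel"
proof (rule part_equivpI)
  show "\<exists>f. L2_rel f f"
    by (rule exI[of _ "\<lambda>t. 0"]) (simp add: L2_rel_def)
  show "symp L2_rel"
    by (rule sympI) (auto simp: L2_rel_def elim: eventually_mono)
  show "transp L2_rel"
  proof (rule transpI)
    fix f g h assume "L2_rel f g" "L2_rel g h"
    then show "L2_rel f h"
      by (auto simp: L2_rel_def elim: eventually_elim2)
  qed
qed

quotient_type L2 = "real \<Rightarrow> complex" / partial: L2_rel
  by (rule part_equivp_L2_rel)

lift_definition cscale :: "complex \<Rightarrow> L2 \<Rightarrow> L2" is "\<lambda>c f t. c * f t"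
  by (auto simp: L2_rel_def sq_integrable_cmult elim: eventually_mono)

text \<open>The inner product is linear in the first argument.\<close>

lift_definition cinner :: "L2 \<Rightarrow> L2 \<Rightarrow> complex" is
  "\<lambda>f g. \<integral>t. f t * cnj (g t) \<partial>lebesgue"
proof -
  fix f f' g g' assume a: "L2_rel f f'" "L2_rel g g'"
  have "AE t in lebesgue. f t * cnj (g t) = f' t * cnj (g' t)"
    using a by (auto simp: L2_rel_def elim: eventually_elim2)
  then show "(\<integral>t. f t * cnj (g t) \<partial>lebesgue) = (\<integral>t. f' t * cnj (g' t) \<partial>lebesgue)"
    using a by (intro integral_cong_AE)
      (auto simp: L2_rel_def intro: borel_measurable_integrable sq_integrable_prod_integrable)
qed

lift_definition vanishes_off :: "real set \<Rightarrow> L2 \<Rightarrow> bool" is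
  "\<lambda>S f. AE t in lebesgue. t \<notin> S \<longrightarrow> f t = 0"
proof -
  fix S and f g :: "real \<Rightarrow> complex" assume "L2_rel f g"
  then have "AE t in lebesgue. f t = g t" by (simp add: L2_rel_def)
  then show "(AE t in lebesgue. t \<notin> S \<longrightarrow> f t = 0) = (AE t in lebesgue. t \<notin> S \<longrightarrow> g t = 0)"
    by (intro eventually_cong) auto
qed

instantiation L2 :: real_inner
begin

lift_definition zero_L2 :: L2 is "\<lambda>t. 0"
  by (simp add: L2_rel_def)

lift_definition plus_L2 :: "L2 \<Rightarrow> L2 \<Rightarrow> L2" is "\<lambda>f g t. f t + g t"
  by (auto simp: L2_rel_def sq_integrable_add elim: eventually_elim2)

definition uminus_L2 :: "L2 \<Rightarrow> L2" where "uminus_L2 F = cscale (-1) F"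

definition minus_L2 :: "L2 \<Rightarrow> L2 \<Rightarrow> L2" where "minus_L2 F G = F + cscale (-1) G"

definition scaleR_L2 :: "real \<Rightarrow> L2 \<Rightarrow> L2" where "scaleR_L2 r F = cscale (of_real r) F"

definition inner_L2 :: "L2 \<Rightarrow> L2 \<Rightarrow> real" where "inner_L2 F G = Re (cinner F G)"

definition norm_L2 :: "L2 \<Rightarrow> real" where "norm_L2 F = sqrt (inner F F)"

definition dist_L2 :: "L2 \<Rightarrow> L2 \<Rightarrow> real" where "dist_L2 F G = norm (F - G)"

definition sgn_L2 :: "L2 \<Rightarrow> L2" where "sgn_L2 F = scaleR (inverse (norm F)) F"

definition uniformity_L2 :: "(L2 \<times> L2) filter" where
  "uniformity_L2 = (INF e\<in>{0<..}. principal {(F, G). dist F G < e})"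

definition open_L2 :: "L2 set \<Rightarrow> bool" where
  "open_L2 U \<longleftrightarrow> (\<forall>F\<in>U. eventually (\<lambda>(F', G). F' = F \<longrightarrow> G \<in> U) uniformity)"

instance
proof
  fix F G H :: L2 and r s :: real
  show "F + G + H = F + (G + H)"
    by transfer (auto simp: L2_rel_def add.assoc add.commute intro!: sq_integrable_add)
  show "F + G = G + F"
    by transfer (auto simp: L2_rel_def add.assoc add.commute intro!: sq_integrable_add)
  show "0 + F = F"
    by transfer (auto simp: L2_rel_def)
  show "- F + F = 0"
    unfolding uminus_L2_def
    by transfer (use sq_integrable_cmult[where c = "-1"] in \<open>auto simp: L2_rel_def\<close>)
  show "F - G = F + - G"
    by (simp add: minus_L2_def uminus_L2_def)
  show "r *\<^sub>R (F + G) = r *\<^sub>R F + r *\<^sub>R G"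
    unfolding scaleR_L2_def
    by transfer (auto simp: L2_rel_def distrib_left intro!: sq_integrable_add sq_integrable_cmult)
  show "(r + s) *\<^sub>R F = r *\<^sub>R F + s *\<^sub>R F"
    unfolding scaleR_L2_def
    by transfer (auto simp: L2_rel_def distrib_right intro!: sq_integrable_add sq_integrable_cmult)
  show "r *\<^sub>R s *\<^sub>R F = (r * s) *\<^sub>R F"
    unfolding scaleR_L2_def
    by transfer (auto simp: L2_rel_def mult.assoc intro!: sq_integrable_cmult)
  show "1 *\<^sub>R F = F"
    unfolding scaleR_L2_def by transfer (auto simp: L2_rel_def)
  show "dist F G = norm (F - G)" by (rule dist_L2_def)
  show "sgn F = scaleR (inverse (norm F)) F" by (rule sgn_L2_def)
  show "uniformity = (INF e\<in>{0<..}. principal {(F :: L2, G). dist F G < e})"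
    by (rule uniformity_L2_def)
  show "open U \<longleftrightarrow> (\<forall>F\<in>U. eventually (\<lambda>(F', G). F' = F \<longrightarrow> G \<in> U) uniformity)" for U :: "L2 set"
    by (rule open_L2_def)
  show "norm F = sqrt (inner F F)" by (rule norm_L2_def)
  show "inner F G = inner G F"
    unfolding inner_L2_def
  proof transfer
    fix f g assume "L2_rel f f" "L2_rel g g"
    have "(\<integral>t. f t * cnj (g t) \<partial>lebesgue) = (\<integral>t. cnj (g t * cnj (f t)) \<partial>lebesgue)"
      by (simp add: mult.commute)
    also have "\<dots> = cnj (\<integral>t. g t * cnj (f t) \<partial>lebesgue)"
      by (rule Bochner_Integration.integral_cnj)
    finally show "Re (\<integral>t. f t * cnj (g t) \<partial>lebesgue) = Re (\<integral>t. g t * cnj (f t) \<partial>lebesgue)"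
      by simp
  qed
  show "inner (F + G) H = inner F H + inner G H"
    unfolding inner_L2_def
    by transfer (simp add: L2_rel_def distrib_right sq_integrable_prod_integrable)
  show "inner (r *\<^sub>R F) G = r * inner F G"
    unfolding inner_L2_def scaleR_L2_def
    by transfer (simp add: mult.assoc)
  have sq: "f t * cnj (f t) = of_real ((cmod (f t))\<^sup>2)" for f :: "real \<Rightarrow> complex" and t
    by (simp add: complex_norm_square del: of_real_power)
  have inner_self: "Re (\<integral>t. f t * cnj (f t) \<partial>lebesgue) = (\<integral>t. (cmod (f t))\<^sup>2 \<partial>lebesgue)"
    for f :: "real \<Rightarrow> complex"
    unfolding sq by (subst integral_complex_of_real) simp
  show "0 \<le> inner F F"
    unfolding inner_L2_def by transfer (simp add: inner_self del: complex_mult_cnj)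
  show "inner F F = 0 \<longleftrightarrow> F = 0"
    unfolding inner_L2_def
  proof transfer
    fix f assume f: "L2_rel f f"
    then have "integrable lebesgue (\<lambda>t. (cmod (f t))\<^sup>2)"
      by (simp add: L2_rel_def sq_integrable_def)
    then have "(\<integral>t. (cmod (f t))\<^sup>2 \<partial>lebesgue) = 0 \<longleftrightarrow> (AE t in lebesgue. (cmod (f t))\<^sup>2 = 0)"
      by (rule integral_nonneg_eq_0_iff_AE) auto
    then show "(Re (\<integral>t. f t * cnj (f t) \<partial>lebesgue) = 0) = L2_rel f (\<lambda>t. 0)"
      using f by (simp add: inner_self L2_rel_def)
  qed
qed

end

global_interpretation cL2: vector_space cscale
proof
  fix a b :: complex and F G :: L2
  show "cscale a (F + G) = cscale a F + cscale a G"
    by transfer (auto simp: L2_rel_def distrib_left intro!: sq_integrable_add sq_integrable_cmult)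
  show "cscale (a + b) F = cscale a F + cscale b F"
    by transfer (auto simp: L2_rel_def distrib_right intro!: sq_integrable_add sq_integrable_cmult)
  show "cscale a (cscale b F) = cscale (a * b) F"
    by transfer (auto simp: L2_rel_def mult.assoc intro!: sq_integrable_cmult)
  show "cscale 1 F = F"
    by transfer (auto simp: L2_rel_def)
qed

text \<open>
  For \<open>S \<subseteq> \<real>\<close> the space \<open>L\<^sup>2(S)\<close> is the closed subspace \<open>L2_on S\<close> of \<open>L\<^sup>2(\<real>)\<close>: functions on \<open>S\<close>
  are extended by zero.
\<close>

definition L2_on :: "real set \<Rightarrow> L2 set" where
  "L2_on S = {F. vanishes_off S F}"

definition sq_integrable_on :: "real set \<Rightarrow> (real \<Rightarrow> complex) \<Rightarrow> bool" where
  "sq_integrable_on S f \<longleftrightarrow> sq_integrable (\<lambda>t. if t \<in> S then f t else 0)"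

text \<open>Only meaningful if \<open>sq_integrable_on S f\<close>.\<close>

definition to_L2 :: "real set \<Rightarrow> (real \<Rightarrow> complex) \<Rightarrow> L2" where
  "to_L2 S f = abs_L2 (\<lambda>t. if t \<in> S then f t else 0)"


section \<open>Unbounded operators in a closed subspace of \<open>L\<^sup>2\<close>\<close>

text \<open>
  An operator in the Hilbert space \<open>K\<close> is represented by its graph \<open>T \<subseteq> K \<times> K\<close>; its domain is
  \<open>Domain T\<close>, and the closure of an operator is the topological closure of its graph.
\<close>

definition symmetric_operator :: "L2 set \<Rightarrow> (L2 \<times> L2) set \<Rightarrow> bool" where
  "symmetric_operator K T \<longleftrightarrow>
     T \<subseteq> K \<times> K \<and>
     single_valued T \<and>
     (0, 0) \<in> T \<and>
     (\<forall>(F, F')\<in>T. \<forall>(G, G')\<in>T. (F + G, F' + G') \<in> T) \<and>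
     (\<forall>c. \<forall>(F, F')\<in>T. (cscale c F, cscale c F') \<in> T) \<and>
     K \<subseteq> closure (Domain T) \<and>
     (\<forall>(F, F')\<in>T. \<forall>(G, G')\<in>T. cinner F' G = cinner F G')"

definition adjoint_op :: "L2 set \<Rightarrow> (L2 \<times> L2) set \<Rightarrow> (L2 \<times> L2) set" where
  "adjoint_op K T = {(G, G'). G \<in> K \<and> G' \<in> K \<and> (\<forall>(F, F')\<in>T. cinner F' G = cinner F G')}"

text \<open>The kernel of \<open>T - z\<close>.\<close>

definition eigenspace :: "(L2 \<times> L2) set \<Rightarrow> complex \<Rightarrow> L2 set" where
  "eigenspace T z = {F. (F, cscale z F) \<in> T}"

text \<open>
  The library's \<open>dim\<close> is a natural number and is \<open>0\<close> for infinite-dimensional spaces, so the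
  deficiency indices below are faithful as soon as they are nonzero.
\<close>

definition deficiency_plus :: "L2 set \<Rightarrow> (L2 \<times> L2) set \<Rightarrow> nat" where
  "deficiency_plus K T = cL2.dim (eigenspace (adjoint_op K T) \<i>)"

definition deficiency_minus :: "L2 set \<Rightarrow> (L2 \<times> L2) set \<Rightarrow> nat" where
  "deficiency_minus K T = cL2.dim (eigenspace (adjoint_op K T) (- \<i>))"


section \<open>Sobolev functions on the punctured interval\<close>

definition abs_cont_on :: "real \<Rightarrow> real \<Rightarrow> (real \<Rightarrow> complex) \<Rightarrow> bool" where
  "abs_cont_on u v f \<longleftrightarrow>
     (\<forall>\<epsilon>>0. \<exists>\<delta>>0. \<forall>D T. D division_of T \<longrightarrow> T \<subseteq> {u..v} \<longrightarrow> (\<Sum>J\<in>D. Sup J - Inf J) < \<delta> \<longrightarrow>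
        (\<Sum>J\<in>D. cmod (f (Sup J) - f (Inf J))) < \<epsilon>)"

definition AC_loc :: "real set \<Rightarrow> (real \<Rightarrow> complex) \<Rightarrow> bool" where
  "AC_loc S f \<longleftrightarrow> (\<forall>u v. u \<le> v \<longrightarrow> {u..v} \<subseteq> S \<longrightarrow> abs_cont_on u v f)"

definition halfopen_interval :: "ereal \<Rightarrow> real set" where
  "halfopen_interval b = {t. 0 \<le> t \<and> ereal t < b}"

text \<open>The derivative relative to \<open>S\<close>; at a left end point belonging to \<open>S\<close> it is one-sided.\<close>

definition deriv_on :: "real set \<Rightarrow> (real \<Rightarrow> complex) \<Rightarrow> real \<Rightarrow> complex" where
  "deriv_on S f t = vector_derivative f (at t within S)"

text \<open>
  Elements of \<open>W\<^sup>2\<^sup>,\<^sup>2(I - X)\<close> are represented by functions whose values at the points of \<open>X\<close> and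
  outside \<open>I\<close> are irrelevant. As \<open>f'\<close> is only locally absolutely continuous, \<open>f''\<close> exists
  almost everywhere; where it does not, \<open>deriv_on\<close> takes an arbitrary value. The
  differentiability clause makes explicit that \<open>f'\<close> exists on all of \<open>I - X\<close>, which local
  absolute continuity of \<open>f'\<close> presupposes.
\<close>

definition W22 :: "real set \<Rightarrow> real set \<Rightarrow> (real \<Rightarrow> complex) set" where
  "W22 I X = {f.
     sq_integrable_on I f \<and>
     AC_loc (I - X) f \<and>
     (\<forall>t\<in>I - X. f differentiable (at t within I - X)) \<and>
     AC_loc (I - X) (deriv_on (I - X) f) \<and>
     sq_integrable_on I (deriv_on (I - X) (deriv_on (I - X) f))}"

definition W22_comp :: "real set \<Rightarrow> real set \<Rightarrow> (real \<Rightarrow> complex) set" where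
  "W22_comp I X = {f \<in> W22 I X.
     compact (closure {t \<in> I - X. f t \<noteq> 0}) \<and> closure {t \<in> I - X. f t \<noteq> 0} \<subseteq> I}"


section \<open>The Schroedinger operator with delta interactions\<close>

definition delta_domain ::
    "ereal \<Rightarrow> (nat \<Rightarrow> real) \<Rightarrow> (nat \<Rightarrow> real) \<Rightarrow> (real \<Rightarrow> complex) set" where
  "delta_domain b x \<alpha> =
     (let I = halfopen_interval b; X = x ` {1..}; f' = deriv_on (I - X)
      in {f \<in> W22_comp I X. f' f 0 = 0 \<and>
           (\<forall>n\<ge>1. \<exists>y p q.
              (f \<longlongrightarrow> y) (at_left (x n)) \<and> (f \<longlongrightarrow> y) (at_right (x n)) \<and>
              (f' f \<longlongrightarrow> p) (at_left (x n)) \<and> (f' f \<longlongrightarrow> q) (at_right (x n)) \<and>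
              q - p = of_real (\<alpha> n) * y)})"

definition delta_operator_min ::
    "ereal \<Rightarrow> (nat \<Rightarrow> real) \<Rightarrow> (nat \<Rightarrow> real) \<Rightarrow> (L2 \<times> L2) set" where
  "delta_operator_min b x \<alpha> =
     (let I = halfopen_interval b; X = x ` {1..}; D = deriv_on (I - X)
      in (\<lambda>f. (to_L2 I f, to_L2 I (\<lambda>t. - D (D f) t))) ` delta_domain b x \<alpha>)"

definition H_delta :: "ereal \<Rightarrow> (nat \<Rightarrow> real) \<Rightarrow> (nat \<Rightarrow> real) \<Rightarrow> (L2 \<times> L2) set" where
  "H_delta b x \<alpha> = closure (delta_operator_min b x \<alpha>)"

end

theory Submission
  imports Defs
begin

text \<open>
  On a segment a solution of \<open>-y'' = z y\<close> is determined by its values at the two end points, and the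
  interface conditions turn these values \<open>A\<^sub>n\<close> into a three-term recurrence
  \<open>A\<^sub>n\<^sub>+\<^sub>1 = - (d\<^sub>n\<^sub>+\<^sub>1 / d\<^sub>n) (1 + O(d\<^sub>n\<^sup>2 + d\<^sub>n\<^sub>+\<^sub>1\<^sup>2)) A\<^sub>n\<^sub>-\<^sub>1 + \<epsilon>\<^sub>n A\<^sub>n\<close>. The assumption on \<open>\<alpha>\<close> makes
  \<open>\<epsilon>\<^sub>n\<close> summable, and log-convexity makes \<open>A\<^sub>n / \<surd>d\<^sub>n\<^sub>+\<^sub>1\<close> bounded, so that \<open>d \<in> l\<^sub>2\<close> puts the solution
  \<open>\<phi>\<close> with \<open>\<phi>(0) = 1\<close>, \<open>\<phi>'(0) = 0\<close> into \<open>L\<^sup>2\<close>. By Green's formula \<open>\<phi>\<close> lies in the deficiency space.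
  Conversely, if \<open>h\<close> has compact support and is orthogonal to \<open>\<phi>\<close>, variation of constants solves
  \<open>- f'' - cnj z f = h\<close> with \<open>f\<close> in the domain; hence every deficiency vector is orthogonal to such \<open>h\<close>
  and is a multiple of \<open>\<phi>\<close>. Green's formula needs the fundamental theorem of calculus for
  absolutely continuous functions, whose almost everywhere differentiability is obtained from the
  Vitali covering theorem.
\<close>

section \<open>Absolutely continuous functions\<close>

text \<open>Deficiency vectors are never shown to be regular. The adjoint is known only through its
  pairing with the operator, so the equation is tested against explicit domain functions and all
  regularity questions fall on the latter. For \<open>cmod \<kappa> = 1\<close> every solution
  obeying the interface conditions turns out to be square integrable; it is the Neumann condition at
  0 that leaves one dimension. Both signs of the imaginary unit are one case, with \<kappa> a square
  root of \<open>- z\<close> and \<open>cmod z = 1\<close>. The strengths enter through a pole: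
  eliminating the slope at an interaction point puts \<alpha> next to two quotients cosh/sinh, each
  equal to 1/d + O(d). The hypothesis on \<alpha> measures the failure of these poles to cancel.
  Bounded values at the interaction points would not suffice, since the gaps need not be summable
  when b is infinite. The rate sqrt(d) makes the contribution of a segment comparable to the squares
  of two neighbouring gaps. Solutions are smooth on segments, but domain functions have second
  derivatives only almost everywhere, hence the general fundamental theorem.\<close>

lemma continuous_on_Icc_bounded:
  fixes f :: "real \<Rightarrow> 'a::real_normed_vector"
  assumes "continuous_on {u..v} f"
  shows "\<exists>B. \<forall>t\<in>{u..v}. norm (f t) \<le> B"
  using compact_imp_bounded[OF compact_continuous_image[OF assms compact_Icc]]
  unfolding bounded_iff by blast

section \<open>Vitali coverings and divisions of the line\<close>

lemma abs_cont_onD: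
  assumes "abs_cont_on u v f" "\<epsilon> > 0"
  shows "\<exists>\<delta>>0. \<forall>D T. D division_of T \<longrightarrow> T \<subseteq> {u..v} \<longrightarrow> (\<Sum>J\<in>D. Sup J - Inf J) < \<delta> \<longrightarrow>
    (\<Sum>J\<in>D. cmod (f (Sup J) - f (Inf J))) < \<epsilon>"
  using assms unfolding abs_cont_on_def by blast

text \<open>An interval is the ball about its midpoint, so the covering theorem for balls gives a
  countable disjoint subfamily covering \<open>S\<close> up to a null set. Since \<open>B\<close> is
  bounded, finite subunions have uniformly bounded measure, so finitely many members exhaust the
  union up to \<open>e\<close>. The remaining members and the null set form
  \<open>T\<close>.\<close>

lemma Vitali_finite_intervals:
  fixes S B :: "real set"
  assumes K: "\<And>J. J \<in> K \<Longrightarrow> \<exists>a b. a < b \<and> J = {a..b}"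
    and S: "\<And>x d. x \<in> S \<Longrightarrow> 0 < d \<Longrightarrow> \<exists>J\<in>K. x \<in> J \<and> Sup J - Inf J < d"
    and B: "\<And>J. J \<in> K \<Longrightarrow> J \<subseteq> B" "bounded B"
    and e: "0 < e"
  obtains D T where "finite D" "D \<subseteq> K" "pairwise disjnt D" "S \<subseteq> \<Union>D \<union> T"
    "T \<in> lmeasurable" "measure lebesgue T < e"
proof -
  have ball: "cball ((Inf J + Sup J) / 2) ((Sup J - Inf J) / 2) = J" if JK: "J \<in> K" for J
  proof -
    obtain a b where J: "a < b" "J = {a..b}" using K[OF JK] by blast
    have "(a + b) / 2 - (b - a) / 2 = a" "(a + b) / 2 + (b - a) / 2 = b" by (simp_all add: field_simps)
    then show ?thesis using J by (simp add: cball_eq_atLeastAtMost)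
  qed
  have pos: "0 < (Sup J - Inf J) / 2" if "J \<in> K" for J
    using K[OF that] by auto
  have ex: "\<exists>J. J \<in> K \<and> x \<in> cball ((Inf J + Sup J) / 2) ((Sup J - Inf J) / 2) \<and> (Sup J - Inf J) / 2 < d"
    if xd: "x \<in> S" "0 < d" for x d
  proof -
    obtain J where "J \<in> K" "x \<in> J" "Sup J - Inf J < d" using S[OF xd] by blast
    moreover have "(Sup J - Inf J) / 2 < d" using pos[OF \<open>J \<in> K\<close>] \<open>Sup J - Inf J < d\<close> by (auto simp: field_simps)
    ultimately show ?thesis using ball by blast
  qed
  obtain C where C: "countable C" "C \<subseteq> K"
    and disj: "pairwise (\<lambda>i j. disjnt (cball ((Inf i + Sup i) / 2) ((Sup i - Inf i) / 2))
         (cball ((Inf j + Sup j) / 2) ((Sup j - Inf j) / 2))) C"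
    and neg: "negligible (S - (\<Union>i\<in>C. cball ((Inf i + Sup i) / 2) ((Sup i - Inf i) / 2)))"
    using Vitali_covering_theorem_cballs[where K = K and S = S, OF pos ex] by blast
  have disj': "pairwise disjnt C"
    using disj C(2) by (auto simp: pairwise_def ball subset_iff)
  have Ueq: "(\<Union>i\<in>C. cball ((Inf i + Sup i) / 2) ((Sup i - Inf i) / 2)) = \<Union>C"
    using C(2) ball by (auto simp: subset_iff)
  obtain c where c: "B \<subseteq> ball 0 c" using bounded_subset_ballD[OF B(2), of 0] by blast
  have Clm: "J \<in> lmeasurable" if "J \<in> C" for J
    using K[of J] that C(2) by auto
  have fin_bd: "measure lebesgue (\<Union>D') \<le> measure lebesgue (ball (0::real) c)" if "D' \<subseteq> C" "finite D'" for D'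
  proof (rule measure_mono_fmeasurable)
    show "\<Union>D' \<subseteq> ball 0 c" using that C(2) B(1) c by blast
    show "\<Union>D' \<in> sets lebesgue" using that Clm by (meson fmeasurableD sets.finite_Union subset_iff)
  qed auto
  obtain D where D: "D \<subseteq> C" "finite D" "measure lebesgue (\<Union>C) - e < measure lebesgue (\<Union>D)"
    using measure_countable_Union_approachable[OF C(1) e Clm fin_bd] by blast
  have UCm: "\<Union>C \<in> lmeasurable"
    by (rule fmeasurable_Union_bound[OF C(1) Clm fin_bd])
  have UDm: "\<Union>D \<in> lmeasurable"
    using D Clm by (meson fmeasurable.finite_Union subset_iff)
  define N where "N = S - \<Union>C"
  have N: "N \<in> lmeasurable" "measure lebesgue N = 0"
    using neg by (auto simp: Ueq N_def negligible_iff_measure)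
  have "measure lebesgue ((\<Union>C - \<Union>D) \<union> N) \<le> measure lebesgue (\<Union>C - \<Union>D) + measure lebesgue N"
    by (rule measure_Un_le) (use UCm UDm N in auto)
  also have "\<dots> = measure lebesgue (\<Union>C) - measure lebesgue (\<Union>D)"
    using N(2) UCm UDm D(1) by (simp add: measurable_measure_Diff fmeasurableD Union_mono)
  finally have m: "measure lebesgue ((\<Union>C - \<Union>D) \<union> N) < e" using D(3) by linarith
  show ?thesis
  proof (rule that[OF D(2)])
    show "D \<subseteq> K" using D(1) C(2) by blast
    show "pairwise disjnt D" using disj' D(1) by (rule pairwise_subset)
    show "S \<subseteq> \<Union>D \<union> ((\<Union>C - \<Union>D) \<union> N)" by (auto simp: N_def)
    show "(\<Union>C - \<Union>D) \<union> N \<in> lmeasurable"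
      using UCm UDm N(1) by (intro fmeasurable.Un fmeasurable_Diff) (auto dest: fmeasurableD)
  qed (rule m)
qed

text \<open>Tagging each interval with its left end point produces a tagged division, for which
  increments telescope.\<close>

lemma sum_division_increments:
  fixes f :: "real \<Rightarrow> 'a::real_normed_vector"
  assumes "a \<le> b" "D division_of {a..b}"
  shows "(\<Sum>J\<in>D. f (Sup J) - f (Inf J)) = f b - f a"
proof -
  let ?p = "(\<lambda>J. (Inf J, J)) ` D"
  have D': "J \<noteq> {} \<and> (\<exists>u v. J = cbox u v) \<and> J \<subseteq> {a..b}" if "J \<in> D" for J
    using division_ofD[OF assms(2)] that by blast
  have "Inf J \<in> J" if "J \<in> D" for J
    using D'[OF that] by auto
  then have "?p tagged_division_of {a..b}"
    using division_ofD[OF assms(2)] by (intro tagged_division_ofI) (auto simp: image_iff; fail | fastforce)+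
  from additive_tagged_division_1[OF assms(1) this, of f]
  have "(\<Sum>(x,K)\<in>?p. f (Sup K) - f (Inf K)) = f b - f a" .
  moreover have "inj_on (\<lambda>J. (Inf J, J)) D" by (auto simp: inj_on_def)
  ultimately show ?thesis by (simp add: sum.reindex)
qed

lemma division_of_disjoint_intervals:
  assumes "finite D" "pairwise disjnt D" "\<And>J. J \<in> D \<Longrightarrow> \<exists>a b::real. a \<le> b \<and> J = {a..b}"
  shows "D division_of \<Union>D"
proof (rule division_ofI)
  fix J assume J: "J \<in> D"
  then obtain a b where "a \<le> b" "J = {a..b}" using assms(3) by blast
  then show "J \<noteq> {}" "\<exists>a b. J = cbox a b" by auto
next
  fix J K assume "J \<in> D" "K \<in> D" "J \<noteq> K"
  then have "J \<inter> K = {}" using assms(2) by (auto simp: pairwise_def disjnt_def)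
  then show "interior J \<inter> interior K = {}" using interior_subset by blast
qed (use assms(1) in auto)

lemma measure_division:
  fixes S :: "real set"
  assumes "D division_of S"
  shows "measure lebesgue S = (\<Sum>J\<in>D. Sup J - Inf J)"
proof -
  have "measure lebesgue S = (\<Sum>J\<in>D. measure lebesgue J)"
    using content_division[OF assms] by simp
  also have "\<dots> = (\<Sum>J\<in>D. Sup J - Inf J)"
  proof (rule sum.cong[OF refl])
    fix J assume "J \<in> D"
    then obtain a b where "J = cbox a b" "J \<noteq> {}" using division_ofD[OF assms] by metis
    then show "measure lebesgue J = Sup J - Inf J" by auto
  qed
  finally show ?thesis .
qed

text \<open>
  The core of the almost everywhere differentiability: cover \<open>E\<close> up to a small remainder by intervals
  of slope \<open>< p\<close>, and cover it again, inside the first family, by intervals of slope \<open>> q\<close>. Both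
  families have nearly the same total length, so by absolute continuity nearly the same total
  increment, which forces the length to vanish.
\<close>

lemma abs_cont_slope_gap_negligible:
  fixes f :: "real \<Rightarrow> real"
  assumes ac: "abs_cont_on u v (\<lambda>t. complex_of_real (f t))" and pq: "p < q"
    and E: "E \<subseteq> {u<..<v}"
    and lo: "\<And>x d. x \<in> E \<Longrightarrow> 0 < d \<Longrightarrow>
       \<exists>a b. a < b \<and> x \<in> {a..b} \<and> b - a < d \<and> f b - f a < p * (b - a)"
    and hi: "\<And>x d. x \<in> E \<Longrightarrow> 0 < d \<Longrightarrow>
       \<exists>a b. a < b \<and> x \<in> {a..b} \<and> b - a < d \<and> f b - f a > q * (b - a)"
  shows "negligible E"
proof (rule ccontr)
  assume "\<not> negligible E"
  then obtain e0 where e0: "e0 > 0" "\<And>T. E \<subseteq> T \<Longrightarrow> T \<in> lmeasurable \<Longrightarrow> e0 \<le> measure lebesgue T"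
    unfolding negligible_outer by (meson not_less)
  \<comment> \<open>\<open>E\<close> is not known to be measurable, so its size is the infimum
    \<open>s\<close> of the measures of its measurable supersets; this outer measure is positive
    because \<open>E\<close> is not negligible.\<close>
  define M where "M = {measure lebesgue T |T. E \<subseteq> T \<and> T \<in> lmeasurable}"
  define s where "s = Inf M"
  have Mne: "M \<noteq> {}" unfolding M_def using E lmeasurable_box[of u v] by auto
  have Mbd: "bdd_below M" unfolding M_def by (auto intro!: bdd_belowI[of _ 0])
  have s_le: "s \<le> measure lebesgue T" if "E \<subseteq> T" "T \<in> lmeasurable" for T
    unfolding s_def using Mbd that by (intro cInf_lower) (auto simp: M_def)
  have s_pos: "0 < s"
  proof -
    have "e0 \<le> s" unfolding s_def using Mne e0 by (intro cInf_greatest) (auto simp: M_def)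
    then show ?thesis using e0 by simp
  qed
  define \<epsilon> where "\<epsilon> = (q - p) * s / 4"
  have \<epsilon>: "\<epsilon> > 0" using pq s_pos by (simp add: \<epsilon>_def)
  obtain \<eta> where \<eta>: "\<eta> > 0" and ac\<eta>: "\<And>D T. D division_of T \<Longrightarrow> T \<subseteq> {u..v} \<Longrightarrow> (\<Sum>J\<in>D. Sup J - Inf J) < \<eta>
       \<Longrightarrow> (\<Sum>J\<in>D. cmod (complex_of_real (f (Sup J)) - complex_of_real (f (Inf J)))) < \<epsilon>"
    using abs_cont_onD[OF ac \<epsilon>] by blast
  \<comment> \<open>The leftover length \<open>m - m'\<close> will be below
    \<open>4 * \<delta>\<close>, hence the bound by \<open>\<eta> / 4\<close>. The bound by
    \<open>s / 8\<close> contradicts \<open>m' < s / 2\<close> at the end, and the last one makes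
    \<open>p * (m - m')\<close> at most \<open>(q - p) * s / 4\<close>; the added 1 allows
    \<open>p = 0\<close>.\<close>
  define \<delta> where "\<delta> = min (\<eta> / 4) (min (s / 8) ((q - p) * s / (16 * (\<bar>p\<bar> + 1))))"
  have "\<delta> \<le> \<eta> / 4" and \<delta>: "\<delta> \<le> s / 8" "\<delta> \<le> (q - p) * s / (16 * (\<bar>p\<bar> + 1))"
    unfolding \<delta>_def by linarith+
  then have \<delta>4: "4 * \<delta> \<le> \<eta>" by simp
  have \<delta>0: "\<delta> > 0" using \<eta> s_pos pq by (simp add: \<delta>_def)
  have p\<delta>: "4 * \<bar>p\<bar> * \<delta> \<le> (q - p) * s / 4"
  proof -
    have "4 * \<bar>p\<bar> * \<delta> \<le> 4 * (\<bar>p\<bar> + 1) * \<delta>" using \<delta>0 by simp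
    also have "\<dots> \<le> 4 * (\<bar>p\<bar> + 1) * ((q - p) * s / (16 * (\<bar>p\<bar> + 1)))"
      using \<delta>(2) by (intro mult_left_mono) auto
    also have "\<dots> = (q - p) * s / 4" by (simp add: field_simps add_pos_pos add_nonneg_eq_0_iff)
    finally show ?thesis .
  qed
  obtain T0 where T0: "E \<subseteq> T0" "T0 \<in> lmeasurable" "measure lebesgue T0 < s + \<delta>"
    using cInf_lessD[OF Mne, of "s + \<delta>"] \<delta>0 unfolding s_def[symmetric] by (auto simp: M_def)
  obtain O1 where O1: "open O1" "T0 \<subseteq> O1" "O1 - T0 \<in> lmeasurable" "emeasure lebesgue (O1 - T0) < ennreal \<delta>"
    using sets_lebesgue_outer_open[OF fmeasurableD[OF T0(2)] \<delta>0] by blast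
  define O2 where "O2 = O1 \<inter> {u<..<v}"
  have O2: "open O2" "E \<subseteq> O2" "O2 \<subseteq> {u<..<v}"
    using O1 T0 E by (auto simp: O2_def)
  have O2m: "O2 \<in> lmeasurable" using O2 by (intro lmeasurable_open) (metis bounded_box box_real(1) bounded_subset)
  have mO2: "measure lebesgue O2 < s + 2 * \<delta>"
  proof -
    have "measure lebesgue (O1 - T0) < \<delta>"
      using O1(3,4) \<delta>0 by (simp add: emeasure_eq_measure2 ennreal_less_iff)
    moreover have "measure lebesgue O2 \<le> measure lebesgue (T0 \<union> (O1 - T0))"
      using O1(2) T0(2) O1(3) O2m
      by (intro measure_mono_fmeasurable fmeasurable.Un fmeasurableD[OF O2m]) (auto simp: O2_def)
    moreover have "\<dots> \<le> measure lebesgue T0 + measure lebesgue (O1 - T0)"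
      using T0 O1 by (intro measure_Un_le) (auto dest: fmeasurableD)
    ultimately show ?thesis using T0(3) by linarith
  qed
  define K1 where "K1 = {{a..b} |a b. a < b \<and> {a..b} \<subseteq> O2 \<and> f b - f a < p * (b - a)}"
  have small: "\<exists>d>0. \<forall>a b. x \<in> {a..b} \<longrightarrow> b - a < d \<longrightarrow> {a..b} \<subseteq> U" if "open U" "x \<in> U" for U :: "real set" and x
  proof -
    obtain d where d: "d > 0" "ball x d \<subseteq> U" using \<open>open U\<close> \<open>x \<in> U\<close> open_contains_ball by blast
    show ?thesis
      by (rule exI[of _ d]) (use d in \<open>auto simp: ball_eq_greaterThanLessThan subset_iff\<close>)
  qed
  obtain D T1 where D: "finite D" "D \<subseteq> K1" "pairwise disjnt D" "E \<subseteq> \<Union>D \<union> T1"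
    "T1 \<in> lmeasurable" "measure lebesgue T1 < \<delta>"
  proof (rule Vitali_finite_intervals[of K1 E O2 \<delta>])
    fix x d :: real assume x: "x \<in> E" "0 < d"
    obtain d' where d': "d' > 0" "\<And>a b. x \<in> {a..b} \<Longrightarrow> b - a < d' \<Longrightarrow> {a..b} \<subseteq> O2"
      using small[OF O2(1), of x] x(1) O2(2) by auto
    obtain a b where ab: "a < b" "x \<in> {a..b}" "b - a < min d d'" "f b - f a < p * (b - a)"
      using lo[OF x(1), of "min d d'"] x d' by auto
    then have "{a..b} \<in> K1" using d'(2)[of a b] by (auto simp: K1_def)
    then show "\<exists>J\<in>K1. x \<in> J \<and> Sup J - Inf J < d" using ab by (intro bexI[of _ "{a..b}"]) auto
  next
    show "bounded O2" using O2(3) by (metis bounded_box box_real(1) bounded_subset)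
  qed (use \<delta>0 in \<open>auto simp: K1_def\<close>)
  define U where "U = (\<Union>J\<in>D. interior J)"
  have Dint: "\<exists>a b. a < b \<and> J = {a..b} \<and> {a..b} \<subseteq> O2 \<and> f b - f a < p * (b - a)" if "J \<in> D" for J
    using D(2) that by (auto simp: K1_def)
  \<comment> \<open>The second covering must stay inside open sets, so it sees only interiors. The
    points of \<open>E\<close> lost this way, outside \<open>T1\<close>, are among finitely many end
    points.\<close>
  have EU: "E - T1 - U \<subseteq> (\<Union>J\<in>D. {Inf J, Sup J})"
  proof
    fix x assume x: "x \<in> E - T1 - U"
    then obtain J where J: "J \<in> D" "x \<in> J" using D(4) by blast
    then obtain a b where ab: "a < b" "J = {a..b}" using Dint by blast
    have "x \<notin> {a<..<b}" using x J(1) ab by (auto simp: U_def)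
    then show "x \<in> (\<Union>J\<in>D. {Inf J, Sup J})" using J ab by (intro UN_I[of J]) auto
  qed
  define K2 where "K2 = {{a..b} |a b. a < b \<and> (\<exists>J\<in>D. {a..b} \<subseteq> interior J) \<and> f b - f a > q * (b - a)}"
  obtain D' T2 where D': "finite D'" "D' \<subseteq> K2" "pairwise disjnt D'" "E \<inter> U \<subseteq> \<Union>D' \<union> T2"
    "T2 \<in> lmeasurable" "measure lebesgue T2 < \<delta>"
  proof (rule Vitali_finite_intervals[of K2 "E \<inter> U" U \<delta>])
    fix x d :: real assume x: "x \<in> E \<inter> U" "0 < d"
    then obtain J where J: "J \<in> D" "x \<in> interior J" by (auto simp: U_def)
    obtain d' where d': "d' > 0" "\<And>a b. x \<in> {a..b} \<Longrightarrow> b - a < d' \<Longrightarrow> {a..b} \<subseteq> interior J"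
      using small[OF open_interior J(2)] by auto
    obtain a b where ab: "a < b" "x \<in> {a..b}" "b - a < min d d'" "f b - f a > q * (b - a)"
      using hi[of x "min d d'"] x d' by auto
    then have "{a..b} \<in> K2" using d'(2)[of a b] J(1) by (auto simp: K2_def)
    then show "\<exists>J\<in>K2. x \<in> J \<and> Sup J - Inf J < d" using ab by (intro bexI[of _ "{a..b}"]) auto
  next
    have "U \<subseteq> O2"
    proof
      fix x assume "x \<in> U"
      then obtain J where "J \<in> D" "x \<in> J" by (auto simp: U_def dest: interior_subset[THEN subsetD])
      then show "x \<in> O2" using Dint by blast
    qed
    then show "bounded U" using O2(3) by (metis bounded_box box_real(1) bounded_subset)
  qed (use \<delta>0 in \<open>auto simp: K2_def U_def\<close>)
  have D'int: "\<exists>a b. a < b \<and> J = {a..b} \<and> f b - f a > q * (b - a)" if "J \<in> D'" for J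
    using D'(2) that by (auto simp: K2_def)
  have D'sub: "\<exists>J\<in>D. I \<subseteq> interior J" if "I \<in> D'" for I
    using D'(2) that by (auto simp: K2_def)
  have Ddiv: "D division_of \<Union>D"
    by (rule division_of_disjoint_intervals[OF D(1,3)]) (use Dint in force)
  have D'div: "D' division_of \<Union>D'"
    by (rule division_of_disjoint_intervals[OF D'(1,3)]) (use D'int in force)
  define m where "m = measure lebesgue (\<Union>D)"
  define m' where "m' = measure lebesgue (\<Union>D')"
  have m_sum: "m = (\<Sum>J\<in>D. Sup J - Inf J)" unfolding m_def by (rule measure_division[OF Ddiv])
  have m'_sum: "m' = (\<Sum>J\<in>D'. Sup J - Inf J)" unfolding m'_def by (rule measure_division[OF D'div])
  have UDm: "\<Union>D \<in> lmeasurable" "\<Union>D' \<in> lmeasurable"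
    using D(1) D'(1) by (auto intro!: fmeasurable.finite_Union dest!: Dint D'int)
  have m_le: "m < s + 2 * \<delta>"
  proof -
    have "m \<le> measure lebesgue O2" unfolding m_def
      using Dint UDm O2m by (intro measure_mono_fmeasurable) (fastforce dest: fmeasurableD)+
    then show ?thesis using mO2 by linarith
  qed
  have UU: "\<Union>D' \<subseteq> \<Union>D" using D'sub interior_subset by blast
  have m'm: "m' \<le> m" unfolding m_def m'_def
    using UU UDm by (intro measure_mono_fmeasurable) (auto dest: fmeasurableD)
  have s_m': "s < m' + 2 * \<delta>"
  proof -
    let ?F = "\<Union>J\<in>D. {Inf J, Sup J}"
    have F: "?F \<in> lmeasurable" "measure lebesgue ?F = 0"
      using D(1) by (auto simp: negligible_finite negligible_imp_measurable negligible_imp_measure0)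
    have "s \<le> measure lebesgue (\<Union>D' \<union> T2 \<union> (T1 \<union> ?F))"
    proof (rule s_le)
      show "E \<subseteq> \<Union>D' \<union> T2 \<union> (T1 \<union> ?F)" using EU D'(4) by blast
      show "\<Union>D' \<union> T2 \<union> (T1 \<union> ?F) \<in> lmeasurable" using UDm D'(5) D(5) F by (intro fmeasurable.Un) auto
    qed
    also have "\<dots> \<le> measure lebesgue (\<Union>D' \<union> T2) + measure lebesgue (T1 \<union> ?F)"
      using UDm D'(5) D(5) F by (intro measure_Un_le sets.Un) (auto dest: fmeasurableD)
    also have "\<dots> \<le> (m' + measure lebesgue T2) + (measure lebesgue T1 + measure lebesgue ?F)"
      unfolding m'_def using UDm D'(5) D(5) F by (intro add_mono measure_Un_le) (auto dest: fmeasurableD)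
    finally show ?thesis using D'(6) D(6) F(2) by linarith
  qed
  \<comment> \<open>Within each \<open>J\<close> the second family is completed to a division of all
    of \<open>J\<close>. The added intervals \<open>R\<close> carry exactly the difference between
    the increments over \<open>D\<close> and over \<open>D'\<close>, and their total length is
    small.\<close>
  have "\<exists>r. {I\<in>D'. I \<subseteq> J} \<subseteq> r \<and> r division_of J" if J: "J \<in> D" for J
  proof -
    obtain a b where ab: "a < b" "J = {a..b}" using Dint[OF J] by blast
    have "{I\<in>D'. I \<subseteq> J} division_of \<Union>{I\<in>D'. I \<subseteq> J}"
      by (rule division_of_subset[OF D'div]) auto
    then obtain r where "{I\<in>D'. I \<subseteq> J} \<subseteq> r" "r division_of cbox a b"
      by (rule partial_division_extend_interval) (use ab in auto)
    then show ?thesis using ab by auto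
  qed
  then obtain r where r: "\<And>J. J \<in> D \<Longrightarrow> {I\<in>D'. I \<subseteq> J} \<subseteq> r J" "\<And>J. J \<in> D \<Longrightarrow> r J division_of J"
    by metis
  define Q where "Q = (\<Union>J\<in>D. r J)"
  have Dd: "J1 = J2" if "J1 \<in> D" "J2 \<in> D" "x \<in> J1" "x \<in> J2" for J1 J2 x
    using D(3) that by (auto simp: pairwise_def disjnt_def)
  have rdisj: "r J1 \<inter> r J2 = {}" if J12: "J1 \<in> D" "J2 \<in> D" "J1 \<noteq> J2" for J1 J2
  proof (rule ccontr)
    assume "r J1 \<inter> r J2 \<noteq> {}"
    then obtain I where I: "I \<in> r J1" "I \<in> r J2" by blast
    then have "I \<subseteq> J1" "I \<subseteq> J2" "I \<noteq> {}"
      using division_ofD(2,3)[OF r(2)[OF J12(1)]] division_ofD(2)[OF r(2)[OF J12(2)]] by auto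
    then show False using Dd[OF J12(1,2)] J12(3) by blast
  qed
  have Q_sum: "(\<Sum>I\<in>Q. g I) = (\<Sum>J\<in>D. \<Sum>I\<in>r J. g I)" for g :: "real set \<Rightarrow> real"
    unfolding Q_def using D(1) r(2) rdisj by (intro sum.UNION_disjoint) (auto intro: division_ofD(1))
  have D'Q: "D' \<subseteq> Q"
  proof
    fix I assume I: "I \<in> D'"
    then obtain J where "J \<in> D" "I \<subseteq> interior J" using D'sub by blast
    then show "I \<in> Q" using r(1)[of J] I interior_subset by (fastforce simp: Q_def)
  qed
  have Qdiv: "Q division_of \<Union>Q"
  proof (rule division_ofI)
    show "finite Q" using D(1) r(2) by (auto simp: Q_def intro: division_ofD(1))
  next
    fix I1 I2 assume "I1 \<in> Q" "I2 \<in> Q" and ne: "I1 \<noteq> I2"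
    then obtain J1 J2 where J: "J1 \<in> D" "I1 \<in> r J1" "J2 \<in> D" "I2 \<in> r J2" by (auto simp: Q_def)
    show "interior I1 \<inter> interior I2 = {}"
    proof (cases "J1 = J2")
      case True
      then show ?thesis using division_ofD(5)[OF r(2)[OF J(1)] J(2) _ ne] J by auto
    next
      case False
      have "I1 \<subseteq> J1" "I2 \<subseteq> J2"
        using division_ofD(2)[OF r(2)[OF J(1)] J(2)] division_ofD(2)[OF r(2)[OF J(3)] J(4)] by auto
      then have "I1 \<inter> I2 = {}" using Dd[OF J(1,3)] False by blast
      then show ?thesis using interior_subset by blast
    qed
  next
    fix I assume "I \<in> Q"
    then obtain J where J: "J \<in> D" "I \<in> r J" by (auto simp: Q_def)
    show "I \<noteq> {}" "\<exists>a b. I = cbox a b" "I \<subseteq> \<Union>Q"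
      using division_ofD(3,4)[OF r(2)[OF J(1)] J(2)] \<open>I \<in> Q\<close> by auto
  qed auto
  have incr: "(\<Sum>I\<in>Q. g (Sup I) - g (Inf I)) = (\<Sum>J\<in>D. g (Sup J) - g (Inf J))" for g :: "real \<Rightarrow> real"
    unfolding Q_sum
  proof (rule sum.cong[OF refl])
    fix J assume J: "J \<in> D"
    obtain a b where "a < b" "J = {a..b}" using Dint[OF J] by blast
    then show "(\<Sum>I\<in>r J. g (Sup I) - g (Inf I)) = g (Sup J) - g (Inf J)"
      using sum_division_increments[of a b "r J" g] r(2)[OF J] by simp
  qed
  define R where "R = Q - D'"
  have finQ: "finite Q" using Qdiv by (rule division_ofD(1))
  have split: "(\<Sum>I\<in>Q. g I) = (\<Sum>I\<in>R. g I) + (\<Sum>I\<in>D'. g I)" for g :: "real set \<Rightarrow> real"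
    unfolding R_def using D'Q finQ by (intro sum.subset_diff) auto
  have Rdiv: "R division_of \<Union>R" by (rule division_of_subset[OF Qdiv]) (auto simp: R_def)
  have Rlen: "(\<Sum>I\<in>R. Sup I - Inf I) = m - m'"
    using split[of "\<lambda>I. Sup I - Inf I"] incr[of "\<lambda>t. t"] by (simp add: m_sum m'_sum)
  have "\<Union>R \<subseteq> {u..v}"
  proof
    fix x assume "x \<in> \<Union>R"
    then obtain I J where "x \<in> I" "I \<in> r J" "J \<in> D" by (auto simp: R_def Q_def)
    then have "x \<in> J" "J \<in> D" using division_ofD(2)[OF r(2)[of J]] by auto
    then have "x \<in> O2" using Dint by blast
    then show "x \<in> {u..v}" using O2(3) by auto
  qed
  then have "(\<Sum>J\<in>R. cmod (complex_of_real (f (Sup J)) - complex_of_real (f (Inf J)))) < \<epsilon>"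
    using ac\<eta>[OF Rdiv] Rlen m_le s_m' \<delta>4 by linarith
  then have Rinc: "- \<epsilon> < (\<Sum>J\<in>R. f (Sup J) - f (Inf J))"
  proof -
    assume a: "(\<Sum>J\<in>R. cmod (complex_of_real (f (Sup J)) - complex_of_real (f (Inf J)))) < \<epsilon>"
    have "\<bar>\<Sum>J\<in>R. f (Sup J) - f (Inf J)\<bar> \<le> (\<Sum>J\<in>R. \<bar>f (Sup J) - f (Inf J)\<bar>)" by (rule sum_abs)
    also have "\<dots> = (\<Sum>J\<in>R. cmod (complex_of_real (f (Sup J)) - complex_of_real (f (Inf J))))"
      by (simp flip: of_real_diff)
    finally show ?thesis using a by linarith
  qed
  have up: "(\<Sum>J\<in>D. f (Sup J) - f (Inf J)) \<le> p * m"
    unfolding m_sum sum_distrib_left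
  proof (rule sum_mono)
    fix J assume "J \<in> D" then show "f (Sup J) - f (Inf J) \<le> p * (Sup J - Inf J)" using Dint[of J] by auto
  qed
  have low: "q * m' \<le> (\<Sum>J\<in>D'. f (Sup J) - f (Inf J))"
    unfolding m'_sum sum_distrib_left
  proof (rule sum_mono)
    fix J assume "J \<in> D'" then show "q * (Sup J - Inf J) \<le> f (Sup J) - f (Inf J)" using D'int[of J] by auto
  qed
  have "q * m' - \<epsilon> < p * m"
    using split[of "\<lambda>I. f (Sup I) - f (Inf I)"] incr[of f] Rinc up low by linarith
  then have "(q - p) * m' < p * (m - m') + \<epsilon>" by (simp add: algebra_simps)
  also have "p * (m - m') \<le> 4 * \<bar>p\<bar> * \<delta>"
  proof -
    have "p * (m - m') \<le> \<bar>p\<bar> * (m - m')" using m'm by (intro mult_right_mono) auto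
    also have "\<dots> \<le> \<bar>p\<bar> * (4 * \<delta>)" using m_le s_m' by (intro mult_left_mono) auto
    finally show ?thesis by (simp add: algebra_simps)
  qed
  also have "4 * \<bar>p\<bar> * \<delta> + \<epsilon> \<le> (q - p) * (s / 2)" using p\<delta> by (simp add: \<epsilon>_def field_simps)
  finally have "(q - p) * m' < (q - p) * (s / 2)" by simp
  then have "m' < s / 2" using pq by simp
  then show False using s_m' \<delta>(1) s_pos by linarith
qed

section \<open>Stability properties and continuity of absolutely continuous functions\<close>

lemma abs_cont_on_combine:
  assumes f: "abs_cont_on u v f" and g: "abs_cont_on u v g" and C: "0 \<le> C"
    and le: "\<And>s t. s \<in> {u..v} \<Longrightarrow> t \<in> {u..v} \<Longrightarrow> s \<le> t
       \<Longrightarrow> cmod (h t - h s) \<le> C * cmod (f t - f s) + C * cmod (g t - g s)"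
  shows "abs_cont_on u v h"
  unfolding abs_cont_on_def
proof (intro allI impI)
  fix \<epsilon> :: real assume "\<epsilon> > 0"
  then have e: "\<epsilon> / (2 * (C + 1)) > 0" using C by simp
  obtain \<delta>1 where \<delta>1: "\<delta>1 > 0" "\<And>D T. D division_of T \<Longrightarrow> T \<subseteq> {u..v} \<Longrightarrow> (\<Sum>J\<in>D. Sup J - Inf J) < \<delta>1
       \<Longrightarrow> (\<Sum>J\<in>D. cmod (f (Sup J) - f (Inf J))) < \<epsilon> / (2 * (C + 1))"
    using abs_cont_onD[OF f e] by blast
  obtain \<delta>2 where \<delta>2: "\<delta>2 > 0" "\<And>D T. D division_of T \<Longrightarrow> T \<subseteq> {u..v} \<Longrightarrow> (\<Sum>J\<in>D. Sup J - Inf J) < \<delta>2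
       \<Longrightarrow> (\<Sum>J\<in>D. cmod (g (Sup J) - g (Inf J))) < \<epsilon> / (2 * (C + 1))"
    using abs_cont_onD[OF g e] by blast
  show "\<exists>\<delta>>0. \<forall>D T. D division_of T \<longrightarrow> T \<subseteq> {u..v} \<longrightarrow> (\<Sum>J\<in>D. Sup J - Inf J) < \<delta> \<longrightarrow>
        (\<Sum>J\<in>D. cmod (h (Sup J) - h (Inf J))) < \<epsilon>"
  proof (intro exI[of _ "min \<delta>1 \<delta>2"] conjI allI impI)
    fix D T assume D: "D division_of T" "T \<subseteq> {u..v}" "(\<Sum>J\<in>D. Sup J - Inf J) < min \<delta>1 \<delta>2"
    have "(\<Sum>J\<in>D. cmod (h (Sup J) - h (Inf J)))
       \<le> (\<Sum>J\<in>D. C * cmod (f (Sup J) - f (Inf J)) + C * cmod (g (Sup J) - g (Inf J)))"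
    proof (rule sum_mono)
      fix J assume "J \<in> D"
      then obtain a b where "J = cbox a b" "J \<noteq> {}" "J \<subseteq> {u..v}"
        using division_ofD(2-4)[OF D(1)] D(2) by (metis order_trans)
      then show "cmod (h (Sup J) - h (Inf J)) \<le> C * cmod (f (Sup J) - f (Inf J)) + C * cmod (g (Sup J) - g (Inf J))"
        by (auto intro!: le)
    qed
    also have "\<dots> = C * (\<Sum>J\<in>D. cmod (f (Sup J) - f (Inf J))) + C * (\<Sum>J\<in>D. cmod (g (Sup J) - g (Inf J)))"
      by (simp add: sum_distrib_left sum.distrib)
    also have "\<dots> \<le> C * (\<epsilon> / (2 * (C + 1))) + C * (\<epsilon> / (2 * (C + 1)))"
      using \<delta>1(2)[OF D(1,2)] \<delta>2(2)[OF D(1,2)] D(3) C by (intro add_mono mult_left_mono) auto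
    also have "\<dots> < \<epsilon>"
    proof -
      define k where "k = \<epsilon> / (2 * (C + 1))"
      have "\<epsilon> = 2 * (C + 1) * k" using C by (simp add: k_def)
      then show ?thesis using e unfolding k_def[symmetric] by (simp add: algebra_simps)
    qed
    finally show "(\<Sum>J\<in>D. cmod (h (Sup J) - h (Inf J))) < \<epsilon>" .
  qed (use \<delta>1 \<delta>2 in auto)
qed

lemma abs_cont_on_increment_le:
  assumes f: "abs_cont_on u v f" and C: "0 \<le> C"
    and le: "\<And>s t. s \<in> {u..v} \<Longrightarrow> t \<in> {u..v} \<Longrightarrow> s \<le> t \<Longrightarrow> cmod (g t - g s) \<le> C * cmod (f t - f s)"
  shows "abs_cont_on u v g"
proof (rule abs_cont_on_combine[OF f f C])
  fix s t assume "s \<in> {u..v}" "t \<in> {u..v}" "s \<le> t"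
  from le[OF this] mult_nonneg_nonneg[OF C norm_ge_zero[of "f t - f s"]]
  show "cmod (g t - g s) \<le> C * cmod (f t - f s) + C * cmod (f t - f s)" by linarith
qed

lemma abs_cont_on_Re: "abs_cont_on u v f \<Longrightarrow> abs_cont_on u v (\<lambda>t. complex_of_real (Re (f t)))"
  by (rule abs_cont_on_increment_le[of u v f 1], assumption, simp)
    (use abs_Re_le_cmod[of "f b - f a" for a b] in \<open>simp flip: of_real_diff\<close>)

lemma abs_cont_on_Im: "abs_cont_on u v f \<Longrightarrow> abs_cont_on u v (\<lambda>t. complex_of_real (Im (f t)))"
  by (rule abs_cont_on_increment_le[of u v f 1], assumption, simp)
    (use abs_Im_le_cmod[of "f b - f a" for a b] in \<open>simp flip: of_real_diff\<close>)

lemma abs_cont_on_cnj: "abs_cont_on u v f \<Longrightarrow> abs_cont_on u v (\<lambda>t. cnj (f t))"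
  by (rule abs_cont_on_increment_le[of u v f 1], assumption, simp) (simp flip: complex_cnj_diff)

lemma abs_cont_on_Lipschitz:
  assumes "0 \<le> C" "\<And>s t. s \<in> {u..v} \<Longrightarrow> t \<in> {u..v} \<Longrightarrow> s \<le> t \<Longrightarrow> cmod (g t - g s) \<le> C * (t - s)"
  shows "abs_cont_on u v g"
proof (rule abs_cont_on_increment_le[of u v complex_of_real C])
  show "abs_cont_on u v complex_of_real"
    unfolding abs_cont_on_def
  proof (intro allI impI)
    fix \<epsilon> :: real assume "\<epsilon> > 0"
    show "\<exists>\<delta>>0. \<forall>D T. D division_of T \<longrightarrow> T \<subseteq> {u..v} \<longrightarrow> (\<Sum>J\<in>D. Sup J - Inf J) < \<delta> \<longrightarrow>
        (\<Sum>J\<in>D. cmod (complex_of_real (Sup J) - complex_of_real (Inf J))) < \<epsilon>"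
    proof (intro exI[of _ \<epsilon>] conjI allI impI)
      fix D T assume D: "D division_of T" "T \<subseteq> {u..v}" "(\<Sum>J\<in>D. Sup J - Inf J) < \<epsilon>"
      have "(\<Sum>J\<in>D. cmod (complex_of_real (Sup J) - complex_of_real (Inf J))) = (\<Sum>J\<in>D. Sup J - Inf J)"
      proof (rule sum.cong[OF refl])
        fix J assume "J \<in> D"
        then obtain a b where "J = cbox a b" "J \<noteq> {}" using division_ofD(3,4)[OF D(1)] by metis
        then show "cmod (complex_of_real (Sup J) - complex_of_real (Inf J)) = Sup J - Inf J"
          by (auto simp flip: of_real_diff)
      qed
      then show "(\<Sum>J\<in>D. cmod (complex_of_real (Sup J) - complex_of_real (Inf J))) < \<epsilon>" using D(3) by simp
    qed fact
  qed
  show "cmod (g t - g s) \<le> C * cmod (complex_of_real t - complex_of_real s)"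
    if "s \<in> {u..v}" "t \<in> {u..v}" "s \<le> t" for s t
    using assms(2)[OF that] that by (simp flip: of_real_diff)
qed fact

lemma abs_cont_on_imp_continuous_on:
  assumes "abs_cont_on u v f"
  shows "continuous_on {u..v} f"
  unfolding continuous_on_iff
proof (intro ballI allI impI)
  fix x \<epsilon> :: real assume x: "x \<in> {u..v}" and \<epsilon>: "\<epsilon> > 0"
  obtain \<delta> where \<delta>: "\<delta> > 0" "\<And>D T. D division_of T \<Longrightarrow> T \<subseteq> {u..v} \<Longrightarrow> (\<Sum>J\<in>D. Sup J - Inf J) < \<delta>
       \<Longrightarrow> (\<Sum>J\<in>D. cmod (f (Sup J) - f (Inf J))) < \<epsilon>"
    using abs_cont_onD[OF assms \<epsilon>] by blast
  have *: "cmod (f t - f s) < \<epsilon>" if "s \<le> t" "t - s < \<delta>" "s \<in> {u..v}" "t \<in> {u..v}" for s t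
  proof -
    have "{{s..t}} division_of {s..t}" using division_of_self[of s t] that(1) by simp
    then show ?thesis using \<delta>(2)[of "{{s..t}}" "{s..t}"] that by auto
  qed
  show "\<exists>d>0. \<forall>x'\<in>{u..v}. dist x' x < d \<longrightarrow> dist (f x') (f x) < \<epsilon>"
  proof (intro exI[of _ \<delta>] conjI ballI impI)
    fix y assume y: "y \<in> {u..v}" "dist y x < \<delta>"
    show "dist (f y) (f x) < \<epsilon>"
    proof (cases "x \<le> y")
      case True then show ?thesis using *[of x y] x y by (simp add: dist_norm)
    next
      case False then show ?thesis using *[of y x] x y by (simp add: dist_norm norm_minus_commute)
    qed
  qed (rule \<delta>)
qed

lemma abs_cont_on_diff:
  assumes "abs_cont_on u v f" "abs_cont_on u v g"
  shows "abs_cont_on u v (\<lambda>t. f t - g t)"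
proof (rule abs_cont_on_combine[OF assms, of 1])
  fix s t
  show "cmod (f t - g t - (f s - g s)) \<le> 1 * cmod (f t - f s) + 1 * cmod (g t - g s)"
    using norm_triangle_ineq4[of "f t - f s" "g t - g s"] by (simp add: algebra_simps)
qed simp

lemma abs_cont_on_mult:
  assumes f: "abs_cont_on u v f" and g: "abs_cont_on u v g"
  shows "abs_cont_on u v (\<lambda>t. f t * g t)"
proof -
  obtain A where A: "\<And>t. t \<in> {u..v} \<Longrightarrow> cmod (f t) \<le> A"
    using continuous_on_Icc_bounded[OF abs_cont_on_imp_continuous_on[OF f]] by blast
  obtain B where B: "\<And>t. t \<in> {u..v} \<Longrightarrow> cmod (g t) \<le> B"
    using continuous_on_Icc_bounded[OF abs_cont_on_imp_continuous_on[OF g]] by blast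
  define C where "C = max 0 (max A B)"
  show ?thesis
  proof (rule abs_cont_on_combine[OF f g, of C])
    fix s t assume st: "s \<in> {u..v}" "t \<in> {u..v}"
    have "f t * g t - f s * g s = (f t - f s) * g s + f t * (g t - g s)" by (simp add: algebra_simps)
    then have "cmod (f t * g t - f s * g s) \<le> cmod (f t - f s) * cmod (g s) + cmod (f t) * cmod (g t - g s)"
      by (metis norm_triangle_ineq norm_mult)
    also have "\<dots> \<le> cmod (f t - f s) * C + C * cmod (g t - g s)"
      using A[OF st(2)] B[OF st(1)] by (intro add_mono mult_left_mono mult_right_mono) (auto simp: C_def)
    finally show "cmod (f t * g t - f s * g s) \<le> C * cmod (f t - f s) + C * cmod (g t - g s)"
      by (simp add: mult.commute)
  qed (simp add: C_def)
qed

section \<open>Almost everywhere differentiability\<close>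

lemma abs_cont_infinite_slope_negligible:
  fixes f :: "real \<Rightarrow> real"
  assumes ac: "abs_cont_on u v (\<lambda>t. complex_of_real (f t))" and E: "E \<subseteq> {u<..<v}"
    and steep: "\<And>x d M. x \<in> E \<Longrightarrow> 0 < d \<Longrightarrow>
       \<exists>a b. a < b \<and> x \<in> {a..b} \<and> b - a < d \<and> \<bar>f b - f a\<bar> > M * (b - a)"
  shows "negligible E"
proof (rule locally_negligible_alt[THEN iffD2], rule ballI)
  obtain \<eta> where \<eta>: "\<eta> > 0" and ac\<eta>: "\<And>D T. D division_of T \<Longrightarrow> T \<subseteq> {u..v} \<Longrightarrow> (\<Sum>J\<in>D. Sup J - Inf J) < \<eta>
       \<Longrightarrow> (\<Sum>J\<in>D. cmod (complex_of_real (f (Sup J)) - complex_of_real (f (Inf J)))) < 1"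
    using abs_cont_onD[OF ac zero_less_one] by blast
  fix x0 assume x0: "x0 \<in> E"
  \<comment> \<open>Absolute continuity controls increments only for total length below \<eta>, so
    the argument is local: disjoint intervals inside a ball of diameter \<open>\<eta> / 2\<close>
    satisfy this automatically.\<close>
  define B where "B = ball x0 (\<eta> / 4) \<inter> {u<..<v}"
  have "negligible (E \<inter> B)"
    unfolding negligible_outer_le
  proof (intro allI impI)
    fix e :: real assume e: "e > 0"
    \<comment> \<open>Disjoint intervals of slope above \<open>2 / e\<close> whose increments add up
      to less than 1 have total length below \<open>e / 2\<close>; the other half of
      \<open>e\<close> is left for the remainder \<open>T\<close>.\<close>
    define K where "K = {{a..b} |a b. a < b \<and> {a..b} \<subseteq> B \<and> \<bar>f b - f a\<bar> > (2 / e) * (b - a)}"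
    obtain D T where D: "finite D" "D \<subseteq> K" "pairwise disjnt D" "E \<inter> B \<subseteq> \<Union>D \<union> T"
      "T \<in> lmeasurable" "measure lebesgue T < e / 2"
    proof (rule Vitali_finite_intervals[of K "E \<inter> B" B "e / 2"])
      fix x d :: real assume x: "x \<in> E \<inter> B" "0 < d"
      have "open B" by (auto simp: B_def)
      then obtain d' where d': "d' > 0" "ball x d' \<subseteq> B" using x open_contains_ball by blast
      obtain a b where ab: "a < b" "x \<in> {a..b}" "b - a < min d d'" "\<bar>f b - f a\<bar> > (2 / e) * (b - a)"
        using steep[of x "min d d'" "2 / e"] x d' by auto
      have "{a..b} \<subseteq> ball x d'" using ab by (auto simp: ball_eq_greaterThanLessThan)
      then have "{a..b} \<in> K" using ab d'(2) by (auto simp: K_def)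
      then show "\<exists>J\<in>K. x \<in> J \<and> Sup J - Inf J < d" using ab by (intro bexI[of _ "{a..b}"]) auto
    next
      show "bounded B" by (auto simp: B_def)
    qed (use e in \<open>auto simp: K_def\<close>)
    have Dint: "\<exists>a b. a < b \<and> J = {a..b} \<and> {a..b} \<subseteq> B \<and> \<bar>f b - f a\<bar> > (2 / e) * (b - a)" if "J \<in> D" for J
      using D(2) that by (auto simp: K_def)
    have div: "D division_of \<Union>D"
      by (rule division_of_disjoint_intervals[OF D(1,3)]) (use Dint in force)
    have UDm: "\<Union>D \<in> lmeasurable"
      using D(1) by (auto intro!: fmeasurable.finite_Union dest!: Dint)
    have m: "measure lebesgue (\<Union>D) = (\<Sum>J\<in>D. Sup J - Inf J)" by (rule measure_division[OF div])
    have UB: "\<Union>D \<subseteq> B" using Dint by blast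
    have "measure lebesgue (\<Union>D) \<le> measure lebesgue {x0 - \<eta> / 4..x0 + \<eta> / 4}"
      using UB UDm by (intro measure_mono_fmeasurable)
         (auto simp: B_def ball_eq_greaterThanLessThan subset_iff less_imp_le dest: fmeasurableD)
    then have "(\<Sum>J\<in>D. Sup J - Inf J) < \<eta>" using \<eta> m by simp
    moreover have "\<Union>D \<subseteq> {u..v}" using UB by (auto simp: B_def subset_iff less_imp_le)
    ultimately have "(\<Sum>J\<in>D. cmod (complex_of_real (f (Sup J)) - complex_of_real (f (Inf J)))) < 1"
      by (intro ac\<eta>[OF div])
    moreover have "(\<Sum>J\<in>D. (2 / e) * (Sup J - Inf J)) \<le> (\<Sum>J\<in>D. cmod (complex_of_real (f (Sup J)) - complex_of_real (f (Inf J))))"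
    proof (rule sum_mono)
      fix J assume "J \<in> D"
      then show "(2 / e) * (Sup J - Inf J) \<le> cmod (complex_of_real (f (Sup J)) - complex_of_real (f (Inf J)))"
        using Dint[of J] by (auto simp flip: of_real_diff)
    qed
    ultimately have "(2 / e) * measure lebesgue (\<Union>D) < 1" by (simp add: m sum_distrib_left)
    then have "measure lebesgue (\<Union>D) < e / 2" using e by (simp add: field_simps)
    moreover have "measure lebesgue (\<Union>D \<union> T) \<le> measure lebesgue (\<Union>D) + measure lebesgue T"
      using UDm D(5) by (intro measure_Un_le) (auto dest: fmeasurableD)
    ultimately show "\<exists>T. E \<inter> B \<subseteq> T \<and> T \<in> lmeasurable \<and> measure lebesgue T \<le> e"
      using D(4-6) UDm by (intro exI[of _ "\<Union>D \<union> T"]) auto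
  qed
  moreover have "openin (top_of_set E) (E \<inter> B)"
    by (rule openin_open_Int) (simp add: B_def open_Int)
  moreover have "x0 \<in> E \<inter> B" using x0 E \<eta> by (auto simp: B_def)
  ultimately show "\<exists>U. openin (top_of_set E) U \<and> x0 \<in> U \<and> negligible U" by (intro exI[of _ "E \<inter> B"] conjI)
qed

text \<open>Outside \<open>E\<close> the slopes of short intervals containing \<open>x\<close> are
  bounded, so a lower derivate is finite. If slopes at arbitrarily small scale stayed above it by a
  fixed amount, two rationals \<open>p < q\<close> would fit in between and place \<open>x\<close>
  in one of countably many null sets \<open>lo p \<inter> hi q\<close>.\<close>

lemma abs_cont_differentiable_ae_real:
  fixes f :: "real \<Rightarrow> real"
  assumes ac: "abs_cont_on u v (\<lambda>t. complex_of_real (f t))"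
  shows "negligible {x \<in> {u<..<v}. \<nexists>L. (f has_real_derivative L) (at x)}"
proof -
  define lo where "lo p = {x \<in> {u<..<v}. \<forall>d>0. \<exists>a b. a < b \<and> x \<in> {a..b} \<and> b - a < d \<and> f b - f a < p * (b - a)}" for p
  define hi where "hi q = {x \<in> {u<..<v}. \<forall>d>0. \<exists>a b. a < b \<and> x \<in> {a..b} \<and> b - a < d \<and> f b - f a > q * (b - a)}" for q
  define E where "E = {x \<in> {u<..<v}. \<forall>d>0. \<forall>M. \<exists>a b. a < b \<and> x \<in> {a..b} \<and> b - a < d \<and> \<bar>f b - f a\<bar> > M * (b - a)}"
  have negE: "negligible E"
    by (rule abs_cont_infinite_slope_negligible[OF ac]) (auto simp: E_def)
  have neg: "negligible (lo p \<inter> hi q)" if "p < q" for p q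
    by (rule abs_cont_slope_gap_negligible[OF ac that]) (auto simp: lo_def hi_def)
  define R where "R = {(p, q). p \<in> \<rat> \<and> q \<in> \<rat> \<and> p < (q::real)}"
  have "R \<subseteq> \<rat> \<times> \<rat>" by (auto simp: R_def)
  then have cR: "countable R" by (rule countable_subset) (intro countable_SIGMA countable_rat)
  have "negligible (E \<union> (\<Union>(p, q)\<in>R. lo p \<inter> hi q))"
    using negE cR by (intro negligible_Un negligible_countable_Union countable_image) (auto simp: R_def neg)
  moreover have "\<exists>L. (f has_real_derivative L) (at x)"
    if x: "x \<in> {u<..<v}" and nE: "x \<notin> E" and nR: "\<And>p q. (p, q) \<in> R \<Longrightarrow> x \<notin> lo p \<inter> hi q" for x
  proof -
    obtain d0 M where d0: "d0 > 0"
      "\<And>a b. a < b \<Longrightarrow> x \<in> {a..b} \<Longrightarrow> b - a < d0 \<Longrightarrow> \<bar>f b - f a\<bar> \<le> M * (b - a)"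
    proof -
      have "\<not> (\<forall>d>0. \<forall>M. \<exists>a b. a < b \<and> x \<in> {a..b} \<and> b - a < d \<and> \<bar>f b - f a\<bar> > M * (b - a))"
        using nE x unfolding E_def by blast
      then show ?thesis using that by (meson not_less)
    qed
    \<comment> \<open>The supremum of \<open>A\<close> is the lower derivate taken over short
      intervals containing \<open>x\<close>; it is the candidate for the derivative.\<close>
    define A where "A = {r. \<exists>d>0. \<forall>a b. a < b \<longrightarrow> x \<in> {a..b} \<longrightarrow> b - a < d \<longrightarrow> r * (b - a) \<le> f b - f a}"
    have A_ne: "- M \<in> A"
      unfolding A_def using d0(1) by (auto intro!: exI[of _ d0] dest!: d0(2))
    have A_le: "r \<le> M" if "r \<in> A" for r
    proof -
      obtain d where d: "d > 0" "\<And>a b. a < b \<Longrightarrow> x \<in> {a..b} \<Longrightarrow> b - a < d \<Longrightarrow> r * (b - a) \<le> f b - f a"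
        using \<open>r \<in> A\<close> unfolding A_def by auto
      define h where "h = min d d0 / 2"
      have h: "h > 0" "h < d" "h < d0" using d(1) d0(1) by (auto simp: h_def)
      have "r * h \<le> f (x + h) - f x" using d(2)[of x "x + h"] h by auto
      moreover have "\<bar>f (x + h) - f x\<bar> \<le> M * h" using d0(2)[of x "x + h"] h by auto
      ultimately have "r * h \<le> M * h" by linarith
      then show "r \<le> M" using h by simp
    qed
    have bdd: "bdd_above A" using A_le by (intro bdd_aboveI)
    define L where "L = Sup A"
    have "((\<lambda>y. (f y - f x) / (y - x)) \<longlongrightarrow> L) (at x)"
    proof (rule LIM_I)
      fix e :: real assume e: "e > 0"
      obtain r where r: "r \<in> A" "L - e / 2 < r"
        using less_cSupE[of "L - e / 2" A] A_ne e unfolding L_def by (metis diff_strict_left_mono diff_zero empty_iff half_gt_zero)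
      then obtain d1 where d1: "d1 > 0" "\<And>a b. a < b \<Longrightarrow> x \<in> {a..b} \<Longrightarrow> b - a < d1 \<Longrightarrow> r * (b - a) \<le> f b - f a"
        unfolding A_def by auto
      obtain p where p: "p \<in> \<rat>" "L < p" "p < L + e / 2" using Rats_dense_in_real[of L "L + e / 2"] e by auto
      obtain q where q: "q \<in> \<rat>" "p < q" "q < L + e / 2" using Rats_dense_in_real[of p "L + e / 2"] p by auto
      \<comment> \<open>Since \<open>p\<close> exceeds the lower derivate, slopes below
        \<open>p\<close> occur at every scale; avoiding the exceptional pair \<open>(p, q)\<close>
        then excludes slopes above \<open>q\<close> at small scale.\<close>
      have "p \<notin> A" using p(2) cSup_upper[OF _ bdd, of p] by (auto simp: L_def)
      then have "x \<in> lo p" unfolding lo_def A_def using x by (auto simp: not_le)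
      then have "x \<notin> hi q" using nR[of p q] p q by (auto simp: R_def)
      then obtain d2 where d2: "d2 > 0" "\<And>a b. a < b \<Longrightarrow> x \<in> {a..b} \<Longrightarrow> b - a < d2 \<Longrightarrow> f b - f a \<le> q * (b - a)"
      proof -
        have "\<not> (\<forall>d>0. \<exists>a b. a < b \<and> x \<in> {a..b} \<and> b - a < d \<and> f b - f a > q * (b - a))"
          using \<open>x \<notin> hi q\<close> x unfolding hi_def by blast
        then show ?thesis using that by (meson not_less)
      qed
      have slope: "(L - e / 2) * (b - a) \<le> f b - f a \<and> f b - f a \<le> (L + e / 2) * (b - a)"
        if ab: "a < b" "x \<in> {a..b}" "b - a < min d1 d2" for a b
      proof -
        have "(L - e / 2) * (b - a) \<le> r * (b - a)" using r ab by (intro mult_right_mono) auto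
        moreover have "q * (b - a) \<le> (L + e / 2) * (b - a)" using q ab by (intro mult_right_mono) auto
        moreover have "r * (b - a) \<le> f b - f a" "f b - f a \<le> q * (b - a)"
          using d1(2)[of a b] d2(2)[of a b] ab by auto
        ultimately show ?thesis by linarith
      qed
      have quot: "\<bar>(f y - f x) / (y - x) - L\<bar> \<le> e / 2" if y: "y \<noteq> x" "\<bar>y - x\<bar> < min d1 d2" for y
      proof (cases "x < y")
        case True
        then have "(L - e / 2) \<le> (f y - f x) / (y - x)" "(f y - f x) / (y - x) \<le> L + e / 2"
          using slope[of x y] y by (auto simp: pos_le_divide_eq pos_divide_le_eq)
        then show ?thesis by linarith
      next
        case False
        then have yx: "y < x" using y by auto
        have eq: "(f y - f x) / (y - x) = (f x - f y) / (x - y)"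
          using yx by (simp add: divide_simps) (simp add: algebra_simps)
        have "(L - e / 2) \<le> (f x - f y) / (x - y)" "(f x - f y) / (x - y) \<le> L + e / 2"
          using slope[of y x] y yx by (auto simp: pos_le_divide_eq pos_divide_le_eq)
        then show ?thesis unfolding eq by linarith
      qed
      show "\<exists>s>0. \<forall>y. y \<noteq> x \<and> norm (y - x) < s \<longrightarrow> norm ((f y - f x) / (y - x) - L) < e"
      proof (intro exI[of _ "min d1 d2"] conjI allI impI)
        fix y assume "y \<noteq> x \<and> norm (y - x) < min d1 d2"
        then show "norm ((f y - f x) / (y - x) - L) < e" using quot[of y] e by auto
      qed (use d1 d2 in auto)
    qed
    then show ?thesis by (auto simp: has_field_derivative_iff)
  qed
  ultimately show ?thesis
    by (elim negligible_subset) auto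
qed

lemma abs_cont_differentiable_ae:
  assumes ac: "abs_cont_on u v f"
  shows "negligible {x \<in> {u<..<v}. \<not> f differentiable (at x)}"
proof (rule negligible_subset)
  show "negligible ({x \<in> {u<..<v}. \<nexists>L. ((\<lambda>t. Re (f t)) has_real_derivative L) (at x)} \<union>
      {x \<in> {u<..<v}. \<nexists>L. ((\<lambda>t. Im (f t)) has_real_derivative L) (at x)})"
    by (intro negligible_Un abs_cont_differentiable_ae_real abs_cont_on_Re abs_cont_on_Im ac)
  show "{x \<in> {u<..<v}. \<not> f differentiable (at x)} \<subseteq>
      {x \<in> {u<..<v}. \<nexists>L. ((\<lambda>t. Re (f t)) has_real_derivative L) (at x)} \<union>
      {x \<in> {u<..<v}. \<nexists>L. ((\<lambda>t. Im (f t)) has_real_derivative L) (at x)}"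
  proof
    fix x assume x: "x \<in> {x \<in> {u<..<v}. \<not> f differentiable (at x)}"
    have False if "((\<lambda>t. Re (f t)) has_real_derivative K) (at x)" "((\<lambda>t. Im (f t)) has_real_derivative L) (at x)" for K L
    proof -
      have "(f has_vector_derivative Complex K L) (at x)"
        using that by (simp add: has_vector_derivative_complex_iff has_real_derivative_iff_has_vector_derivative)
      then show False using x by (auto simp: differentiableI_vector)
    qed
    then show "x \<in> {x \<in> {u<..<v}. \<nexists>L. ((\<lambda>t. Re (f t)) has_real_derivative L) (at x)} \<union>
      {x \<in> {u<..<v}. \<nexists>L. ((\<lambda>t. Im (f t)) has_real_derivative L) (at x)}" using x by blast
  qed
qed

section \<open>The fundamental theorem of calculus with a null exceptional set\<close>

lemma negligible_outer_open:
  fixes N :: "real set"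
  assumes "negligible N" "e > 0"
  obtains U where "open U" "N \<subseteq> U" "U \<in> lmeasurable" "measure lebesgue U < e"
proof -
  have N: "N \<in> lmeasurable" "measure lebesgue N = 0" using assms(1) by (auto simp: negligible_iff_measure)
  obtain U where U: "open U" "N \<subseteq> U" "U - N \<in> lmeasurable" "emeasure lebesgue (U - N) < ennreal e"
    using sets_lebesgue_outer_open[OF fmeasurableD[OF N(1)] assms(2)] by blast
  have "U = N \<union> (U - N)" using U by auto
  then have Um: "U \<in> lmeasurable" using N(1) U(3) by (metis fmeasurable.Un)
  have "measure lebesgue (U - N) < e"
    using U(3,4) assms(2) by (simp add: emeasure_eq_measure2 ennreal_less_iff)
  moreover have "measure lebesgue (N \<union> (U - N)) \<le> measure lebesgue N + measure lebesgue (U - N)"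
    using N U by (intro measure_Un_le) (auto dest: fmeasurableD)
  ultimately have "measure lebesgue U < e" using \<open>U = N \<union> (U - N)\<close> N(2) by simp
  then show ?thesis using that U Um by blast
qed

text \<open>
  Away from the exceptional set the gauge is given by differentiability; tags in the exceptional set
  have intervals inside an open set of small measure, where absolute continuity applies.
\<close>

lemma abs_cont_fundamental_theorem:
  assumes ac: "abs_cont_on u v f" and uv: "u \<le> v" and N: "negligible N"
    and der: "\<And>t. t \<in> {u..v} - N \<Longrightarrow> (f has_vector_derivative g t) (at t within {u..v})"
  shows "(g has_integral (f v - f u)) {u..v}"
proof (cases "u = v")
  case True then show ?thesis by auto
next
  case False
  then have uv': "u < v" using uv by simp
  \<comment> \<open>With the integrand set to zero on \<open>N\<close>, a tag in \<open>N\<close>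
    contributes to the error only the increment of \<open>f\<close> over its interval, which
    absolute continuity controls.\<close>
  define k where "k t = (if t \<in> N then 0 else g t)" for t
  have "(k has_integral (f v - f u)) {u..v}"
    unfolding has_integral_real
  proof (intro allI impI)
    fix e :: real assume e: "e > 0"
    define e1 where "e1 = e / (4 * (v - u))"
    have e1: "e1 > 0" using e uv' by (simp add: e1_def)
    have "e / 2 > 0" using e by simp
    obtain \<eta> where \<eta>: "\<eta> > 0" and ac\<eta>: "\<And>D T. D division_of T \<Longrightarrow> T \<subseteq> {u..v} \<Longrightarrow> (\<Sum>J\<in>D. Sup J - Inf J) < \<eta>
       \<Longrightarrow> (\<Sum>J\<in>D. cmod (f (Sup J) - f (Inf J))) < e / 2"
      using abs_cont_onD[OF ac \<open>e / 2 > 0\<close>] by blast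
    obtain U where U: "open U" "N \<subseteq> U" "U \<in> lmeasurable" "measure lebesgue U < \<eta>"
      using negligible_outer_open[OF N \<eta>] by blast
    have ex1: "\<exists>d>0. \<forall>y\<in>{u..v}. \<bar>y - x\<bar> < d \<longrightarrow> cmod (f y - f x - (y - x) *\<^sub>R k x) \<le> e1 * \<bar>y - x\<bar>"
      if "x \<in> {u..v} - N" for x
      using der[OF that] e1 that
      by (auto simp: has_vector_derivative_def has_derivative_within_alt k_def dist_norm)
    have ex2: "\<exists>d>0. ball x d \<subseteq> U" if "x \<in> N" for x
      using U that open_contains_ball by blast
    have "\<exists>d>0. (x \<in> N \<longrightarrow> ball x d \<subseteq> U) \<and> (x \<in> {u..v} - N \<longrightarrow>
       (\<forall>y\<in>{u..v}. \<bar>y - x\<bar> < d \<longrightarrow> cmod (f y - f x - (y - x) *\<^sub>R k x) \<le> e1 * \<bar>y - x\<bar>))" for x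
    proof (cases "x \<in> N")
      case True then show ?thesis using ex2[of x] by auto
    next
      case False
      show ?thesis
      proof (cases "x \<in> {u..v}")
        case True then show ?thesis using ex1[of x] False by auto
      next
        case F2: False then show ?thesis using False by (intro exI[of _ 1]) auto
      qed
    qed
    then obtain d where d: "\<And>x. d x > 0" "\<And>x. x \<in> N \<Longrightarrow> ball x (d x) \<subseteq> U"
      "\<And>x y. x \<in> {u..v} - N \<Longrightarrow> y \<in> {u..v} \<Longrightarrow> \<bar>y - x\<bar> < d x \<Longrightarrow> cmod (f y - f x - (y - x) *\<^sub>R k x) \<le> e1 * \<bar>y - x\<bar>"
      by metis
    show "\<exists>\<gamma>. gauge \<gamma> \<and> (\<forall>p. p tagged_division_of {u..v} \<and> \<gamma> fine p \<longrightarrow>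
        norm ((\<Sum>(x, K)\<in>p. measure lborel K *\<^sub>R k x) - (f v - f u)) < e)"
    proof (intro exI[of _ "\<lambda>x. ball x (d x)"] conjI allI impI)
      show "gauge (\<lambda>x. ball x (d x))" using d(1) by (intro gauge_ball_dependent) auto
      fix p assume p: "p tagged_division_of {u..v} \<and> (\<lambda>x. ball x (d x)) fine p"
      then have pt: "p tagged_division_of {u..v}" and fine: "(\<lambda>x. ball x (d x)) fine p" by auto
      note pD = tagged_division_ofD[OF pt]
      have int: "\<exists>a b. a \<le> b \<and> K = {a..b} \<and> x \<in> {a..b} \<and> a \<in> {u..v} \<and> b \<in> {u..v} \<and> {a..b} \<subseteq> ball x (d x)"
        if xK: "(x, K) \<in> p" for x K
      proof -
        obtain a b where K: "K = cbox a b" using pD(4)[OF xK] by blast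
        have "x \<in> K" "K \<subseteq> {u..v}" "K \<subseteq> ball x (d x)"
          using pD(2,3)[OF xK] fine xK by (auto simp: fine_def)
        then show ?thesis using K by (intro exI[of _ a] exI[of _ b]) auto
      qed
      define \<Delta> where "\<Delta> K = f (Sup K) - f (Inf K)" for K :: "real set"
      define p2 where "p2 = {(x, K) \<in> p. x \<in> N}"
      have p2: "p2 \<subseteq> p" by (auto simp: p2_def)
      have finp: "finite p" using pt by (rule tagged_division_ofD)
      have tot: "(\<Sum>(x, K)\<in>p. \<Delta> K) = f v - f u"
        using additive_tagged_division_1[OF uv pt, of f] by (simp add: \<Delta>_def)
      have len: "(\<Sum>(x, K)\<in>p. Sup K - Inf K) = v - u"
        using additive_tagged_division_1[OF uv pt, of "\<lambda>t. t"] by simp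
      have b1: "cmod (measure lborel K *\<^sub>R k x - \<Delta> K) \<le> e1 * (Sup K - Inf K)" if xK: "(x, K) \<in> p - p2" for x K
      proof -
        have xp: "(x, K) \<in> p" "x \<notin> N" using xK by (auto simp: p2_def)
        obtain a b where ab: "a \<le> b" "K = {a..b}" "x \<in> {a..b}" "a \<in> {u..v}" "b \<in> {u..v}" "{a..b} \<subseteq> ball x (d x)"
          using int[OF xp(1)] by blast
        have xuv: "x \<in> {u..v} - N" using ab xp by auto
        have "a \<in> ball x (d x)" "b \<in> ball x (d x)" using ab(1,6) by (meson atLeastAtMost_iff order_refl subsetD)+
        then have "\<bar>a - x\<bar> < d x" "\<bar>b - x\<bar> < d x" by (auto simp: dist_real_def)
        then have le: "cmod (f a - f x - (a - x) *\<^sub>R k x) \<le> e1 * (x - a)" "cmod (f b - f x - (b - x) *\<^sub>R k x) \<le> e1 * (b - x)"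
          using d(3)[OF xuv ab(4)] d(3)[OF xuv ab(5)] ab(3) by auto
        have "measure lborel K *\<^sub>R k x - \<Delta> K = (f a - f x - (a - x) *\<^sub>R k x) - (f b - f x - (b - x) *\<^sub>R k x)"
          using ab(1) unfolding ab(2) \<Delta>_def by (simp add: algebra_simps)
        then have "cmod (measure lborel K *\<^sub>R k x - \<Delta> K) \<le> e1 * (x - a) + e1 * (b - x)"
          by (simp only: order_trans[OF norm_triangle_ineq4 add_mono[OF le]])
        then show ?thesis using ab(1,2) by (simp add: algebra_simps)
      qed
      have b2: "(\<Sum>(x, K)\<in>p2. cmod (\<Delta> K)) < e / 2"
      proof -
        have pp: "p2 tagged_partial_division_of {u..v}"
          by (rule tagged_partial_division_subset[OF _ p2]) (use pt in \<open>simp add: tagged_division_of_def\<close>)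
        have tag: "p2 tagged_division_of \<Union>(snd ` p2)" by (rule tagged_partial_division_of_Union_self[OF pp])
        \<comment> \<open>Passing from tagged pairs to their intervals requires a summand that
          vanishes on boxes with empty interior. For a single point the increment is zero, but for
          the empty set \<open>Sup\<close> and \<open>Inf\<close> carry no information; hence the
          case distinction.\<close>
        have "(\<Sum>(x, K)\<in>p2. cmod (\<Delta> K)) = (\<Sum>K\<in>snd ` p2. if K = {} then 0 else cmod (\<Delta> K))"
        proof -
          have "(\<Sum>(x, K)\<in>p2. cmod (\<Delta> K)) = (\<Sum>(x, K)\<in>p2. if K = {} then 0 else cmod (\<Delta> K))"
            using int p2 by (intro sum.cong[OF refl]) force
          also have "\<dots> = (\<Sum>K\<in>snd ` p2. if K = {} then 0 else cmod (\<Delta> K))"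
            by (rule sum.over_tagged_division_lemma[OF tag]) (auto simp: \<Delta>_def box_real not_less)
          finally show ?thesis .
        qed
        also have "\<dots> \<le> (\<Sum>K\<in>snd ` p2. cmod (f (Sup K) - f (Inf K)))"
          by (intro sum_mono) (auto simp: \<Delta>_def)
        also have "\<dots> < e / 2"
        proof (rule ac\<eta>)
          show div: "snd ` p2 division_of \<Union>(snd ` p2)" by (rule division_of_tagged_division[OF tag])
          show "\<Union>(snd ` p2) \<subseteq> {u..v}" using pD(3) p2 by fastforce
          have "\<Union>(snd ` p2) \<subseteq> U"
          proof
            fix y assume "y \<in> \<Union>(snd ` p2)"
            then obtain x K where "(x, K) \<in> p2" "y \<in> K" by auto
            then have "y \<in> ball x (d x)" "x \<in> N" using int[of x K] by (auto simp: p2_def)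
            then show "y \<in> U" using d(2) by blast
          qed
          then have "measure lebesgue (\<Union>(snd ` p2)) \<le> measure lebesgue U"
            using U(3) lmeasurable_division[OF div] by (intro measure_mono_fmeasurable) (auto dest: fmeasurableD)
          then show "(\<Sum>J\<in>snd ` p2. Sup J - Inf J) < \<eta>"
            using measure_division[OF div] U(4) by linarith
        qed
        finally show ?thesis .
      qed
      have "(\<Sum>(x, K)\<in>p. measure lborel K *\<^sub>R k x) - (f v - f u) = (\<Sum>(x, K)\<in>p. measure lborel K *\<^sub>R k x - \<Delta> K)"
        unfolding tot[symmetric] by (simp add: sum_subtractf case_prod_beta)
      also have "\<dots> = (\<Sum>(x, K)\<in>p - p2. measure lborel K *\<^sub>R k x - \<Delta> K) + (\<Sum>(x, K)\<in>p2. measure lborel K *\<^sub>R k x - \<Delta> K)"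
        by (rule sum.subset_diff[OF p2 finp])
      also have "norm \<dots> \<le> (\<Sum>(x, K)\<in>p - p2. e1 * (Sup K - Inf K)) + (\<Sum>(x, K)\<in>p2. cmod (\<Delta> K))"
      proof (rule norm_triangle_mono)
        show "norm (\<Sum>(x, K)\<in>p - p2. measure lborel K *\<^sub>R k x - \<Delta> K) \<le> (\<Sum>(x, K)\<in>p - p2. e1 * (Sup K - Inf K))"
          by (rule sum_norm_le) (use b1 in auto)
        show "norm (\<Sum>(x, K)\<in>p2. measure lborel K *\<^sub>R k x - \<Delta> K) \<le> (\<Sum>(x, K)\<in>p2. cmod (\<Delta> K))"
          by (rule sum_norm_le) (auto simp: p2_def k_def)
      qed
      also have "(\<Sum>(x, K)\<in>p - p2. e1 * (Sup K - Inf K)) \<le> (\<Sum>(x, K)\<in>p. e1 * (Sup K - Inf K))"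
        using finp e1 by (intro sum_mono2) (auto dest!: int)
      also have "\<dots> = e1 * (v - u)"
        unfolding len[symmetric] by (simp add: sum_distrib_left case_prod_beta)
      also have "\<dots> = e / 4" using uv' by (simp add: e1_def divide_simps)
      finally show "norm ((\<Sum>(x, K)\<in>p. measure lborel K *\<^sub>R k x) - (f v - f u)) < e" using b2 e by linarith
    qed
  qed
  then show ?thesis
    by (rule has_integral_spike[OF N, rotated]) (auto simp: k_def)
qed

section \<open>The space \<open>L\<^sup>2\<close>\<close>

lemma L2_rel_refl_iff: "L2_rel f f \<longleftrightarrow> sq_integrable f"
  by (simp add: L2_rel_def)

lemma cinner_add_left: "cinner (F + G) H = cinner F H + cinner G H"
  by transfer (simp add: L2_rel_def distrib_right sq_integrable_prod_integrable)

lemma cinner_cscale_left: "cinner (cscale c F) G = c * cinner F G"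
  by transfer (simp add: mult.assoc)

lemma cinner_commute: "cinner G F = cnj (cinner F G)"
proof transfer
  fix g f assume "L2_rel g g" "L2_rel f f"
  have "(\<integral>t. g t * cnj (f t) \<partial>lebesgue) = (\<integral>t. cnj (f t * cnj (g t)) \<partial>lebesgue)"
    by (simp add: mult.commute)
  also have "\<dots> = cnj (\<integral>t. f t * cnj (g t) \<partial>lebesgue)"
    by (rule Bochner_Integration.integral_cnj)
  finally show "(\<integral>t. g t * cnj (f t) \<partial>lebesgue) = cnj (\<integral>t. f t * cnj (g t) \<partial>lebesgue)" .
qed

lemma cinner_add_right: "cinner H (F + G) = cinner H F + cinner H G"
  by (simp add: cinner_commute[of H] cinner_add_left)

lemma cinner_cscale_right: "cinner F (cscale c G) = cnj c * cinner F G"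
  by (simp add: cinner_commute[of F] cinner_cscale_left)

lemma cinner_diff_left: "cinner (F - G) H = cinner F H - cinner G H"
  unfolding minus_L2_def cinner_add_left cinner_cscale_left by simp

lemma cinner_diff_right: "cinner H (F - G) = cinner H F - cinner H G"
  unfolding minus_L2_def cinner_add_right cinner_cscale_right by simp

lemma cinner_zero_left [simp]: "cinner 0 G = 0"
  using cinner_cscale_left[of 0 0 G] by simp

lemma cinner_zero_right [simp]: "cinner G 0 = 0"
  using cinner_commute[of G 0] by simp

lemma cinner_self_eq_0: "cinner F F = 0 \<Longrightarrow> F = 0"
  using inner_eq_zero_iff[of F] by (simp add: inner_L2_def)

text \<open>Continuity is available for the real inner product of the type class; expressing the
  complex product through it transfers limits and closedness arguments.\<close>

lemma cinner_conv_inner: "cinner F G = Complex (inner F G) (inner (cscale (- \<i>) F) G)"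
proof -
  have "inner (cscale (- \<i>) F) G = Re (- \<i> * cinner F G)"
    by (simp only: inner_L2_def cinner_cscale_left)
  then show ?thesis by (simp add: inner_L2_def complex_eq_iff)
qed

lemma norm_cscale: "norm (cscale c F) = cmod c * norm F"
proof -
  have "inner (cscale c F) (cscale c F) = (cmod c)\<^sup>2 * inner F F"
  proof -
    have "cinner (cscale c F) (cscale c F) = (c * cnj c) * cinner F F"
      by (simp only: cinner_cscale_left cinner_cscale_right mult.assoc mult.left_commute)
    then show ?thesis
      unfolding inner_L2_def by (simp add: complex_norm_square[symmetric] del: of_real_power complex_mult_cnj)
  qed
  then show ?thesis by (simp add: norm_eq_sqrt_inner real_sqrt_mult)
qed

lemma tendsto_cscale [tendsto_intros]:
  assumes "(f \<longlongrightarrow> F) net"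
  shows "((\<lambda>n. cscale c (f n)) \<longlongrightarrow> cscale c F) net"
  by (rule bounded_linear.tendsto[OF _ assms], unfold_locales)
    (auto simp: cL2.scale_right_distrib scaleR_L2_def mult.commute norm_cscale intro: exI[of _ "cmod c"])

lemma tendsto_cinner [tendsto_intros]:
  assumes "(f \<longlongrightarrow> F) net" "(g \<longlongrightarrow> G) net"
  shows "((\<lambda>n. cinner (f n) (g n)) \<longlongrightarrow> cinner F G) net"
  unfolding cinner_conv_inner using assms by (intro tendsto_intros)

lemma continuous_on_cinner [continuous_intros]:
  assumes "continuous_on S f" "continuous_on S g"
  shows "continuous_on S (\<lambda>x. cinner (f x) (g x))"
  using assms unfolding continuous_on_def by (auto intro: tendsto_cinner)

lemma continuous_on_cscale [continuous_intros]:
  assumes "continuous_on S f"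
  shows "continuous_on S (\<lambda>x. cscale c (f x))"
  using assms unfolding continuous_on_def by (auto intro: tendsto_cscale)

lemma orthogonal_to_dense_eq_0:
  assumes "F \<in> K" "K \<subseteq> closure A" "\<And>G. G \<in> A \<Longrightarrow> cinner G F = 0"
  shows "F = 0"
proof -
  have "closed {G. cinner G F = 0}"
    by (intro closed_Collect_eq continuous_intros)
  then have "closure A \<subseteq> {G. cinner G F = 0}"
    using assms(3) by (intro closure_minimal) auto
  then show ?thesis using assms(1,2) by (intro cinner_self_eq_0) auto
qed

text \<open>No measurability of \<open>g\<close> is assumed: completeness of Lebesgue measure
  supplies it. This permits arbitrary values at the interaction points and wherever a second
  derivative fails to exist.\<close>

lemma sq_integrable_cong_AE:
  assumes "sq_integrable f" "AE t in lebesgue. f t = g t"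
  shows "sq_integrable g"
proof -
  have [measurable]: "f \<in> borel_measurable lebesgue" using assms(1) by (simp add: sq_integrable_def)
  have [measurable]: "g \<in> borel_measurable lebesgue"
  proof (rule measurableI)
    fix A :: "complex set" assume A: "A \<in> sets borel"
    have "f -` A \<inter> space lebesgue \<in> sets lebesgue" using A by measurable
    then show "g -` A \<inter> space lebesgue \<in> sets lebesgue"
      by (rule completion.in_sets_AE[rotated]) (use assms(2) in \<open>auto elim!: eventually_mono\<close>)
  qed auto
  have "integrable lebesgue (\<lambda>t. (cmod (g t))\<^sup>2) \<longleftrightarrow> integrable lebesgue (\<lambda>t. (cmod (f t))\<^sup>2)"
    using assms(2) by (intro integrable_cong_AE) (auto elim!: eventually_mono)
  then show ?thesis using assms(1) by (simp add: sq_integrable_def)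
qed

section \<open>Functions on a subset of the line as elements of the Hilbert space\<close>

lemma to_L2_eq_iff:
  assumes "sq_integrable_on S f" "sq_integrable_on S g"
  shows "to_L2 S f = to_L2 S g \<longleftrightarrow> (AE t in lebesgue. t \<in> S \<longrightarrow> f t = g t)"
proof -
  have "L2_rel (\<lambda>t. if t \<in> S then f t else 0) (\<lambda>t. if t \<in> S then f t else 0)"
    "L2_rel (\<lambda>t. if t \<in> S then g t else 0) (\<lambda>t. if t \<in> S then g t else 0)"
    using assms by (auto simp: L2_rel_refl_iff sq_integrable_on_def)
  then have "to_L2 S f = to_L2 S g \<longleftrightarrow> L2_rel (\<lambda>t. if t \<in> S then f t else 0) (\<lambda>t. if t \<in> S then g t else 0)"
    unfolding to_L2_def
    using Quotient3_rel[OF Quotient3_L2, of "\<lambda>t. if t \<in> S then f t else 0" "\<lambda>t. if t \<in> S then g t else 0"]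
    by blast
  also have "\<dots> \<longleftrightarrow> (AE t in lebesgue. t \<in> S \<longrightarrow> f t = g t)"
    using assms by (auto simp: L2_rel_def sq_integrable_on_def elim!: eventually_mono split: if_splits)
  finally show ?thesis .
qed

lemma cinner_to_L2:
  assumes "sq_integrable_on S f" "sq_integrable_on S g"
  shows "cinner (to_L2 S f) (to_L2 S g) = (\<integral>t. (if t \<in> S then f t * cnj (g t) else 0) \<partial>lebesgue)"
  using assms unfolding to_L2_def sq_integrable_on_def
  by (subst cinner.abs_eq) (auto simp: L2_rel_refl_iff intro!: Bochner_Integration.integral_cong)

lemma to_L2_add:
  assumes "sq_integrable_on S f" "sq_integrable_on S g"
  shows "to_L2 S f + to_L2 S g = to_L2 S (\<lambda>t. f t + g t)"
  using assms unfolding to_L2_def sq_integrable_on_def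
  by (subst plus_L2.abs_eq) (auto simp: L2_rel_refl_iff intro!: arg_cong[of _ _ abs_L2])

lemma to_L2_cscale:
  assumes "sq_integrable_on S f"
  shows "cscale c (to_L2 S f) = to_L2 S (\<lambda>t. c * f t)"
  using assms unfolding to_L2_def sq_integrable_on_def
  by (subst cscale.abs_eq) (auto simp: L2_rel_refl_iff intro!: arg_cong[of _ _ abs_L2])

lemma sq_integrable_on_add:
  assumes "sq_integrable_on S f" "sq_integrable_on S g"
  shows "sq_integrable_on S (\<lambda>t. f t + g t)"
  using sq_integrable_add[OF assms[unfolded sq_integrable_on_def]]
  unfolding sq_integrable_on_def by (rule back_subst[of sq_integrable]) auto

lemma sq_integrable_on_cmult:
  assumes "sq_integrable_on S f"
  shows "sq_integrable_on S (\<lambda>t. c * f t)"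
  using sq_integrable_cmult[OF assms[unfolded sq_integrable_on_def], of c]
  unfolding sq_integrable_on_def by (rule back_subst[of sq_integrable]) auto

lemma sq_integrable_on_diff:
  assumes "sq_integrable_on S f" "sq_integrable_on S g"
  shows "sq_integrable_on S (\<lambda>t. f t - g t)"
  using sq_integrable_on_add[OF assms(1) sq_integrable_on_cmult[OF assms(2), of "-1"]] by simp

lemma to_L2_diff:
  assumes "sq_integrable_on S f" "sq_integrable_on S g"
  shows "to_L2 S f - to_L2 S g = to_L2 S (\<lambda>t. f t - g t)"
  unfolding minus_L2_def to_L2_cscale[OF assms(2)]
  by (subst to_L2_add) (simp_all add: assms sq_integrable_on_cmult[where c = "-1", simplified])

lemma to_L2_in_L2_on:
  assumes "sq_integrable_on S f"
  shows "to_L2 S f \<in> L2_on S"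
  using assms unfolding L2_on_def to_L2_def sq_integrable_on_def mem_Collect_eq
  by (subst vanishes_off.abs_eq) (auto simp: L2_rel_refl_iff)

lemma L2_on_obtain:
  assumes "F \<in> L2_on S"
  obtains f where "sq_integrable_on S f" "F = to_L2 S f"
proof -
  have r: "L2_rel (rep_L2 F) (rep_L2 F)" and a: "abs_L2 (rep_L2 F) = F"
    using Quotient3_rep_reflp[OF Quotient3_L2] Quotient3_abs_rep[OF Quotient3_L2] by auto
  have ae: "AE t in lebesgue. t \<notin> S \<longrightarrow> rep_L2 F t = 0"
    using assms vanishes_off.abs_eq[OF r] a by (simp add: L2_on_def)
  then have eq: "AE t in lebesgue. rep_L2 F t = (if t \<in> S then rep_L2 F t else 0)"
    by (auto elim!: eventually_mono)
  have "sq_integrable (\<lambda>t. if t \<in> S then rep_L2 F t else 0)"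
    by (rule sq_integrable_cong_AE[OF _ eq]) (use r in \<open>simp add: L2_rel_refl_iff\<close>)
  then have s: "sq_integrable_on S (rep_L2 F)" by (simp add: sq_integrable_on_def)
  have "L2_rel (rep_L2 F) (\<lambda>t. if t \<in> S then rep_L2 F t else 0)"
    using s r eq by (simp add: L2_rel_def sq_integrable_on_def)
  then have "F = to_L2 S (rep_L2 F)"
    unfolding to_L2_def using a Quotient3_rel_abs[OF Quotient3_L2] by (metis (no_types))
  then show ?thesis using that s by blast
qed

lemma norm_to_L2:
  assumes "sq_integrable_on S f"
  shows "(norm (to_L2 S f))\<^sup>2 = (\<integral>t. (if t \<in> S then (cmod (f t))\<^sup>2 else 0) \<partial>lebesgue)"
proof -
  have "of_real ((norm (to_L2 S f))\<^sup>2) = cinner (to_L2 S f) (to_L2 S f)"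
    unfolding power2_norm_eq_inner inner_L2_def
    using cinner_commute[of "to_L2 S f" "to_L2 S f"] by (simp add: complex_eq_iff)
  also have "\<dots> = (\<integral>t. complex_of_real (if t \<in> S then (cmod (f t))\<^sup>2 else 0) \<partial>lebesgue)"
    unfolding cinner_to_L2[OF assms assms]
    by (rule Bochner_Integration.integral_cong) (simp_all add: complex_norm_square del: of_real_power)
  also have "\<dots> = of_real (\<integral>t. (if t \<in> S then (cmod (f t))\<^sup>2 else 0) \<partial>lebesgue)"
    by (rule integral_complex_of_real)
  finally show ?thesis by (simp only: of_real_eq_iff)
qed

lemma vanishes_off_cinner_eq_0: "vanishes_off S F \<Longrightarrow> vanishes_off (- S) G \<Longrightarrow> cinner F G = 0"
proof transfer
  fix S and f g :: "real \<Rightarrow> complex"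
  assume "AE t in lebesgue. t \<notin> S \<longrightarrow> f t = 0" "AE t in lebesgue. t \<notin> - S \<longrightarrow> g t = 0"
  then have "AE t in lebesgue. f t * cnj (g t) = 0" by eventually_elim auto
  then show "(\<integral>t. f t * cnj (g t) \<partial>lebesgue) = 0" by (rule integral_eq_zero_AE)
qed

text \<open>The subspace is the orthogonal complement of \<open>L2_on (- S)\<close>, hence an
  intersection of kernels of continuous functionals. For the nontrivial inclusion an element is
  tested against its own restriction to \<open>- S\<close>.\<close>

lemma closed_L2_on:
  assumes "S \<in> sets lebesgue"
  shows "closed (L2_on S)"
proof -
  have sqC: "sq_integrable (\<lambda>t. if t \<in> - S then f t else 0)" if f: "sq_integrable f" for f :: "real \<Rightarrow> complex"
  proof -
    have [measurable]: "f \<in> borel_measurable lebesgue" "S \<in> sets lebesgue"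
      using f assms by (auto simp: sq_integrable_def)
    have "integrable lebesgue (\<lambda>t. (cmod (if t \<in> - S then f t else 0))\<^sup>2)"
      by (rule Bochner_Integration.integrable_bound[of _ "\<lambda>t. (cmod (f t))\<^sup>2"])
        (use f in \<open>auto simp: sq_integrable_def\<close>)
    then show ?thesis by (simp add: sq_integrable_def)
  qed
  have "L2_on S = {F. \<forall>G\<in>L2_on (- S). cinner F G = 0}"
  proof (intro set_eqI iffI)
    fix F assume "F \<in> L2_on S"
    then show "F \<in> {F. \<forall>G\<in>L2_on (- S). cinner F G = 0}"
      by (auto simp: L2_on_def vanishes_off_cinner_eq_0)
  next
    fix F assume F: "F \<in> {F. \<forall>G\<in>L2_on (- S). cinner F G = 0}"
    have r: "L2_rel (rep_L2 F) (rep_L2 F)" and a: "abs_L2 (rep_L2 F) = F"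
      using Quotient3_rep_reflp[OF Quotient3_L2] Quotient3_abs_rep[OF Quotient3_L2] by auto
    define f where "f = rep_L2 F"
    have f: "sq_integrable f" using r by (simp add: f_def L2_rel_refl_iff)
    have fC: "sq_integrable_on (- S) f" using sqC[OF f] by (simp add: sq_integrable_on_def)
    have "0 = cinner F (to_L2 (- S) f)" using F to_L2_in_L2_on[OF fC] by auto
    also have "\<dots> = (\<integral>t. f t * cnj (if t \<in> - S then f t else 0) \<partial>lebesgue)"
    proof -
      have "cinner (abs_L2 f) (abs_L2 (\<lambda>t. if t \<in> - S then f t else 0))
          = (\<integral>t. f t * cnj (if t \<in> - S then f t else 0) \<partial>lebesgue)"
        by (rule cinner.abs_eq) (use f sqC[OF f] in \<open>auto simp: L2_rel_refl_iff\<close>)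
      then show ?thesis using a by (simp only: to_L2_def f_def)
    qed
    also have "\<dots> = (\<integral>t. (if t \<in> - S then f t * cnj (f t) else 0) \<partial>lebesgue)"
      by (rule Bochner_Integration.integral_cong) auto
    also have "\<dots> = cinner (to_L2 (- S) f) (to_L2 (- S) f)"
      by (rule cinner_to_L2[symmetric, OF fC fC])
    finally have "to_L2 (- S) f = 0" by (intro cinner_self_eq_0) simp
    then have "to_L2 (- S) f = to_L2 (- S) (\<lambda>t. 0)"
      by (simp add: to_L2_def zero_L2.abs_eq)
    then have "AE t in lebesgue. t \<in> - S \<longrightarrow> f t = 0"
      using fC by (subst (asm) to_L2_eq_iff) (auto simp: sq_integrable_on_def)
    then show "F \<in> L2_on S"
      using vanishes_off.abs_eq[OF r] a by (simp add: L2_on_def f_def)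
  qed
  also have "\<dots> = (\<Inter>G\<in>L2_on (- S). {F. cinner F G = 0})" by auto
  also have "closed \<dots>"
    by (intro closed_INT ballI closed_Collect_eq continuous_intros)
  finally show ?thesis .
qed

lemma tendsto_to_L2_dominated:
  assumes f: "\<And>n. sq_integrable_on S (f n)" and g: "sq_integrable_on S g"
    and w: "integrable lebesgue (\<lambda>t. (w t)\<^sup>2)"
    and lim: "AE t in lebesgue. t \<in> S \<longrightarrow> (\<lambda>n. f n t) \<longlonglongrightarrow> g t"
    and dom: "\<And>n. AE t in lebesgue. t \<in> S \<longrightarrow> cmod (f n t - g t) \<le> w t"
  shows "(\<lambda>n. to_L2 S (f n)) \<longlonglongrightarrow> to_L2 S g"
proof -
  define h where "h n t = (if t \<in> S then (cmod (f n t - g t))\<^sup>2 else 0)" for n t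
  have h: "integrable lebesgue (h n)" for n
  proof -
    have "integrable lebesgue (\<lambda>t. (cmod (if t \<in> S then f n t - g t else 0))\<^sup>2)"
      using sq_integrable_on_diff[OF f g, of n] by (simp add: sq_integrable_on_def sq_integrable_def)
    moreover have "h n = (\<lambda>t. (cmod (if t \<in> S then f n t - g t else 0))\<^sup>2)"
      by (rule ext) (simp add: h_def)
    ultimately show ?thesis by simp
  qed
  have "(\<lambda>n. \<integral>t. h n t \<partial>lebesgue) \<longlonglongrightarrow> (\<integral>t. 0 \<partial>(lebesgue :: real measure))"
  proof (rule integral_dominated_convergence[where w = "\<lambda>t. (w t)\<^sup>2"])
    show "AE t in lebesgue. (\<lambda>n. h n t) \<longlonglongrightarrow> 0"
      using lim
    proof eventually_elim
      case (elim t)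
      show ?case
      proof (cases "t \<in> S")
        case True
        then have "(\<lambda>n. (cmod (f n t - g t))\<^sup>2) \<longlonglongrightarrow> (cmod (g t - g t))\<^sup>2"
          using elim by (intro tendsto_intros) auto
        then show ?thesis using True by (simp add: h_def)
      qed (simp add: h_def)
    qed
    show "AE t in lebesgue. norm (h n t) \<le> (w t)\<^sup>2" for n
      using dom[of n] by eventually_elim (auto simp: h_def intro: power_mono)
  qed (use w h in auto)
  then have "(\<lambda>n. (norm (to_L2 S (f n) - to_L2 S g))\<^sup>2) \<longlonglongrightarrow> 0"
    using norm_to_L2[OF sq_integrable_on_diff[OF f g]] by (simp add: to_L2_diff f g h_def)
  then have "(\<lambda>n. sqrt ((norm (to_L2 S (f n) - to_L2 S g))\<^sup>2)) \<longlonglongrightarrow> sqrt 0"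
    by (rule tendsto_real_sqrt)
  then have "(\<lambda>n. norm (to_L2 S (f n) - to_L2 S g)) \<longlonglongrightarrow> 0" by simp
  then show ?thesis by (subst LIM_zero_iff[symmetric]) (rule tendsto_norm_zero_cancel)
qed

section \<open>The segments between the interaction points\<close>

lemma sq_integrable_on_continuous_Icc:
  assumes "continuous_on {u..v} f"
  shows "sq_integrable (\<lambda>t. if t \<in> {u..<v} then f t else 0)"
proof -
  have m: "(\<lambda>t. if t \<in> {u..v} then f t else 0) \<in> borel_measurable borel"
    by (rule borel_measurable_continuous_on_if) (use assms in \<open>auto intro: continuous_intros\<close>)
  have "(\<lambda>t. if t \<in> {u..<v} then (if t \<in> {u..v} then f t else 0) else 0) \<in> borel_measurable borel"
    by (intro measurable_If m) auto
  then have m': "(\<lambda>t. if t \<in> {u..<v} then f t else 0) \<in> borel_measurable borel"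
    by (rule back_subst[of "\<lambda>h. h \<in> borel_measurable borel"]) auto
  then have m2: "(\<lambda>t. if t \<in> {u..<v} then f t else 0) \<in> borel_measurable lebesgue"
    by (simp add: measurable_completion)
  obtain B where B: "\<And>t. t \<in> {u..v} \<Longrightarrow> cmod (f t) \<le> B"
    using continuous_on_Icc_bounded[OF assms] by blast
  have "integrable lebesgue (\<lambda>t. (cmod (if t \<in> {u..<v} then f t else 0))\<^sup>2)"
  proof (rule Bochner_Integration.integrable_bound)
    show "integrable lebesgue (\<lambda>t. indicator {u..v} t * B\<^sup>2 :: real)"
      by (intro integrable_mult_left integrable_real_indicator) (auto simp: emeasure_lborel_Icc_eq)
    show "AE t in lebesgue. norm ((cmod (if t \<in> {u..<v} then f t else 0))\<^sup>2) \<le> norm (indicator {u..v} t * B\<^sup>2 :: real)"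
      using B by (auto simp: indicator_def intro!: power_mono)
  qed (use m2 in measurable)
  then show ?thesis using m2 by (simp add: sq_integrable_def)
qed

locale interaction_points =
  fixes b :: ereal and x :: "nat \<Rightarrow> real"
  assumes x_zero: "x 0 = 0"
    and x_incr: "strict_mono x"
    and x_less: "\<And>n. ereal (x n) < b"
    and x_lim: "(\<lambda>n. ereal (x n)) \<longlonglongrightarrow> b"
begin

abbreviation "I \<equiv> halfopen_interval b"
abbreviation "X \<equiv> x ` {1..}"

text \<open>The index of the segment \<open>[x\<^sub>n, x\<^sub>n\<^sub>+\<^sub>1)\<close> containing \<open>t\<close>; it is \<open>0\<close> to the left of \<open>0\<close>.\<close>

definition seg :: "real \<Rightarrow> nat" where
  "seg t = (LEAST n. t < x (Suc n))"

text \<open>Each piece is a function on the whole line, so one-sided limits of the glued function at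
  an interaction point can be read off from two-sided continuity of the adjacent pieces.\<close>

definition glue :: "(nat \<Rightarrow> real \<Rightarrow> 'a) \<Rightarrow> real \<Rightarrow> 'a" where
  "glue F t = F (seg t) t"

lemma x_less_iff [simp]: "x m < x n \<longleftrightarrow> m < n"
  using x_incr by (simp add: strict_mono_less)

lemma x_le_iff [simp]: "x m \<le> x n \<longleftrightarrow> m \<le> n"
  using x_incr by (simp add: strict_mono_less_eq)

lemma x_nonneg [simp]: "0 \<le> x n"
  using x_le_iff[of 0 n] by (simp add: x_zero)

lemma x_pos [simp]: "0 < x (Suc n)"
  using x_less_iff[of 0 "Suc n"] by (simp add: x_zero)

lemma ex_greater: "ereal t < b \<Longrightarrow> \<exists>n. t < x n"
  using order_tendstoD(1)[OF x_lim, of "ereal t"] by (auto simp: eventually_sequentially)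

lemma less_b: "t \<le> x n \<Longrightarrow> ereal t < b"
  using x_less[of n] by (meson ereal_less_eq(3) le_less_trans)

lemma seg_upper:
  assumes "ereal t < b"
  shows "t < x (Suc (seg t))"
proof -
  obtain n where "t < x n" using ex_greater[OF assms] by blast
  also have "x n \<le> x (Suc n)" by simp
  finally show ?thesis unfolding seg_def by (rule LeastI)
qed

lemma seg_eq:
  assumes "n = 0 \<or> x n \<le> t" "t < x (Suc n)"
  shows "seg t = n"
  unfolding seg_def
proof (rule Least_equality)
  fix m assume m: "t < x (Suc m)"
  show "n \<le> m"
  proof (cases n)
    case (Suc k)
    then have "x n \<le> t" using assms(1) by simp
    then have "x n < x (Suc m)" using m by linarith
    then have "n < Suc m" by (simp only: x_less_iff)
    then show ?thesis by simp
  qed simp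
qed fact

lemma seg_lower:
  assumes "t \<in> I"
  shows "x (seg t) \<le> t"
proof (cases "seg t")
  case 0 then show ?thesis using assms by (simp add: x_zero halfopen_interval_def)
next
  case (Suc k)
  then have "\<not> t < x (Suc k)" using not_less_Least[of k "\<lambda>n. t < x (Suc n)"] by (simp add: seg_def)
  then show ?thesis using Suc by simp
qed

lemma seg_less_iff: "t \<in> I \<Longrightarrow> seg t < N \<longleftrightarrow> t < x N"
proof -
  assume t: "t \<in> I"
  then have s: "x (seg t) \<le> t" "t < x (Suc (seg t))"
    using seg_lower seg_upper by (auto simp: halfopen_interval_def)
  show ?thesis
  proof
    assume "seg t < N"
    then have "x (Suc (seg t)) \<le> x N" by simp
    then show "t < x N" using s by linarith
  next
    assume "t < x N"
    then have "x (seg t) < x N" using s by linarith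
    then show "seg t < N" by simp
  qed
qed

lemma X_not_in_segment: "x n < t \<Longrightarrow> t < x (Suc n) \<Longrightarrow> t \<notin> X"
  by auto

lemma in_I: "0 \<le> t \<Longrightarrow> t \<le> x n \<Longrightarrow> t \<in> I"
  using less_b by (auto simp: halfopen_interval_def)

lemma segment_subset_I: "t \<in> {x k..x (Suc k)} \<Longrightarrow> t \<in> I"
  using in_I[of t "Suc k"] x_nonneg[of k] by auto

lemma x_in_I [simp]: "x n \<in> I"
  by (rule in_I[of _ n]) auto

lemma I_minus_X_cases:
  assumes "t \<in> I - X"
  shows "(t = 0 \<or> x (seg t) < t) \<and> t < x (Suc (seg t))"
proof (cases "seg t")
  case 0 then show ?thesis using assms seg_upper[of t] by (auto simp: x_zero halfopen_interval_def)
next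
  case (Suc k)
  then have "t \<noteq> x (seg t)" using assms by auto
  then show ?thesis using assms seg_lower[of t] seg_upper[of t] by (auto simp: halfopen_interval_def)
qed

text \<open>At \<open>t = 0\<close> the neighbourhood is two-sided, since \<open>seg\<close> is \<open>0\<close> on the negative axis.\<close>

lemma seg_eventually:
  assumes "t \<in> I - X"
  shows "\<forall>\<^sub>F s in nhds t. seg s = seg t"
proof (cases "t = 0")
  case True
  then have 0: "seg t = 0" using seg_eq[of 0 t] x_pos[of 0] by simp
  have "\<forall>\<^sub>F s in nhds t. s < x 1" using True x_pos[of 0] eventually_nhds_in_open[of "{..<x 1}" t] by auto
  then show ?thesis by eventually_elim (simp add: 0 seg_eq)
next
  case False
  then have t: "x (seg t) < t" "t < x (Suc (seg t))" using I_minus_X_cases[OF assms] by auto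
  have "\<forall>\<^sub>F s in nhds t. x (seg t) < s" "\<forall>\<^sub>F s in nhds t. s < x (Suc (seg t))"
    using eventually_nhds_in_open[of "{x (seg t)<..}" t] eventually_nhds_in_open[of "{..<x (Suc (seg t))}" t] t by auto
  then show ?thesis by eventually_elim (rule seg_eq, auto)
qed

section \<open>Limits, derivatives and square integrability of glued functions\<close>

lemma glue_has_vector_derivative:
  assumes "t \<in> I - X" "(F (seg t) has_vector_derivative F' (seg t) t) (at t)"
  shows "(glue F has_vector_derivative glue F' t) (at t)"
proof -
  have "\<forall>\<^sub>F s in nhds t. glue F s = F (seg t) s"
    using seg_eventually[OF assms(1)] by eventually_elim (simp add: glue_def)
  then show ?thesis
    using assms(2) unfolding has_vector_derivative_def glue_def[of F']
    by (intro has_derivative_transform_eventually[of "F (seg t)" _ t UNIV "glue F"])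
      (auto simp: glue_def eventually_at_filter elim: eventually_mono)
qed

lemma glue_isCont:
  assumes "t \<in> I - X" "isCont (F (seg t)) t"
  shows "isCont (glue F) t"
proof -
  have "\<forall>\<^sub>F s in nhds t. glue F s = F (seg t) s"
    using seg_eventually[OF assms(1)] by eventually_elim (simp add: glue_def)
  then show ?thesis using assms(2) by (simp add: isCont_cong)
qed

lemma eventually_at_left_x:
  "\<forall>\<^sub>F s in at_left (x (Suc n)). seg s = n \<and> s \<in> I - X"
proof -
  have "\<forall>\<^sub>F s in at_left (x (Suc n)). s \<in> {x n<..<x (Suc n)}"
    by (rule eventually_at_leftI[of "x n"]) auto
  then show ?thesis
  proof eventually_elim
    case (elim s)
    then show ?case using seg_eq[of n s] in_I[of s "Suc n"] X_not_in_segment[of n s] x_nonneg[of n] by auto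
  qed
qed

lemma eventually_at_right_x:
  "\<forall>\<^sub>F s in at_right (x n). seg s = n \<and> s \<in> I - X"
proof -
  have "\<forall>\<^sub>F s in at_right (x n). s \<in> {x n<..<x (Suc n)}"
    by (rule eventually_at_rightI[of _ "x (Suc n)"]) auto
  then show ?thesis
  proof eventually_elim
    case (elim s)
    then show ?case using seg_eq[of n s] in_I[of s "Suc n"] X_not_in_segment[of n s] x_nonneg[of n] by auto
  qed
qed

lemma glue_at_left:
  assumes "isCont (F n) (x (Suc n))"
  shows "(glue F \<longlongrightarrow> F n (x (Suc n))) (at_left (x (Suc n)))"
proof -
  have "(F n \<longlongrightarrow> F n (x (Suc n))) (at_left (x (Suc n)))"
    using assms by (simp add: isCont_def filterlim_at_split)
  then show ?thesis
    by (rule Lim_transform_eventually)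
      (use eventually_at_left_x[of n] in \<open>eventually_elim, simp add: glue_def\<close>)
qed

lemma glue_at_right:
  assumes "isCont (F n) (x n)"
  shows "(glue F \<longlongrightarrow> F n (x n)) (at_right (x n))"
proof -
  have "(F n \<longlongrightarrow> F n (x n)) (at_right (x n))"
    using assms by (simp add: isCont_def filterlim_at_split)
  then show ?thesis
    by (rule Lim_transform_eventually)
      (use eventually_at_right_x[of n] in \<open>eventually_elim, simp add: glue_def\<close>)
qed

text \<open>The rest of the segment to the right of \<open>t\<close> lies in \<open>I - X\<close>,
  so \<open>t\<close> is a limit point. This is what makes the relative derivative unique, in
  particular the one-sided one at 0.\<close>

lemma at_within_neq_bot:
  assumes "t \<in> I - X"
  shows "at t within (I - X) \<noteq> bot"
proof -
  have t: "t < x (Suc (seg t))" "x (seg t) \<le> t" using I_minus_X_cases[OF assms] seg_lower assms by auto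
  have sub: "{t<..<x (Suc (seg t))} \<subseteq> I - X"
  proof
    fix s assume s: "s \<in> {t<..<x (Suc (seg t))}"
    then show "s \<in> I - X"
      using t X_not_in_segment[of "seg t" s] segment_subset_I[of s "seg t"] by auto
  qed
  have "at t within {t<..<x (Suc (seg t))} \<noteq> bot"
    using t by (simp add: at_within_eq_bot_iff closure_greaterThanLessThan)
  then show ?thesis using at_le[OF sub, of t] by (auto simp: bot_unique)
qed

lemma deriv_on_eqI:
  assumes "t \<in> I - X" "(f has_vector_derivative f') (at t within (I - X))"
  shows "deriv_on (I - X) f t = f'"
  unfolding deriv_on_def by (rule vector_derivative_within[OF at_within_neq_bot[OF assms(1)] assms(2)])

lemma I_borel: "I \<in> sets borel"
proof -
  have "I = {0..} \<inter> (\<lambda>t. ereal t) -` {..<b}" by (auto simp: halfopen_interval_def)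
  moreover have "(\<lambda>t. ereal t) -` {..<b} \<inter> space borel \<in> sets borel" by measurable
  ultimately show ?thesis by auto
qed

lemma I_lebesgue: "I \<in> sets lebesgue"
  using I_borel by (simp add: sets_completionI_sets)

lemma negligible_X: "negligible X"
  unfolding negligible_iff_null_sets by (rule null_sets_completionI, rule countable_imp_null_set_lborel) auto

lemma AE_not_X: "AE t in lebesgue. t \<notin> X"
  using negligible_X by (auto simp: negligible_iff_null_sets intro: AE_not_in)

text \<open>Monotone convergence over the disjoint segments: at each point at most one truncated
  piece \<open>g k\<close> is nonzero, so the squared modulus is the sum of the squared moduli, and
  a piece contributes at most the length of its segment times the square of its bound.\<close>

lemma sq_integrable_on_glue:
  assumes cont: "\<And>k. continuous_on {x k..x (Suc k)} (F k)"
    and M: "\<And>k t. t \<in> {x k..<x (Suc k)} \<Longrightarrow> cmod (F k t) \<le> M k"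
    and sm: "summable (\<lambda>k. (x (Suc k) - x k) * (M k)\<^sup>2)"
  shows "sq_integrable_on I (glue F)"
proof -
  define f where "f t = (if t \<in> I then glue F t else 0)" for t
  define g where "g k t = (if t \<in> {x k..<x (Suc k)} then F k t else 0)" for k t
  have g_sq: "sq_integrable (g k)" for k
    unfolding g_def by (rule sq_integrable_on_continuous_Icc[OF cont])
  then have g_meas [measurable]: "g k \<in> borel_measurable lebesgue" for k by (simp add: sq_integrable_def)
  have gk: "g k t = (if k = seg t then f t else 0)" if t: "t \<in> I" for k t
  proof (cases "k = seg t")
    case True
    have "t < x (Suc (seg t))" using t by (intro seg_upper) (simp add: halfopen_interval_def)
    then show ?thesis unfolding True using t seg_lower[OF t] by (simp add: g_def f_def glue_def)
  next
    case False
    then have "t \<notin> {x k..<x (Suc k)}" using seg_eq[of k t] by auto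
    then show ?thesis using False by (auto simp: g_def)
  qed
  have gk0: "g k t = 0" if "t \<notin> I" for k t
    using that segment_subset_I[of t k] by (auto simp: g_def)
  have fg: "(\<Sum>k<N. g k t) = (if t \<in> I \<and> t < x N then f t else 0)" for N t
  proof (cases "t \<in> I")
    case True
    then show ?thesis using seg_less_iff[OF True, of N] by (simp add: gk)
  next
    case False
    then show ?thesis by (simp add: gk0)
  qed
  have lim: "(\<lambda>N. \<Sum>k<N. g k t) \<longlonglongrightarrow> f t" for t
  proof (cases "t \<in> I")
    case True
    then obtain n where n: "t < x n" using ex_greater by (auto simp: halfopen_interval_def)
    have "\<forall>\<^sub>F N in sequentially. (\<Sum>k<N. g k t) = f t"
      using eventually_ge_at_top[of n]
      by eventually_elim (use n True in \<open>auto simp: fg intro: less_le_trans\<close>)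
    then show ?thesis by (rule tendsto_eventually)
  next
    case False
    then have "f t = 0" by (simp add: f_def)
    then show ?thesis using False by (simp add: fg)
  qed
  have f_meas [measurable]: "f \<in> borel_measurable lebesgue"
    by (rule borel_measurable_LIMSEQ_metric[of "\<lambda>N t. \<Sum>k<N. g k t"]) (use lim in auto)
  have bound: "(\<integral>\<^sup>+t. ennreal ((cmod (g k t))\<^sup>2) \<partial>lebesgue) \<le> ennreal ((x (Suc k) - x k) * (M k)\<^sup>2)" for k
  proof -
    have "(\<integral>\<^sup>+t. ennreal ((cmod (g k t))\<^sup>2) \<partial>lebesgue)
        \<le> (\<integral>\<^sup>+t. ennreal ((M k)\<^sup>2) * indicator {x k..<x (Suc k)} t \<partial>lebesgue)"
      using M[of _ k] by (intro nn_integral_mono) (auto simp: g_def indicator_def intro!: ennreal_leI power_mono)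
    also have "\<dots> = ennreal ((M k)\<^sup>2) * ennreal (x (Suc k) - x k)"
      by (subst nn_integral_cmult_indicator) auto
    also have "\<dots> = ennreal ((x (Suc k) - x k) * (M k)\<^sup>2)"
      by (subst ennreal_mult[symmetric]) (auto simp: mult.commute)
    finally show ?thesis .
  qed
  have sumsq: "ennreal ((cmod (f t))\<^sup>2) = (\<Sum>k. ennreal ((cmod (g k t))\<^sup>2))" for t
  proof (cases "t \<in> I")
    case True
    then have "(\<Sum>k. ennreal ((cmod (g k t))\<^sup>2)) = (\<Sum>k\<in>{seg t}. ennreal ((cmod (g k t))\<^sup>2))"
      by (intro suminf_finite) (auto simp: gk)
    then show ?thesis using True by (simp add: gk)
  next
    case False
    then show ?thesis by (simp add: f_def gk0)
  qed
  have "(\<integral>\<^sup>+t. ennreal ((cmod (f t))\<^sup>2) \<partial>lebesgue) = (\<Sum>k. \<integral>\<^sup>+t. ennreal ((cmod (g k t))\<^sup>2) \<partial>lebesgue)"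
    unfolding sumsq by (rule nn_integral_suminf) measurable
  also have "\<dots> \<le> (\<Sum>k. ennreal ((x (Suc k) - x k) * (M k)\<^sup>2))"
    by (intro suminf_le bound) auto
  also have "\<dots> = ennreal (\<Sum>k. (x (Suc k) - x k) * (M k)\<^sup>2)"
    by (rule suminf_ennreal2) (use sm in auto)
  also have "\<dots> < \<infinity>" by simp
  finally have "integrable lebesgue (\<lambda>t. (cmod (f t))\<^sup>2)"
    by (intro integrableI_bounded) auto
  then show ?thesis using f_meas unfolding sq_integrable_on_def f_def[symmetric, abs_def]
    by (simp add: sq_integrable_def)
qed

lemma sq_integrable_on_glue_finite:
  assumes cont: "\<And>k. continuous_on {x k..x (Suc k)} (F k)"
    and zero: "\<And>k t. N \<le> k \<Longrightarrow> t \<in> {x k..<x (Suc k)} \<Longrightarrow> F k t = 0"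
  shows "sq_integrable_on I (glue F)"
proof -
  have "\<exists>B. \<forall>t\<in>{x k..x (Suc k)}. cmod (F k t) \<le> B" for k
    by (rule continuous_on_Icc_bounded[OF cont])
  then obtain B where B: "\<And>k t. t \<in> {x k..x (Suc k)} \<Longrightarrow> cmod (F k t) \<le> B k" by metis
  show ?thesis
  proof (rule sq_integrable_on_glue[OF cont])
    show "cmod (F k t) \<le> (if k < N then B k else 0)" if "t \<in> {x k..<x (Suc k)}" for k t
      using that B[of t k] zero[of k t] by auto
    show "summable (\<lambda>k. (x (Suc k) - x k) * (if k < N then B k else 0)\<^sup>2)"
      by (rule summable_finite[of "{..<N}"]) auto
  qed
qed

end

text \<open>Otherwise the simplifier rewrites the index set \<open>{1..}\<close> of the interaction points.\<close>

declare One_nat_def [simp del]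

lemma abs_cont_on_C1:
  assumes der: "\<And>t. t \<in> {u..v} \<Longrightarrow> (f has_vector_derivative f' t) (at t within {u..v})"
    and cont: "continuous_on {u..v} f'"
  shows "abs_cont_on u v f"
proof -
  obtain B where B: "\<And>t. t \<in> {u..v} \<Longrightarrow> cmod (f' t) \<le> B"
    using continuous_on_Icc_bounded[OF cont] by blast
  show ?thesis
  proof (rule abs_cont_on_Lipschitz[of "max 0 B"])
    fix s t assume st: "s \<in> {u..v}" "t \<in> {u..v}" "s \<le> t"
    then have sub: "{s..t} \<subseteq> {u..v}" by auto
    have "(f' has_integral (f t - f s)) {s..t}"
      using st(3) sub
      by (intro fundamental_theorem_of_calculus has_vector_derivative_within_subset[OF der]) auto
    then have "cmod (f t - f s) \<le> max 0 B * measure lborel {s..t}"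
      by (intro has_integral_bound_real[where S = "{}"]) (use B sub in \<open>auto intro: max.coboundedI2\<close>)
    then show "cmod (f t - f s) \<le> max 0 B * (t - s)" using st by simp
  qed simp
qed

section \<open>The domain of the minimal operator in terms of pieces\<close>

locale delta_interactions = interaction_points +
  fixes \<alpha> :: "nat \<Rightarrow> real"
begin

abbreviation "D \<equiv> deriv_on (I - X)"
abbreviation "K \<equiv> L2_on I"
abbreviation "H_min \<equiv> delta_operator_min b x \<alpha>"

text \<open>These are the domain conditions without compact support, so that Green's formula can
  also be applied to solutions that do not belong to the domain.\<close>

definition interface :: "(real \<Rightarrow> complex) \<Rightarrow> bool" where
  "interface f \<longleftrightarrow> D f 0 = 0 \<and>
     (\<forall>n\<ge>1. \<exists>y p q.
        (f \<longlongrightarrow> y) (at_left (x n)) \<and> (f \<longlongrightarrow> y) (at_right (x n)) \<and>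
        (D f \<longlongrightarrow> p) (at_left (x n)) \<and> (D f \<longlongrightarrow> q) (at_right (x n)) \<and>
        q - p = of_real (\<alpha> n) * y)"

lemma delta_domain_iff: "f \<in> delta_domain b x \<alpha> \<longleftrightarrow> f \<in> W22_comp I X \<and> interface f"
  by (simp add: delta_domain_def interface_def Let_def)

lemma H_min_eq: "H_min = (\<lambda>f. (to_L2 I f, to_L2 I (\<lambda>t. - D (D f) t))) ` delta_domain b x \<alpha>"
  by (simp add: delta_operator_min_def Let_def)

lemma AC_loc_C1:
  assumes der: "\<And>t. t \<in> I - X \<Longrightarrow> (f has_vector_derivative f' t) (at t within (I - X))"
    and cont: "continuous_on (I - X) f'"
  shows "AC_loc (I - X) f"
  unfolding AC_loc_def
proof (intro allI impI)
  fix u v assume "u \<le> v" "{u..v} \<subseteq> I - X"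
  then show "abs_cont_on u v f"
    by (intro abs_cont_on_C1[of u v f f'] has_vector_derivative_within_subset[OF der] continuous_on_subset[OF cont]) blast+
qed

lemma W22I:
  assumes d1: "\<And>t. t \<in> I - X \<Longrightarrow> (f has_vector_derivative f1 t) (at t within (I - X))"
    and d2: "\<And>t. t \<in> I - X \<Longrightarrow> (f1 has_vector_derivative f2 t) (at t within (I - X))"
    and c2: "continuous_on (I - X) f2"
    and sq: "sq_integrable_on I f" "sq_integrable_on I f2"
  shows "f \<in> W22 I X" "\<And>t. t \<in> I - X \<Longrightarrow> D f t = f1 t" "\<And>t. t \<in> I - X \<Longrightarrow> D (D f) t = f2 t"
proof -
  show D1: "D f t = f1 t" if "t \<in> I - X" for t
    by (rule deriv_on_eqI[OF that d1[OF that]])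
  have dD: "(D f has_vector_derivative f2 t) (at t within (I - X))" if "t \<in> I - X" for t
    by (rule has_vector_derivative_transform[OF that _ d2[OF that]]) (simp add: D1)
  show D2: "D (D f) t = f2 t" if "t \<in> I - X" for t
    by (rule deriv_on_eqI[OF that dD[OF that]])
  have c1: "continuous_on (I - X) f1"
    using d2 has_vector_derivative_continuous unfolding continuous_on_eq_continuous_within by blast
  have "sq_integrable_on I (D (D f))"
    unfolding sq_integrable_on_def
    by (rule sq_integrable_cong_AE[OF sq(2)[unfolded sq_integrable_on_def]])
      (use AE_not_X in \<open>eventually_elim, simp add: D2\<close>)
  moreover have "f differentiable (at t within I - X)" if "t \<in> I - X" for t
    using d1[OF that] by (rule differentiableI_vector)
  moreover have "AC_loc (I - X) f" by (rule AC_loc_C1[OF d1 c1])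
  moreover have "AC_loc (I - X) (D f)" by (rule AC_loc_C1[OF dD c2])
  ultimately show "f \<in> W22 I X" using sq(1) by (simp add: W22_def)
qed

lemma zero_in_I_minus_X: "0 \<in> I - X"
proof -
  have "x n \<noteq> 0" if "1 \<le> n" for n
    using that x_pos[of "n - 1"] by simp
  then show ?thesis using x_in_I[of 0] by (auto simp: x_zero)
qed

text \<open>The pieces are twice continuously differentiable up to both ends of their segments. The
  boundary and interface conditions thereby become identities between values of pieces at 0 and at
  common end points.\<close>

lemma glue_W22_interface:
  assumes d1: "\<And>k t. t \<in> {x k..x (Suc k)} \<Longrightarrow> (F k has_vector_derivative F1 k t) (at t)"
    and d2: "\<And>k t. t \<in> {x k..x (Suc k)} \<Longrightarrow> (F1 k has_vector_derivative F2 k t) (at t)"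
    and c2: "\<And>k t. t \<in> {x k..x (Suc k)} \<Longrightarrow> isCont (F2 k) t"
    and F0: "F1 0 0 = 0"
    and cont: "\<And>k. F (Suc k) (x (Suc k)) = F k (x (Suc k))"
    and jump: "\<And>k. F1 (Suc k) (x (Suc k)) - F1 k (x (Suc k)) = of_real (\<alpha> (Suc k)) * F k (x (Suc k))"
    and sq: "sq_integrable_on I (glue F)" "sq_integrable_on I (glue F2)"
  shows "glue F \<in> W22 I X" "interface (glue F)"
    "\<And>t. t \<in> I - X \<Longrightarrow> D (glue F) t = glue F1 t" "\<And>t. t \<in> I - X \<Longrightarrow> D (D (glue F)) t = glue F2 t"
proof -
  have seg: "t \<in> {x (seg t)..x (Suc (seg t))}" if "t \<in> I - X" for t
    using I_minus_X_cases[OF that] seg_lower[of t] that by auto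
  have g1: "(glue F has_vector_derivative glue F1 t) (at t within (I - X))" if "t \<in> I - X" for t
    by (rule has_vector_derivative_at_within, rule glue_has_vector_derivative[where F = F and F' = F1, OF that d1[OF seg[OF that]]])
  have g2: "(glue F1 has_vector_derivative glue F2 t) (at t within (I - X))" if "t \<in> I - X" for t
    by (rule has_vector_derivative_at_within, rule glue_has_vector_derivative[where F = F1 and F' = F2, OF that d2[OF seg[OF that]]])
  have gc: "continuous_on (I - X) (glue F2)"
    using seg by (intro continuous_at_imp_continuous_on ballI glue_isCont c2)
  note W = W22I[OF g1 g2 gc sq]
  show "glue F \<in> W22 I X" by (rule W(1))
  show D1: "D (glue F) t = glue F1 t" if "t \<in> I - X" for t by (rule W(2)) (use that in auto)
  show "D (D (glue F)) t = glue F2 t" if "t \<in> I - X" for t by (rule W(3)) (use that in auto)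
  have isC: "isCont (F k) t" "isCont (F1 k) t" if "t \<in> {x k..x (Suc k)}" for k t
    using d1[OF that] d2[OF that] has_vector_derivative_continuous by blast+
  have "\<exists>y p q. (glue F \<longlongrightarrow> y) (at_left (x n)) \<and> (glue F \<longlongrightarrow> y) (at_right (x n)) \<and>
        (D (glue F) \<longlongrightarrow> p) (at_left (x n)) \<and> (D (glue F) \<longlongrightarrow> q) (at_right (x n)) \<and>
        q - p = of_real (\<alpha> n) * y" if n: "n \<ge> 1" for n
  proof -
    obtain k where k: "n = Suc k" using n by (cases n) auto
    have "(D (glue F) \<longlongrightarrow> F1 k (x (Suc k))) (at_left (x (Suc k)))"
      by (rule Lim_transform_eventually[OF glue_at_left])
        (use isC eventually_at_left_x[of k] in \<open>auto simp: D1 elim!: eventually_mono\<close>)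
    moreover have "(D (glue F) \<longlongrightarrow> F1 (Suc k) (x (Suc k))) (at_right (x (Suc k)))"
      by (rule Lim_transform_eventually[OF glue_at_right])
        (use isC eventually_at_right_x[of "Suc k"] in \<open>auto simp: D1 elim!: eventually_mono\<close>)
    moreover have "(glue F \<longlongrightarrow> F k (x (Suc k))) (at_left (x (Suc k)))"
      by (rule glue_at_left) (use isC in auto)
    moreover have "(glue F \<longlongrightarrow> F k (x (Suc k))) (at_right (x (Suc k)))"
      unfolding cont[symmetric] by (rule glue_at_right) (use isC in auto)
    ultimately show ?thesis unfolding k using jump[of k] by blast
  qed
  moreover have "D (glue F) 0 = 0"
    using D1[OF zero_in_I_minus_X] F0 seg_eq[of 0 0] x_pos[of 0] by (simp add: glue_def)
  ultimately show "interface (glue F)" by (simp add: interface_def)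
qed

lemma glue_delta_domain:
  assumes d1: "\<And>k t. t \<in> {x k..x (Suc k)} \<Longrightarrow> (F k has_vector_derivative F1 k t) (at t)"
    and d2: "\<And>k t. t \<in> {x k..x (Suc k)} \<Longrightarrow> (F1 k has_vector_derivative F2 k t) (at t)"
    and c2: "\<And>k t. t \<in> {x k..x (Suc k)} \<Longrightarrow> isCont (F2 k) t"
    and F0: "F1 0 0 = 0"
    and cont: "\<And>k. F (Suc k) (x (Suc k)) = F k (x (Suc k))"
    and jump: "\<And>k. F1 (Suc k) (x (Suc k)) - F1 k (x (Suc k)) = of_real (\<alpha> (Suc k)) * F k (x (Suc k))"
    and zero: "\<And>k t. N \<le> k \<Longrightarrow> t \<in> {x k..x (Suc k)} \<Longrightarrow> F k t = 0 \<and> F2 k t = 0"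
  shows "glue F \<in> delta_domain b x \<alpha>" "sq_integrable_on I (glue F)" "sq_integrable_on I (glue F2)"
    "(to_L2 I (glue F), to_L2 I (\<lambda>t. - glue F2 t)) \<in> H_min"
proof -
  have contF: "continuous_on {x k..x (Suc k)} (F k)" for k
    using d1 has_vector_derivative_continuous by (blast intro: continuous_at_imp_continuous_on)
  show sqF: "sq_integrable_on I (glue F)"
    by (rule sq_integrable_on_glue_finite[OF contF, of N]) (use zero in auto)
  show sqF2: "sq_integrable_on I (glue F2)"
    by (rule sq_integrable_on_glue_finite[of F2 N])
      (use zero c2 in \<open>auto intro!: continuous_at_imp_continuous_on\<close>)
  note W = glue_W22_interface[OF d1 d2 c2 F0 cont jump sqF sqF2]
  have W4: "D (D (glue F)) t = glue F2 t" if "t \<in> I - X" for t by (rule W(4)) (use that in auto)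
  have "closure {t \<in> I - X. glue F t \<noteq> 0} \<subseteq> {0..x N}"
  proof (rule closure_minimal)
    show "{t \<in> I - X. glue F t \<noteq> 0} \<subseteq> {0..x N}"
    proof
      fix t assume t: "t \<in> {t \<in> I - X. glue F t \<noteq> 0}"
      then have tI: "t \<in> I" by auto
      have "seg t < N"
      proof (rule ccontr)
        assume "\<not> seg t < N"
        then have "F (seg t) t = 0"
          using zero[of "seg t" t] I_minus_X_cases[of t] seg_lower[OF tI] t by auto
        then show False using t by (simp add: glue_def)
      qed
      then show "t \<in> {0..x N}" using seg_less_iff[OF tI] tI by (auto simp: halfopen_interval_def)
    qed
  qed simp
  then have supp: "bounded (closure {t \<in> I - X. glue F t \<noteq> 0})" "closure {t \<in> I - X. glue F t \<noteq> 0} \<subseteq> {0..x N}"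
    by (blast intro: bounded_subset[OF compact_imp_bounded[OF compact_Icc]])+
  have "{0..x N} \<subseteq> I" using in_I by auto
  then have supp_I: "closure {t \<in> I - X. glue F t \<noteq> 0} \<subseteq> I" using supp(2) by blast
  have "compact (closure {t \<in> I - X. glue F t \<noteq> 0})"
    unfolding compact_eq_bounded_closed using supp(1) closed_closure by blast
  then show dom: "glue F \<in> delta_domain b x \<alpha>"
    unfolding delta_domain_iff W22_comp_def mem_Collect_eq using W(1,2) supp_I by blast
  have "to_L2 I (\<lambda>t. - D (D (glue F)) t) = to_L2 I (\<lambda>t. - glue F2 t)"
  proof (subst to_L2_eq_iff)
    show "sq_integrable_on I (\<lambda>t. - glue F2 t)" using sq_integrable_on_cmult[OF sqF2, of "-1"] by simp
    have "sq_integrable_on I (D (D (glue F)))" using W(1) by (simp add: W22_def)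
    then show "sq_integrable_on I (\<lambda>t. - D (D (glue F)) t)" using sq_integrable_on_cmult[of I _ "-1"] by simp
    show "AE t in lebesgue. t \<in> I \<longrightarrow> - D (D (glue F)) t = - glue F2 t"
      using AE_not_X
    proof eventually_elim
      case (elim t)
      then show ?case using W4[of t] by simp
    qed
  qed
  then show "(to_L2 I (glue F), to_L2 I (\<lambda>t. - glue F2 t)) \<in> H_min"
    unfolding H_min_eq using dom by (intro image_eqI[of _ _ "glue F"]) auto
qed

end

section \<open>Density of the domain\<close>

context interaction_points
begin

text \<open>
  A nonnegative function supported in \<open>[0, x\<^sub>N]\<close> with double zeros at the interaction points: its
  products with smooth functions satisfy every interface condition.
\<close>

definition bump :: "nat \<Rightarrow> real \<Rightarrow> real" where
  "bump N t = (\<Sum>k<N. (max 0 ((t - x k) * (x (Suc k) - t)))\<^sup>2)"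

lemma continuous_on_bump [continuous_intros]: "continuous_on A (bump N)"
  unfolding bump_def by (intro continuous_intros)

lemma bump_nonneg [simp]: "0 \<le> bump N t"
  unfolding bump_def by (intro sum_nonneg) auto

lemma bump_term_eq_0: "t \<notin> {x k<..<x (Suc k)} \<Longrightarrow> max 0 ((t - x k) * (x (Suc k) - t)) = 0"
proof -
  assume "t \<notin> {x k<..<x (Suc k)}"
  moreover have "x k < x (Suc k)" by simp
  ultimately have "t - x k \<le> 0 \<and> 0 \<le> x (Suc k) - t \<or> 0 \<le> t - x k \<and> x (Suc k) - t \<le> 0"
    unfolding greaterThanLessThan_iff by linarith
  then have "(t - x k) * (x (Suc k) - t) \<le> 0" by (auto simp: mult_le_0_iff)
  then show ?thesis by simp
qed

lemma bump_eq_0: "t \<le> 0 \<or> x N \<le> t \<Longrightarrow> bump N t = 0"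
  unfolding bump_def
proof (intro sum.neutral ballI)
  fix k assume t: "t \<le> 0 \<or> x N \<le> t" and "k \<in> {..<N}"
  then have "x (Suc k) \<le> x N" by simp
  then have "t \<notin> {x k<..<x (Suc k)}" using t x_nonneg[of k] unfolding greaterThanLessThan_iff by linarith
  then show "(max 0 ((t - x k) * (x (Suc k) - t)))\<^sup>2 = 0" by (simp add: bump_term_eq_0)
qed

lemma bump_on_segment:
  assumes "t \<in> {x k..x (Suc k)}" "k < N"
  shows "bump N t = ((t - x k) * (x (Suc k) - t))\<^sup>2"
proof -
  have "bump N t = (\<Sum>j<N. if j = k then ((t - x k) * (x (Suc k) - t))\<^sup>2 else 0)"
    unfolding bump_def
  proof (rule sum.cong[OF refl])
    fix j
    show "(max 0 ((t - x j) * (x (Suc j) - t)))\<^sup>2 = (if j = k then ((t - x k) * (x (Suc k) - t))\<^sup>2 else 0)"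
    proof (cases "j = k")
      case True then show ?thesis using assms by (simp add: max_def)
    next
      case False
      then have "Suc j \<le> k \<or> Suc k \<le> j" by linarith
      then have "x (Suc j) \<le> x k \<or> x (Suc k) \<le> x j" by simp
      then have "t \<notin> {x j<..<x (Suc j)}"
        using assms(1) unfolding greaterThanLessThan_iff atLeastAtMost_iff by linarith
      then show ?thesis using False by (simp add: bump_term_eq_0)
    qed
  qed
  then show ?thesis using assms by simp
qed

lemma bump_pos:
  assumes "t \<in> I" "t \<notin> X" "t \<noteq> 0" "t < x N"
  shows "0 < bump N t"
proof -
  have k: "seg t < N" using assms seg_less_iff by simp
  have "x (seg t) < t" "t < x (Suc (seg t))" using I_minus_X_cases[of t] assms by auto
  then show ?thesis using bump_on_segment[of t "seg t", OF _ k] by auto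
qed

lemma sq_integrable_on_I_continuous:
  assumes "continuous_on UNIV h" "\<And>t. x N \<le> t \<Longrightarrow> h t = 0"
  shows "sq_integrable_on I h"
proof -
  have "(\<lambda>t. if t \<in> {0..<x N} then h t else 0) = (\<lambda>t. if t \<in> I then h t else 0)"
  proof
    fix t
    show "(if t \<in> {0..<x N} then h t else 0) = (if t \<in> I then h t else 0)"
      using assms(2)[of t] in_I[of t N] by (auto simp: halfopen_interval_def)
  qed
  then show ?thesis
    unfolding sq_integrable_on_def
    using sq_integrable_on_continuous_Icc[of 0 "x N" h] continuous_on_subset[OF assms(1)] by simp
qed

lemma sq_integrable_on_bump:
  assumes "continuous_on UNIV p"
  shows "sq_integrable_on I (\<lambda>t. bump N t *\<^sub>R p t)"
  by (rule sq_integrable_on_I_continuous[of _ N]) (auto intro!: continuous_intros assms simp: bump_eq_0)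

text \<open>The quotient of \<open>f\<close> by the bump is bounded by \<open>B\<close>. It is an
  almost everywhere limit of continuous functions, which are truncated and then approximated
  uniformly on \<open>{0..x N}\<close> by polynomials; multiplying back by the bump allows dominated
  convergence.\<close>

lemma bump_approximation:
  assumes p: "sq_integrable_on I f" and bd: "\<And>t. t \<in> I \<Longrightarrow> cmod (f t) \<le> B * bump N t" and B: "B > 0"
  shows "to_L2 I f \<in> closure {to_L2 I (\<lambda>t. bump N t *\<^sub>R p t) |p. polynomial_function p}"
proof -
  define g where "g t = (if t \<in> I then f t / of_real (bump N t) else 0)" for t
  have [measurable]: "(\<lambda>t. if t \<in> I then f t else 0) \<in> borel_measurable lebesgue"
    using p by (simp add: sq_integrable_on_def sq_integrable_def)
  have [measurable]: "bump N \<in> borel_measurable borel"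
    by (intro borel_measurable_continuous_onI continuous_intros)
  have [measurable]: "bump N \<in> borel_measurable lebesgue" by (simp add: measurable_completion)
  have "(\<lambda>t. (if t \<in> I then f t else 0) / of_real (bump N t)) \<in> borel_measurable lebesgue" by measurable
  then have gm: "g \<in> borel_measurable lebesgue"
    unfolding g_def by (rule back_subst[of "\<lambda>h. h \<in> borel_measurable lebesgue"]) auto
  have gB: "cmod (g t) \<le> B" for t
  proof (cases "t \<in> I \<and> bump N t > 0")
    case True
    then show ?thesis using bd[of t] by (simp add: g_def norm_divide pos_divide_le_eq)
  next
    case False
    then have "t \<notin> I \<or> bump N t = 0" using bump_nonneg[of N t] by linarith
    then show ?thesis using B by (auto simp: g_def)
  qed
  have fg: "f t = bump N t *\<^sub>R g t" if "t \<in> I" for t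
    using bd[OF that] that by (cases "bump N t = 0") (auto simp: g_def scaleR_conv_of_real)
  obtain Z c where Z: "negligible Z" and c: "\<And>n. continuous_on UNIV (c n)"
    and cg: "\<And>t. t \<notin> Z \<Longrightarrow> (\<lambda>n. c n t) \<longlonglongrightarrow> g t"
    using lebesgue_measurable_imp_measurable_on[OF gm, of UNIV] unfolding measurable_on_def by auto
  \<comment> \<open>Radial truncation to modulus at most \<open>B\<close> preserves continuity and
    does not change the limit, because \<open>g\<close> itself is bounded by \<open>B\<close>. It
    supplies the common bound for dominated convergence.\<close>
  define c' where "c' n t = (B / max B (cmod (c n t))) *\<^sub>R c n t" for n t
  have c'_cont: "continuous_on UNIV (c' n)" for n
    unfolding c'_def using B by (intro continuous_intros c) (auto simp: max_def)
  have c'B: "cmod (c' n t) \<le> B" for n t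
    using B by (auto simp: c'_def max_def field_simps)
  have c'g: "(\<lambda>n. c' n t) \<longlonglongrightarrow> g t" if "t \<notin> Z" for t
  proof -
    have "(\<lambda>n. c' n t) \<longlonglongrightarrow> (B / max B (cmod (g t))) *\<^sub>R g t"
      unfolding c'_def using B by (intro tendsto_intros cg that) (auto simp: max_def)
    moreover have "max B (cmod (g t)) = B" using gB[of t] by simp
    ultimately show ?thesis using B by simp
  qed
  have "\<exists>q. polynomial_function q \<and> (\<forall>t\<in>{0..x N}. norm (c' n t - q t) < inverse (real (Suc n)))" for n
    by (rule Stone_Weierstrass_polynomial_function) (auto intro: continuous_on_subset[OF c'_cont])
  then obtain q where q: "\<And>n. polynomial_function (q n)"
    "\<And>n t. t \<in> {0..x N} \<Longrightarrow> norm (c' n t - q n t) < inverse (real (Suc n))"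
    by metis
  have q_cont: "continuous_on UNIV (q n)" for n by (rule continuous_on_polymonial_function[OF q(1)])
  obtain W where "\<And>t. t \<in> {0..x N} \<Longrightarrow> norm (bump N t) \<le> W"
    using continuous_on_Icc_bounded[OF continuous_on_bump[of "{0..x N}" N]] by blast
  then have W: "\<And>t. t \<in> {0..x N} \<Longrightarrow> bump N t \<le> W" by simp
  have "(\<lambda>n. to_L2 I (\<lambda>t. bump N t *\<^sub>R q n t)) \<longlonglongrightarrow> to_L2 I f"
  \<comment> \<open>\<open>2 * B + 1\<close> bounds the distance from \<open>q n\<close> to
    \<open>g\<close>: at most 1 from the polynomial approximation, and \<open>B\<close> each for
    \<open>c' n\<close> and \<open>g\<close>. \<open>W\<close> bounds the bump.\<close>
  proof (rule tendsto_to_L2_dominated[where w = "\<lambda>t. indicator {0..x N} t * (W * (2 * B + 1))"])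
    show "sq_integrable_on I (\<lambda>t. bump N t *\<^sub>R q n t)" for n by (rule sq_integrable_on_bump[OF q_cont])
    show "integrable lebesgue (\<lambda>t. (indicator {0..x N} t * (W * (2 * B + 1)))\<^sup>2)"
    proof -
      have "(\<lambda>t. (indicator {0..x N} t * (W * (2 * B + 1)))\<^sup>2) = (\<lambda>t. indicator {0..x N} t * (W * (2 * B + 1))\<^sup>2)"
        by (auto simp: indicator_def)
      moreover have "integrable lebesgue (\<lambda>t. indicator {0..x N} t * (W * (2 * B + 1))\<^sup>2 :: real)"
        by (intro integrable_mult_left integrable_real_indicator) (auto simp: emeasure_lborel_Icc_eq)
      ultimately show ?thesis by simp
    qed
    have "AE t in lebesgue. t \<notin> Z" using Z by (auto simp: negligible_iff_null_sets intro: AE_not_in)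
    then show "AE t in lebesgue. t \<in> I \<longrightarrow> (\<lambda>n. bump N t *\<^sub>R q n t) \<longlonglongrightarrow> f t"
    proof eventually_elim
      case (elim t)
      show ?case
      proof
        assume t: "t \<in> I"
        show "(\<lambda>n. bump N t *\<^sub>R q n t) \<longlonglongrightarrow> f t"
        proof (cases "t \<in> {0..x N}")
          case True
          have "(\<lambda>n. c' n t - q n t) \<longlonglongrightarrow> 0"
            by (rule Lim_null_comparison[OF _ LIMSEQ_inverse_real_of_nat])
              (intro always_eventually allI less_imp_le q(2)[OF True])
          from tendsto_diff[OF c'g[OF elim] this] have "(\<lambda>n. q n t) \<longlonglongrightarrow> g t" by simp
          then show ?thesis unfolding fg[OF t] by (intro tendsto_intros)
        next
          case False
          then have "bump N t = 0" using t by (intro bump_eq_0) (auto simp: halfopen_interval_def)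
          then show ?thesis using fg[OF t] by simp
        qed
      qed
    qed
    show "AE t in lebesgue. t \<in> I \<longrightarrow> cmod (bump N t *\<^sub>R q n t - f t) \<le> indicator {0..x N} t * (W * (2 * B + 1))" for n
    proof (rule AE_I2, rule impI)
      fix t assume t: "t \<in> I"
      show "cmod (bump N t *\<^sub>R q n t - f t) \<le> indicator {0..x N} t * (W * (2 * B + 1))"
      proof (cases "t \<in> {0..x N}")
        case True
        have "cmod (q n t - g t) \<le> cmod (c' n t - q n t) + cmod (c' n t) + cmod (g t)"
          using norm_triangle_ineq4[of "c' n t - g t" "c' n t - q n t"] norm_triangle_ineq4[of "c' n t" "g t"]
          by (simp add: algebra_simps)
        also have "\<dots> \<le> 1 + B + B"
        proof -
          have "inverse (real (Suc n)) \<le> 1" by (simp add: field_simps)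
          then show ?thesis using q(2)[OF True, of n] c'B[of n t] gB[of t] by linarith
        qed
        finally have "cmod (q n t - g t) \<le> 2 * B + 1" by simp
        then have "bump N t * cmod (q n t - g t) \<le> W * (2 * B + 1)"
          using W[OF True] B order_trans[OF bump_nonneg W[OF True]] by (intro mult_mono) auto
        then show ?thesis using True by (simp add: fg[OF t] flip: scaleR_diff_right)
      next
        case False
        then have "bump N t = 0" using t by (intro bump_eq_0) (auto simp: halfopen_interval_def)
        then show ?thesis using fg[OF t] False by simp
      qed
    qed
  qed (use p in auto)
  then show ?thesis
    by (rule closed_sequentially[OF closed_closure, rotated])
      (use q(1) in \<open>auto intro!: subsetD[OF closure_subset]\<close>)
qed

text \<open>\<open>f\<close> is cut off to the sets \<open>A N\<close>, on which it is dominated by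
  a multiple of the bump. At a point of \<open>I\<close> outside \<open>X\<close> and different from
  0 the bump is positive and independent of \<open>N\<close> once \<open>x N\<close> lies beyond the
  point, so almost every point of \<open>I\<close> eventually belongs to all
  \<open>A N\<close>.\<close>

lemma L2_on_subset_closure_bump:
  "L2_on I \<subseteq> closure {to_L2 I (\<lambda>t. bump N t *\<^sub>R p t) |N p. polynomial_function p}"
proof
  let ?S = "{to_L2 I (\<lambda>t. bump N t *\<^sub>R p t) |N p. polynomial_function (p :: real \<Rightarrow> complex)}"
  fix F assume "F \<in> L2_on I"
  then obtain f where f: "sq_integrable_on I f" and F: "F = to_L2 I f" by (rule L2_on_obtain)
  define A where "A N = {t \<in> I. t < x N \<and> cmod (if t \<in> I then f t else 0) \<le> real (Suc N) * bump N t}" for N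
  define f' where "f' N t = (if t \<in> A N then f t else 0)" for N t
  have [measurable]: "(\<lambda>t. if t \<in> I then f t else 0) \<in> borel_measurable lebesgue"
    using f by (simp add: sq_integrable_on_def sq_integrable_def)
  have bm: "bump N \<in> borel_measurable borel" for N
    by (intro borel_measurable_continuous_onI continuous_intros)
  have [measurable]: "bump N \<in> borel_measurable lebesgue" for N using bm by (simp add: measurable_completion)
  note I_lebesgue [measurable]
  have [measurable]: "A N \<in> sets lebesgue" for N
  proof -
    have B: "{t \<in> space lebesgue. cmod (if t \<in> I then f t else 0) \<le> real (Suc N) * bump N t} \<in> sets lebesgue"
      by measurable
    have eq: "A N = I \<inter> {..<x N} \<inter> {t \<in> space lebesgue. cmod (if t \<in> I then f t else 0) \<le> real (Suc N) * bump N t}"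
      by (auto simp: A_def)
    show ?thesis unfolding eq by (intro sets.Int I_lebesgue B) simp
  qed
  have f'_sq: "sq_integrable_on I (f' N)" for N
  proof -
    have m: "(\<lambda>t. if t \<in> I then f' N t else 0) \<in> borel_measurable lebesgue"
    proof -
      have "(\<lambda>t. if t \<in> A N then (if t \<in> I then f t else 0) else 0) \<in> borel_measurable lebesgue" by measurable
      then show ?thesis by (rule back_subst[of "\<lambda>h. h \<in> borel_measurable lebesgue"]) (auto simp: f'_def A_def)
    qed
    have "integrable lebesgue (\<lambda>t. (cmod (if t \<in> I then f' N t else 0))\<^sup>2)"
    proof (rule Bochner_Integration.integrable_bound)
      show "integrable lebesgue (\<lambda>t. (cmod (if t \<in> I then f t else 0))\<^sup>2)"
        using f by (simp add: sq_integrable_on_def sq_integrable_def)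
    qed (use m in \<open>measurable, auto simp: f'_def\<close>)
    then show ?thesis using m by (simp add: sq_integrable_on_def sq_integrable_def)
  qed
  have "to_L2 I (f' N) \<in> closure ?S" for N
  proof -
    have "to_L2 I (f' N) \<in> closure {to_L2 I (\<lambda>t. bump N t *\<^sub>R p t) |p. polynomial_function p}"
      by (rule bump_approximation[OF f'_sq, where B = "real (Suc N)"]) (auto simp: f'_def A_def)
    moreover have "{to_L2 I (\<lambda>t. bump N t *\<^sub>R p t) |p. polynomial_function p} \<subseteq> ?S" by blast
    ultimately show ?thesis using closure_mono by blast
  qed
  moreover have "(\<lambda>N. to_L2 I (f' N)) \<longlonglongrightarrow> to_L2 I f"
  proof (rule tendsto_to_L2_dominated[OF f'_sq f, where w = "\<lambda>t. cmod (if t \<in> I then f t else 0)"])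
    show "integrable lebesgue (\<lambda>t. (cmod (if t \<in> I then f t else 0))\<^sup>2)"
      using f by (simp add: sq_integrable_on_def sq_integrable_def)
    show "AE t in lebesgue. t \<in> I \<longrightarrow> cmod (f' N t - f t) \<le> cmod (if t \<in> I then f t else 0)" for N
      by (auto simp: f'_def)
    have "AE t in lebesgue. t \<noteq> (0::real)"
      by (intro AE_completion AE_lborel_singleton)
    with AE_not_X show "AE t in lebesgue. t \<in> I \<longrightarrow> (\<lambda>N. f' N t) \<longlonglongrightarrow> f t"
    proof eventually_elim
      case (elim t)
      show ?case
      proof
        assume t: "t \<in> I"
        obtain M where M: "t < x M" using t ex_greater by (auto simp: halfopen_interval_def)
        have pos: "0 < bump M t" using t elim M by (intro bump_pos)
        have eq: "bump N t = bump M t" if "N \<ge> M" for N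
        proof -
          have s: "seg t < M" using M seg_less_iff[OF t, of M] by blast
          then have s': "seg t < N" using that by linarith
          have "t \<in> {x (seg t)..x (Suc (seg t))}" using seg_lower[OF t] seg_upper[of t] t by (auto simp: halfopen_interval_def)
          from bump_on_segment[OF this s] bump_on_segment[OF this s'] show ?thesis by simp
        qed
        obtain L where L: "cmod (f t) / bump M t \<le> real L" using real_arch_simple by blast
        have "f' N t = f t" if N: "N \<ge> max M L" for N
        proof -
          have "x M \<le> x N" using N by simp
          then have "t < x N" using M by linarith
          have "cmod (f t) \<le> real L * bump M t" using L pos by (simp add: pos_divide_le_eq)
          also have "\<dots> \<le> real (Suc N) * bump M t" using N pos by (intro mult_right_mono) auto
          finally show ?thesis using t eq[of N] N \<open>t < x N\<close> by (simp add: f'_def A_def)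
        qed
        then show "(\<lambda>N. f' N t) \<longlonglongrightarrow> f t"
          by (auto intro!: tendsto_eventually exI[of _ "max M L"] simp: eventually_sequentially)
      qed
    qed
  qed
  ultimately show "F \<in> closure ?S"
    unfolding F by (rule closed_sequentially[OF closed_closure])
qed

end

context delta_interactions
begin

lemma bump_in_domain:
  assumes p: "polynomial_function (p :: real \<Rightarrow> complex)"
  shows "to_L2 I (\<lambda>t. bump N t *\<^sub>R p t) \<in> Domain H_min"
proof -
  obtain p1 where p1: "polynomial_function p1" "\<And>t. (p has_vector_derivative p1 t) (at t)"
    using has_vector_derivative_polynomial_function[OF p] by blast
  obtain p2 where p2: "polynomial_function p2" "\<And>t. (p1 has_vector_derivative p2 t) (at t)"
    using has_vector_derivative_polynomial_function[OF p1(1)] by blast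
  define w where "w k t = ((t - x k) * (x (Suc k) - t))\<^sup>2" for k t
  define w1 where "w1 k t = 2 * ((t - x k) * (x (Suc k) - t)) * (x k + x (Suc k) - 2 * t)" for k t
  define w2 where "w2 k t = 2 * (x k + x (Suc k) - 2 * t)\<^sup>2 - 4 * ((t - x k) * (x (Suc k) - t))" for k t
  have dw: "(w k has_real_derivative w1 k t) (at t)" for k t
    unfolding w_def[abs_def] w1_def by (auto intro!: derivative_eq_intros simp: power2_eq_square algebra_simps)
  have dw1: "(w1 k has_real_derivative w2 k t) (at t)" for k t
    unfolding w1_def[abs_def] w2_def by (auto intro!: derivative_eq_intros simp: power2_eq_square algebra_simps)
  define F where "F k t = (if k < N then w k t *\<^sub>R p t else 0)" for k t
  define F1 where "F1 k t = (if k < N then w k t *\<^sub>R p1 t + w1 k t *\<^sub>R p t else 0)" for k t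
  define F2 where "F2 k t = (if k < N then (w k t *\<^sub>R p2 t + w1 k t *\<^sub>R p1 t) + (w1 k t *\<^sub>R p1 t + w2 k t *\<^sub>R p t) else 0)" for k t
  have wc: "isCont (w k) t" "isCont (w1 k) t" "isCont (w2 k) t" for k t
    unfolding w_def w1_def w2_def by (intro continuous_intros)+
  have pc: "isCont p t" "isCont p1 t" "isCont p2 t" for t
    using p p1 p2 by (auto intro: continuous_polymonial_function)
  have w0: "w k (x k) = 0" "w k (x (Suc k)) = 0" "w1 k (x k) = 0" "w1 k (x (Suc k)) = 0" for k
    by (simp_all add: w_def w1_def)
  note G = glue_delta_domain[of F F1 F2 N]
  have "(to_L2 I (glue F), to_L2 I (\<lambda>t. - glue F2 t)) \<in> H_min"
  proof (rule G(4))
    fix k t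
    show "(F k has_vector_derivative F1 k t) (at t)"
      unfolding F_def F1_def by (auto intro!: has_vector_derivative_scaleR dw p1)
    show "(F1 k has_vector_derivative F2 k t) (at t)"
      using has_vector_derivative_add[OF has_vector_derivative_scaleR[OF dw[of k t] p2(2)]
          has_vector_derivative_scaleR[OF dw1[of k t] p1(2)]]
      unfolding F1_def F2_def by simp
    show "isCont (F2 k) t"
      unfolding F2_def by (cases "k < N") (auto intro!: continuous_intros wc pc)
  qed (auto simp: F_def F1_def F2_def w0 w0(1)[of 0, unfolded x_zero] w0(3)[of 0, unfolded x_zero])
  moreover have "to_L2 I (glue F) = to_L2 I (\<lambda>t. bump N t *\<^sub>R p t)"
    unfolding to_L2_def
  proof (rule arg_cong[of _ _ abs_L2], rule ext)
    fix t
    show "(if t \<in> I then glue F t else 0) = (if t \<in> I then bump N t *\<^sub>R p t else 0)"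
    proof (cases "t \<in> I")
      case True
      have t: "t \<in> {x (seg t)..x (Suc (seg t))}" using seg_lower[OF True] seg_upper[of t] True by (auto simp: halfopen_interval_def)
      show ?thesis
      proof (cases "seg t < N")
        case a: True
        then show ?thesis using bump_on_segment[OF t a] True by (simp add: glue_def F_def w_def)
      next
        case False
        then have "x N \<le> t" using seg_less_iff[OF True] by auto
        then show ?thesis using False by (simp add: glue_def F_def bump_eq_0)
      qed
    qed simp
  qed
  ultimately show ?thesis by (metis DomainI)
qed

lemma dense_domain: "K \<subseteq> closure (Domain H_min)"
proof -
  have "{to_L2 I (\<lambda>t. bump N t *\<^sub>R p t) |N p. polynomial_function p} \<subseteq> Domain H_min"
    using bump_in_domain by blast
  then show ?thesis using L2_on_subset_closure_bump closure_mono by blast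
qed

end

section \<open>Green's formula\<close>

text \<open>The values of \<open>W\<close> at \<open>a\<close> and \<open>c\<close> carry no
  information, since the fundamental theorem is available only strictly inside a segment. There
  \<open>W\<close> differs by a constant from the indefinite integral, and one-sided limits identify
  that constant at both ends.\<close>

lemma integral_eq_limit_difference:
  fixes H :: "real \<Rightarrow> complex"
  assumes ac: "a < c" and int: "H integrable_on {a..c}"
    and W: "\<And>u v. a < u \<Longrightarrow> u \<le> v \<Longrightarrow> v < c \<Longrightarrow> (H has_integral (W v - W u)) {u..v}"
    and left: "(W \<longlongrightarrow> La) (at_right a)" and right: "(W \<longlongrightarrow> Lc) (at_left c)"
  shows "integral {a..c} H = Lc - La"
proof -
  define J where "J v = integral {a..v} H" for v
  have J_cont: "continuous_on {a..c} J"
    unfolding J_def by (rule indefinite_integral_continuous_1[OF int])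
  define m where "m = (a + c) / 2"
  have m: "a < m" "m < c" using ac by (auto simp: m_def)
  have JJ: "J v - J u = W v - W u" if "a < u" "u \<le> v" "v < c" for u v
  proof -
    have "H integrable_on {a..v}" by (rule integrable_on_subinterval[OF int]) (use that in auto)
    then have "J u + integral {u..v} H = J v"
      unfolding J_def using that by (intro Henstock_Kurzweil_Integration.integral_combine) auto
    then show ?thesis using integral_unique[OF W[OF that]] by (simp add: algebra_simps)
  qed
  have const: "W v - J v = W m - J m" if "a < v" "v < c" for v
  proof (cases "v \<le> m")
    case True then show ?thesis using JJ[of v m] that m by (simp add: algebra_simps)
  next
    case False then show ?thesis using JJ[of m v] that m by (simp add: algebra_simps)
  qed
  have "(J \<longlongrightarrow> J a) (at_right a)"
    using J_cont ac by (simp add: continuous_on_Icc_at_rightD)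
  with left have "((\<lambda>v. W v - J v) \<longlongrightarrow> La - J a) (at_right a)" by (rule tendsto_diff)
  moreover have "\<forall>\<^sub>F v in at_right a. W v - J v = W m - J m"
    by (rule eventually_at_rightI[of a c]) (use const ac in auto)
  ultimately have "((\<lambda>v. W m - J m) \<longlongrightarrow> La - J a) (at_right a)"
    by (rule Lim_transform_eventually)
  then have 1: "W m - J m = La - J a" by (simp add: tendsto_const_iff)
  have "(J \<longlongrightarrow> J c) (at_left c)"
    using J_cont ac by (simp add: continuous_on_Icc_at_leftD)
  with right have "((\<lambda>v. W v - J v) \<longlongrightarrow> Lc - J c) (at_left c)" by (rule tendsto_diff)
  moreover have "\<forall>\<^sub>F v in at_left c. W v - J v = W m - J m"
    by (rule eventually_at_leftI[of a]) (use const ac in auto)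
  ultimately have "((\<lambda>v. W m - J m) \<longlongrightarrow> Lc - J c) (at_left c)"
    by (rule Lim_transform_eventually)
  then have 2: "W m - J m = Lc - J c" by (simp add: tendsto_const_iff)
  have "J a = 0" by (simp add: J_def)
  then show ?thesis using 1 2 by (simp add: J_def algebra_simps)
qed

context delta_interactions
begin

lemma W22_derivative:
  assumes "f \<in> W22 I X" "t \<in> I - X"
  shows "(f has_vector_derivative D f t) (at t within (I - X))"
  using assms unfolding W22_def deriv_on_def by (auto simp: vector_derivative_works[symmetric])

lemma segment_interior_subset: "x n < u \<Longrightarrow> v < x (Suc n) \<Longrightarrow> {u..v} \<subseteq> I - X"
proof
  fix t assume "x n < u" "v < x (Suc n)" "t \<in> {u..v}"
  then have t: "x n < t" "t < x (Suc n)" by auto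
  then show "t \<in> I - X" using segment_subset_I[of t n] X_not_in_segment[OF t] by auto
qed

text \<open>Absolute continuity of \<open>D f\<close> is only local, but countably many compact
  intervals with rational end points cover the interiors of the segments. The point 0 is added to
  the exceptional set because it is interior to none of them. Where \<open>D f\<close> is
  differentiable, uniqueness of the relative derivative identifies it with
  \<open>D (D f)\<close>.\<close>

lemma W22_second_derivative_ae:
  assumes f: "f \<in> W22 I X"
  shows "negligible {t \<in> I - X. \<not> (D f has_vector_derivative D (D f) t) (at t)}"
proof (rule negligible_subset)
  define R where "R = {(p, q). p \<in> \<rat> \<and> q \<in> \<rat> \<and> p \<le> q \<and> {p..q} \<subseteq> I - X}"
  define N where "N p q = {t \<in> {p<..<q}. \<not> D f differentiable (at t)}" for p q
  have neg: "negligible (N p q)" if "(p, q) \<in> R" for p q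
  proof -
    have "abs_cont_on p q (D f)" using f that by (auto simp: W22_def AC_loc_def R_def)
    then show ?thesis unfolding N_def by (rule abs_cont_differentiable_ae)
  qed
  have "R \<subseteq> \<rat> \<times> \<rat>" by (auto simp: R_def)
  then have "countable R" by (rule countable_subset) (intro countable_SIGMA countable_rat)
  then show "negligible ({0} \<union> (\<Union>(p, q)\<in>R. N p q))"
    using neg by (intro negligible_Un negligible_countable_Union countable_image) auto
  show "{t \<in> I - X. \<not> (D f has_vector_derivative D (D f) t) (at t)} \<subseteq> {0} \<union> (\<Union>(p, q)\<in>R. N p q)"
  proof
    fix t assume t: "t \<in> {t \<in> I - X. \<not> (D f has_vector_derivative D (D f) t) (at t)}"
    then have tI: "t \<in> I - X" by blast
    have nd: "\<not> D f differentiable (at t)"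
    proof
      assume "D f differentiable (at t)"
      then have d: "(D f has_vector_derivative vector_derivative (D f) (at t)) (at t)"
        by (simp add: vector_derivative_works)
      from deriv_on_eqI[OF tI has_vector_derivative_at_within[OF d]] d t show False by simp
    qed
    show "t \<in> {0} \<union> (\<Union>(p, q)\<in>R. N p q)"
    proof (cases "t = 0")
      case False
      then have t': "x (seg t) < t" "t < x (Suc (seg t))" using I_minus_X_cases[OF tI] by auto
      obtain p where p: "p \<in> \<rat>" "x (seg t) < p" "p < t" using Rats_dense_in_real[OF t'(1)] by blast
      obtain q where q: "q \<in> \<rat>" "t < q" "q < x (Suc (seg t))" using Rats_dense_in_real[OF t'(2)] by blast
      have "(p, q) \<in> R" using p q segment_interior_subset[OF p(2) q(3)] by (simp add: R_def)
      moreover have "t \<in> N p q" using p q nd by (simp add: N_def)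
      ultimately show ?thesis by blast
    qed simp
  qed
qed

lemma Green_segment:
  assumes f: "f \<in> W22 I X" and g: "g \<in> W22 I X" and uv: "u \<le> v" "{u..v} \<subseteq> I - X"
  defines "W \<equiv> \<lambda>t. D f t * cnj (g t) - f t * cnj (D g t)"
  shows "abs_cont_on u v W"
    and "((\<lambda>t. D (D f) t * cnj (g t) - f t * cnj (D (D g) t)) has_integral (W v - W u)) {u..v}"
proof -
  have ac: "abs_cont_on u v f" "abs_cont_on u v (D f)" "abs_cont_on u v g" "abs_cont_on u v (D g)"
    using f g uv by (auto simp: W22_def AC_loc_def)
  show acW: "abs_cont_on u v W"
    unfolding W_def by (intro abs_cont_on_diff abs_cont_on_mult abs_cont_on_cnj ac)
  define N where "N h = {t \<in> I - X. \<not> (D h has_vector_derivative D (D h) t) (at t)}" for h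
  have N: "negligible (N f)" "negligible (N g)"
    unfolding N_def by (intro W22_second_derivative_ae f g)+
  show "((\<lambda>t. D (D f) t * cnj (g t) - f t * cnj (D (D g) t)) has_integral (W v - W u)) {u..v}"
  proof (rule abs_cont_fundamental_theorem[OF acW uv(1), of "N f \<union> N g"])
    show "negligible (N f \<union> N g)" using N by simp
    fix t assume t: "t \<in> {u..v} - (N f \<union> N g)"
    have f1: "(f has_vector_derivative D f t) (at t within {u..v})"
      using W22_derivative[OF f, of t] t uv(2) by (meson DiffD1 has_vector_derivative_within_subset subsetD)
    have g1: "(g has_vector_derivative D g t) (at t within {u..v})"
      using W22_derivative[OF g, of t] t uv(2) by (meson DiffD1 has_vector_derivative_within_subset subsetD)
    have f2: "(D f has_vector_derivative D (D f) t) (at t within {u..v})"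
      and g2: "(D g has_vector_derivative D (D g) t) (at t within {u..v})"
      using t uv(2) by (auto simp: N_def intro: has_vector_derivative_at_within)
    have "(W has_vector_derivative (D f t * cnj (D g t) + D (D f) t * cnj (g t))
        - (f t * cnj (D (D g) t) + D f t * cnj (D g t))) (at t within {u..v})"
      unfolding W_def
      by (intro has_vector_derivative_diff has_vector_derivative_mult has_vector_derivative_cnj f1 f2 g1 g2)
    then show "(W has_vector_derivative D (D f) t * cnj (g t) - f t * cnj (D (D g) t)) (at t within {u..v})"
      by simp
  qed
qed

lemma deriv_on_eq_0_beyond:
  assumes "\<And>s. s \<in> I - X \<Longrightarrow> c < s \<Longrightarrow> f s = 0" "t \<in> I - X" "c < t"
  shows "D f t = 0"
proof (rule deriv_on_eqI[OF assms(2)])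
  show "(f has_vector_derivative 0) (at t within (I - X))"
    by (rule has_vector_derivative_transform_within[of "\<lambda>_. 0" _ _ _ "t - c"])
      (use assms in \<open>auto simp: dist_real_def\<close>)
qed

text \<open>The jump of the derivative of \<open>f\<close> contributes \<alpha> y times the
  conjugate of y', and that of \<open>g\<close> contributes y times the conjugate of \<alpha> y'.
  These cancel because the strengths are real, so the Wronskian passes continuously through the
  interaction point.\<close>

lemma interface_Wronskian_limit:
  assumes "interface f" "interface g" "1 \<le> n"
  obtains L where "((\<lambda>t. D f t * cnj (g t) - f t * cnj (D g t)) \<longlongrightarrow> L) (at_left (x n))"
    "((\<lambda>t. D f t * cnj (g t) - f t * cnj (D g t)) \<longlongrightarrow> L) (at_right (x n))"
proof -
  obtain y p q where f: "(f \<longlongrightarrow> y) (at_left (x n))" "(f \<longlongrightarrow> y) (at_right (x n))"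
    "(D f \<longlongrightarrow> p) (at_left (x n))" "(D f \<longlongrightarrow> q) (at_right (x n))" "q - p = of_real (\<alpha> n) * y"
    using assms(1,3) unfolding interface_def by blast
  obtain y' p' q' where g: "(g \<longlongrightarrow> y') (at_left (x n))" "(g \<longlongrightarrow> y') (at_right (x n))"
    "(D g \<longlongrightarrow> p') (at_left (x n))" "(D g \<longlongrightarrow> q') (at_right (x n))" "q' - p' = of_real (\<alpha> n) * y'"
    using assms(2,3) unfolding interface_def by blast
  have "q = p + of_real (\<alpha> n) * y" "q' = p' + of_real (\<alpha> n) * y'" using f(5) g(5) by (auto simp: algebra_simps)
  then have eq: "q * cnj y' - y * cnj q' = p * cnj y' - y * cnj p'" by (simp add: algebra_simps)
  show ?thesis
  proof (rule that)
    show "((\<lambda>t. D f t * cnj (g t) - f t * cnj (D g t)) \<longlongrightarrow> p * cnj y' - y * cnj p') (at_left (x n))"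
      by (intro tendsto_intros f g)
    show "((\<lambda>t. D f t * cnj (g t) - f t * cnj (D g t)) \<longlongrightarrow> p * cnj y' - y * cnj p') (at_right (x n))"
      unfolding eq[symmetric] by (intro tendsto_intros f g)
  qed
qed

theorem Green:
  assumes f: "f \<in> W22 I X" "interface f" and g: "g \<in> W22 I X" "interface g"
    and supp: "\<And>t. t \<in> I - X \<Longrightarrow> x N < t \<Longrightarrow> f t = 0"
  shows "cinner (to_L2 I (D (D f))) (to_L2 I g) = cinner (to_L2 I f) (to_L2 I (D (D g)))"
proof -
  define M where "M = Suc N"
  have suppM: "f t = 0" if "t \<in> I - X" "x M \<le> t" for t
  proof -
    have "x N < x M" by (simp add: M_def)
    then show ?thesis using supp[OF that(1)] that(2) by linarith
  qed
  define W where "W t = D f t * cnj (g t) - f t * cnj (D g t)" for t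
  define H where "H t = D (D f) t * cnj (g t) - f t * cnj (D (D g) t)" for t
  \<comment> \<open>Set to zero off \<open>I - X\<close>, the integrand becomes a function on the
    whole line with the same Lebesgue integral, whose gauge integral can be split at the interaction
    points.\<close>
  define Hz where "Hz t = (if t \<in> I - X then H t else 0)" for t
  have sq: "sq_integrable_on I f" "sq_integrable_on I (D (D f))" "sq_integrable_on I g" "sq_integrable_on I (D (D g))"
    using f g by (auto simp: W22_def)
  have i1: "integrable lebesgue (\<lambda>t. if t \<in> I then D (D f) t * cnj (g t) else 0)"
    using sq_integrable_prod_integrable[OF sq(2)[unfolded sq_integrable_on_def] sq(3)[unfolded sq_integrable_on_def]]
    by (rule back_subst[of "integrable lebesgue"]) auto
  have i2: "integrable lebesgue (\<lambda>t. if t \<in> I then f t * cnj (D (D g) t) else 0)"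
    using sq_integrable_prod_integrable[OF sq(1)[unfolded sq_integrable_on_def] sq(4)[unfolded sq_integrable_on_def]]
    by (rule back_subst[of "integrable lebesgue"]) auto
  have diff: "cinner (to_L2 I (D (D f))) (to_L2 I g) - cinner (to_L2 I f) (to_L2 I (D (D g)))
      = (\<integral>t. (if t \<in> I then H t else 0) \<partial>lebesgue)"
    unfolding cinner_to_L2[OF sq(2,3)] cinner_to_L2[OF sq(1,4)] Bochner_Integration.integral_diff[OF i1 i2, symmetric]
    by (rule Bochner_Integration.integral_cong) (auto simp: H_def)
  have iH: "integrable lebesgue (\<lambda>t. if t \<in> I then H t else 0)"
    using Bochner_Integration.integrable_diff[OF i1 i2]
    by (rule back_subst[of "integrable lebesgue"]) (auto simp: H_def)
  have ae: "AE t in lebesgue. (if t \<in> I then H t else 0) = Hz t"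
    using AE_not_X by eventually_elim (auto simp: Hz_def)
  have Hz_meas: "Hz \<in> borel_measurable lebesgue"
  proof -
    have "X \<in> sets lebesgue" using negligible_X by (rule negligible_imp_sets)
    then have "(\<lambda>t. if t \<in> X then 0 else (if t \<in> I then H t else 0)) \<in> borel_measurable lebesgue"
      using borel_measurable_integrable[OF iH] by measurable
    then show ?thesis by (rule back_subst[of "\<lambda>h. h \<in> borel_measurable lebesgue"]) (auto simp: Hz_def)
  qed
  have int_eq: "(\<integral>t. (if t \<in> I then H t else 0) \<partial>lebesgue) = (\<integral>t. Hz t \<partial>lebesgue)"
    using borel_measurable_integrable[OF iH] Hz_meas ae by (rule integral_cong_AE)
  have iHz: "integrable lebesgue Hz"
    using integrable_cong_AE[OF borel_measurable_integrable[OF iH] Hz_meas ae] iH by blast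
  have HK: "(Hz has_integral (\<integral>t. Hz t \<partial>lebesgue)) UNIV"
    by (rule has_integral_integral_lebesgue[OF iHz])
  then have Hz_int: "Hz integrable_on {u..v}" for u v
    using integrable_on_subcbox[of Hz UNIV u v] by (auto simp: integrable_on_def)
  have W_int: "(Hz has_integral (W v - W u)) {u..v}" if "u \<le> v" "{u..v} \<subseteq> I - X" for u v
    using Green_segment(2)[OF f(1) g(1) that] that(2)
    unfolding W_def[symmetric] H_def[symmetric]
    by (rule_tac has_integral_eq) (auto simp: Hz_def)
  have W0: "W 0 = 0" using f(2) g(2) by (simp add: W_def interface_def)
  \<comment> \<open>The Wronskian has one common limit \<open>L n\<close> at each interaction point,
    so the segment integrals telescope. At 0 it vanishes by the Neumann condition of both functions,
    and at \<open>x M\<close> by the support of \<open>f\<close>.\<close>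
  have "\<exists>L. (n = 0 \<longrightarrow> L = 0) \<and> (n > 0 \<longrightarrow> (W \<longlongrightarrow> L) (at_left (x n))) \<and> (W \<longlongrightarrow> L) (at_right (x n))" for n
  proof (cases "n = 0")
    case True
    define c where "c = x 1 / 2"
    have c: "0 < c" "c < x 1" using x_pos[of 0] by (auto simp: c_def One_nat_def)
    have sub: "{0..c} \<subseteq> I - X"
    proof
      fix t assume t: "t \<in> {0..c}"
      show "t \<in> I - X"
      proof (cases "t = 0")
        case True then show ?thesis using zero_in_I_minus_X by simp
      next
        case False
        then show ?thesis using segment_interior_subset[of 0 t t] t c by (auto simp: x_zero One_nat_def)
      qed
    qed
    have "continuous_on {0..c} W"
      using abs_cont_on_imp_continuous_on[OF Green_segment(1)[OF f(1) g(1) _ sub]] c by (simp add: W_def[abs_def])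
    then have "(W \<longlongrightarrow> W 0) (at_right 0)" using c by (simp add: continuous_on_Icc_at_rightD)
    then show ?thesis using True W0 by (auto simp: x_zero)
  next
    case False
    then have "1 \<le> n" by simp
    then show ?thesis
      using interface_Wronskian_limit[OF f(2) g(2)] False unfolding W_def[symmetric, abs_def] by metis
  qed
  then obtain L where L: "L 0 = 0" "\<And>n. n > 0 \<Longrightarrow> (W \<longlongrightarrow> L n) (at_left (x n))" "\<And>n. (W \<longlongrightarrow> L n) (at_right (x n))"
    by metis
  have seg_int: "integral {x n..x (Suc n)} Hz = L (Suc n) - L n" for n
  proof (rule integral_eq_limit_difference[where W = W])
    show "(Hz has_integral W v - W u) {u..v}" if "x n < u" "u \<le> v" "v < x (Suc n)" for u v
      by (rule W_int[OF that(2) segment_interior_subset[OF that(1,3)]])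
  qed (use Hz_int L in auto)
  have sum_int: "integral {0..x n} Hz = L n" for n
  proof (induction n)
    case 0 then show ?case by (simp add: x_zero L)
  next
    case (Suc n)
    have "integral {0..x n} Hz + integral {x n..x (Suc n)} Hz = integral {0..x (Suc n)} Hz"
      by (rule Henstock_Kurzweil_Integration.integral_combine) (use Hz_int in auto)
    then show ?case using Suc seg_int[of n] by simp
  qed
  have f_beyond: "f t = 0" "D f t = 0" "D (D f) t = 0" if t: "t \<in> I - X" "x M < t" for t
  proof -
    show "f t = 0" using suppM t by simp
    have D0: "D f s = 0" if "s \<in> I - X" "x M < s" for s
      using deriv_on_eq_0_beyond[of "x M" f s] suppM that by auto
    show "D f t = 0" by (rule D0[OF t])
    show "D (D f) t = 0" by (rule deriv_on_eq_0_beyond[of "x M" "D f" t, OF D0 t])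
  qed
  have "L M = 0"
  proof -
    have "\<forall>\<^sub>F t in at_right (x M). W t = 0"
      using eventually_at_right_x[of M] eventually_at_right_less[of "x M"]
      by eventually_elim (simp add: W_def f_beyond)
    then have "((\<lambda>_. 0) \<longlongrightarrow> L M) (at_right (x M))" using L(3)[of M] by (rule Lim_transform_eventually[rotated])
    then show ?thesis by (simp add: tendsto_const_iff)
  qed
  have "(Hz has_integral 0) UNIV"
  proof (rule has_integral_on_superset[of Hz 0 "{0..x M}"])
    show "(Hz has_integral 0) {0..x M}" using Hz_int[of 0 "x M"] sum_int[of M] \<open>L M = 0\<close> by (simp add: has_integral_iff)
    show "Hz t = 0" if "t \<notin> {0..x M}" for t
      using that f_beyond[of t] by (auto simp: Hz_def H_def halfopen_interval_def)
  qed auto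
  then have "(\<integral>t. Hz t \<partial>lebesgue) = 0" using HK by (rule has_integral_unique[rotated])
  then show ?thesis using diff int_eq by simp
qed

lemma domain_support:
  assumes "f \<in> delta_domain b x \<alpha>"
  obtains N where "\<And>t. t \<in> I - X \<Longrightarrow> x N < t \<Longrightarrow> f t = 0"
proof -
  let ?S = "{t \<in> I - X. f t \<noteq> 0}"
  have c: "compact (closure ?S)" "closure ?S \<subseteq> I"
    using assms by (auto simp: delta_domain_iff W22_comp_def)
  show ?thesis
  proof (cases "?S = {}")
    case True then show ?thesis using that[of 0] by blast
  next
    case False
    then have "closure ?S \<noteq> {}" by auto
    then obtain T where T: "T \<in> closure ?S" "\<And>s. s \<in> closure ?S \<Longrightarrow> s \<le> T"
      using compact_attains_sup[OF c(1)] by blast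
    then have "T \<in> I" using c(2) by blast
    then obtain N where "T < x N" using ex_greater by (auto simp: halfopen_interval_def)
    then show ?thesis using T(2) closure_subset[of ?S] by (intro that[of N]) fastforce
  qed
qed

lemma H_min_Green:
  assumes "(F, F') \<in> H_min" and g: "g \<in> W22 I X" "interface g"
  shows "cinner F' (to_L2 I g) = cinner F (to_L2 I (\<lambda>t. - D (D g) t))"
proof -
  obtain f where f: "f \<in> delta_domain b x \<alpha>" and F: "F = to_L2 I f" "F' = to_L2 I (\<lambda>t. - D (D f) t)"
    using assms(1) unfolding H_min_eq by auto
  obtain N where N: "\<And>t. t \<in> I - X \<Longrightarrow> x N < t \<Longrightarrow> f t = 0" using domain_support[OF f] by blast
  have fW: "f \<in> W22 I X" "interface f" using f by (auto simp: delta_domain_iff W22_comp_def)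
  have sq: "sq_integrable_on I (D (D f))" "sq_integrable_on I (D (D g))" using fW g by (auto simp: W22_def)
  have "F' = cscale (-1) (to_L2 I (D (D f)))" unfolding F to_L2_cscale[OF sq(1)] by simp
  moreover have "to_L2 I (\<lambda>t. - D (D g) t) = cscale (-1) (to_L2 I (D (D g)))"
    unfolding to_L2_cscale[OF sq(2)] by simp
  ultimately show ?thesis
    using Green[OF fW g N] by (simp only: cinner_cscale_left cinner_cscale_right F(1)) simp
qed

end

section \<open>Three-term recurrences and hyperbolic functions\<close>

text \<open>A discrete Gronwall inequality, based on
  \<open>1 + \<delta> k \<le> exp (\<delta> k)\<close>.\<close>

lemma multiplicative_perturbation_bounded:
  fixes m \<delta> :: "nat \<Rightarrow> real"
  assumes "\<And>k. 0 \<le> \<delta> k" "summable \<delta>" "\<And>k. 0 \<le> m k" and step: "\<And>k. m (Suc k) \<le> (1 + \<delta> k) * m k"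
  shows "m k \<le> m 0 * exp (suminf \<delta>)"
proof -
  have "m k \<le> m 0 * exp (\<Sum>j<k. \<delta> j)"
  proof (induction k)
    case (Suc k)
    have "m (Suc k) \<le> (1 + \<delta> k) * m k" by (rule step)
    also have "\<dots> \<le> exp (\<delta> k) * (m 0 * exp (\<Sum>j<k. \<delta> j))"
      using Suc assms exp_ge_add_one_self[of "\<delta> k"] by (intro mult_mono) auto
    also have "\<dots> = m 0 * exp (\<Sum>j<Suc k. \<delta> j)" by (simp add: exp_add)
    finally show ?case .
  qed simp
  also have "\<dots> \<le> m 0 * exp (suminf \<delta>)"
    using assms sum_le_suminf[of \<delta> "{..<k}"] by (intro mult_left_mono) auto
  finally show ?thesis .
qed

text \<open>
  With \<open>u\<^sub>k = e\<^sub>k / \<surd>d\<^sub>k\<close> log-convexity turns the leading coefficient into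
  \<open>d\<^sub>k\<^sub>+\<^sub>1 / \<surd>(d\<^sub>k d\<^sub>k\<^sub>+\<^sub>2) \<le> 1\<close>.
\<close>

lemma three_term_growth:
  fixes e d \<eta> \<epsilon> :: "nat \<Rightarrow> real"
  assumes d: "\<And>k. 0 < d k" and lc: "\<And>k. (d (Suc k))\<^sup>2 \<le> d k * d (Suc (Suc k))"
    and nn: "\<And>k. 0 \<le> e k" "\<And>k. 0 \<le> \<eta> k" "\<And>k. 0 \<le> \<epsilon> k"
    and sm: "summable \<eta>" "summable \<epsilon>"
    and rec: "\<And>k. e (Suc (Suc k)) \<le> d (Suc k) / d k * (1 + \<eta> k) * e k + \<epsilon> k * e (Suc k)"
  obtains M where "0 \<le> M" "\<And>k. e k \<le> M * sqrt (d k)"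
proof -
  define \<rho> where "\<rho> = d (Suc 0) / d 0"
  have \<rho>: "\<rho> > 0" using d by (simp add: \<rho>_def)
  have ratio: "\<rho> \<le> d (Suc k) / d k" for k
  proof (induction k)
    case 0 then show ?case by (simp add: \<rho>_def)
  next
    case (Suc k)
    have "d (Suc k) / d k \<le> d (Suc (Suc k)) / d (Suc k)"
      using lc[of k] d by (simp add: divide_simps power2_eq_square mult.commute)
    with Suc show ?case by linarith
  qed
  \<comment> \<open>By log-convexity the ratios of successive gaps are nondecreasing, hence at least
    \<rho>. So \<open>R\<close> bounds \<open>sqrt (d (Suc k) / d (Suc (Suc k)))\<close>, the factor
    that the middle term acquires in the normalisation.\<close>
  define R where "R = sqrt (1 / \<rho>)"
  define u where "u k = e k / sqrt (d k)" for k
  \<comment> \<open>The maximum of two consecutive values turns the second-order inequality into a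
    first-order one.\<close>
  define m where "m k = max (u k) (u (Suc k))" for k
  define \<delta> where "\<delta> k = \<eta> k + R * \<epsilon> k" for k
  have R: "R \<ge> 0" using \<rho> by (simp add: R_def)
  have u_nn: "0 \<le> u k" for k using nn d by (simp add: u_def less_imp_le)
  have e_u: "e k = u k * sqrt (d k)" for k using d[of k] by (simp add: u_def)
  have step: "u (Suc (Suc k)) \<le> (1 + \<eta> k) * u k + R * \<epsilon> k * u (Suc k)" for k
  proof -
    have c1: "d (Suc k) / d k * sqrt (d k) \<le> sqrt (d (Suc (Suc k)))"
    proof -
      have "d (Suc k) \<le> sqrt (d k * d (Suc (Suc k)))" using lc[of k] by (rule real_le_rsqrt)
      then have "d (Suc k) \<le> sqrt (d k) * sqrt (d (Suc (Suc k)))" by (simp add: real_sqrt_mult)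
      moreover have "d (Suc k) / d k * sqrt (d k) = d (Suc k) / sqrt (d k)"
        using d[of k] real_sqrt_mult_self[of "d k"] by (simp add: field_simps)
      ultimately show ?thesis using d[of k] by (simp add: pos_divide_le_eq mult.commute)
    qed
    have c2: "sqrt (d (Suc k)) \<le> R * sqrt (d (Suc (Suc k)))"
    proof -
      have "d (Suc k) \<le> 1 / \<rho> * d (Suc (Suc k))"
        using ratio[of "Suc k"] d[of "Suc k"] \<rho> by (simp add: field_simps)
      then have "sqrt (d (Suc k)) \<le> sqrt (1 / \<rho> * d (Suc (Suc k)))" by (rule real_sqrt_le_mono)
      then show ?thesis unfolding R_def real_sqrt_mult .
    qed
    have "u (Suc (Suc k)) * sqrt (d (Suc (Suc k))) = e (Suc (Suc k))" by (simp add: e_u)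
    also have "\<dots> \<le> d (Suc k) / d k * (1 + \<eta> k) * e k + \<epsilon> k * e (Suc k)" by (rule rec)
    also have "\<dots> = ((1 + \<eta> k) * u k) * (d (Suc k) / d k * sqrt (d k)) + (\<epsilon> k * u (Suc k)) * sqrt (d (Suc k))"
      by (simp add: e_u)
    also have "\<dots> \<le> ((1 + \<eta> k) * u k) * sqrt (d (Suc (Suc k))) + (\<epsilon> k * u (Suc k)) * (R * sqrt (d (Suc (Suc k))))"
      using c1 c2 nn u_nn by (intro add_mono mult_left_mono) auto
    also have "\<dots> = ((1 + \<eta> k) * u k + R * \<epsilon> k * u (Suc k)) * sqrt (d (Suc (Suc k)))"
      by (simp add: algebra_simps)
    finally show ?thesis using d[of "Suc (Suc k)"] by (simp add: mult_le_cancel_right)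
  qed
  have "m k \<le> m 0 * exp (suminf \<delta>)" for k
  proof (rule multiplicative_perturbation_bounded)
    show "0 \<le> \<delta> k" for k using nn R by (simp add: \<delta>_def)
    show "summable \<delta>" unfolding \<delta>_def by (intro summable_add summable_mult sm)
    show m_nn: "0 \<le> m k" for k using u_nn[of k] by (simp add: m_def le_max_iff_disj)
    fix k
    have mk: "u k \<le> m k" "u (Suc k) \<le> m k" by (auto simp: m_def)
    have "u (Suc (Suc k)) \<le> (1 + \<eta> k) * u k + R * \<epsilon> k * u (Suc k)" by (rule step)
    also have "\<dots> \<le> (1 + \<eta> k) * m k + R * \<epsilon> k * m k"
      using mk nn R by (intro add_mono mult_left_mono) auto
    also have "\<dots> = (1 + \<delta> k) * m k" by (simp add: \<delta>_def algebra_simps)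
    finally have 1: "u (Suc (Suc k)) \<le> (1 + \<delta> k) * m k" .
    have "m k \<le> (1 + \<delta> k) * m k"
      using m_nn[of k] nn[of k] R by (simp add: \<delta>_def algebra_simps)
    then show "m (Suc k) \<le> (1 + \<delta> k) * m k" using 1 mk by (simp add: m_def[of "Suc k"])
  qed
  then have "u k \<le> m 0 * exp (suminf \<delta>)" for k
    using order_trans[of "u k" "m k"] by (simp add: m_def)
  then have "e k \<le> (m 0 * exp (suminf \<delta>)) * sqrt (d k)" for k
    unfolding e_u using d[of k] by (intro mult_right_mono) auto
  moreover have "0 \<le> m 0 * exp (suminf \<delta>)" using u_nn[of 0] by (simp add: m_def le_max_iff_disj)
  ultimately show ?thesis using that by blast
qed

section \<open>Hyperbolic functions and fundamental solutions near 0\<close>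

lemma exp_abs_Re_le_3:
  assumes "cmod w \<le> 1"
  shows "exp \<bar>Re w\<bar> \<le> 3"
proof -
  have "\<bar>Re w\<bar> \<le> 1" using abs_Re_le_cmod[of w] assms by linarith
  then have "exp \<bar>Re w\<bar> \<le> exp 1" by simp
  then show ?thesis using exp_le by linarith
qed

lemma norm_half_sum_le:
  fixes u v :: complex
  assumes "cmod u \<le> c" "cmod v \<le> c"
  shows "cmod ((u + v) / 2) \<le> c" "cmod ((u - v) / 2) \<le> c"
  using assms norm_triangle_ineq[of u v] norm_triangle_ineq4[of u v] by (auto simp: norm_divide)

text \<open>Averaging the first-order Taylor expansions at \<open>w\<close> and \<open>- w\<close>
  cancels the linear terms, and 3 bounds the exponential in the remainders.\<close>

lemma norm_cosh_minus_1_le: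
  fixes w :: complex
  assumes "cmod w \<le> 1"
  shows "cmod (cosh w - 1) \<le> 3 * (cmod w)\<^sup>2"
proof -
  note e = exp_abs_Re_le_3[OF assms]
  have "cmod (exp w - (\<Sum>k\<le>1. w ^ k / fact k)) \<le> exp \<bar>Re w\<bar> * cmod w ^ Suc 1 / fact 1"
    by (rule Taylor_exp)
  moreover have "cmod (exp (- w) - (\<Sum>k\<le>1. (- w) ^ k / fact k)) \<le> exp \<bar>Re (- w)\<bar> * cmod (- w) ^ Suc 1 / fact 1"
    by (rule Taylor_exp)
  moreover have "exp \<bar>Re w\<bar> * (cmod w)\<^sup>2 \<le> 3 * (cmod w)\<^sup>2" using e by (intro mult_right_mono) auto
  ultimately have a: "cmod (exp w - (1 + w)) \<le> 3 * (cmod w)\<^sup>2" "cmod (exp (- w) - (1 - w)) \<le> 3 * (cmod w)\<^sup>2"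
    by (simp_all add: numeral_2_eq_2 One_nat_def)
  have eq: "cosh w - 1 = ((exp w - (1 + w)) + (exp (- w) - (1 - w))) / 2"
    by (simp add: cosh_def scaleR_conv_of_real field_simps)
  show ?thesis unfolding eq by (rule norm_half_sum_le(1)[OF a])
qed

lemma norm_sinh_minus_le:
  fixes w :: complex
  assumes "cmod w \<le> 1"
  shows "cmod (sinh w - w) \<le> 3 * cmod w ^ 3"
proof -
  note e = exp_abs_Re_le_3[OF assms]
  have "cmod (exp w - (\<Sum>k\<le>2. w ^ k / fact k)) \<le> exp \<bar>Re w\<bar> * cmod w ^ Suc 2 / fact 2"
    by (rule Taylor_exp)
  moreover have "cmod (exp (- w) - (\<Sum>k\<le>2. (- w) ^ k / fact k)) \<le> exp \<bar>Re (- w)\<bar> * cmod (- w) ^ Suc 2 / fact 2"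
    by (rule Taylor_exp)
  moreover have "exp \<bar>Re w\<bar> * cmod w ^ 3 / 2 \<le> 3 * cmod w ^ 3"
  proof -
    have "exp \<bar>Re w\<bar> * cmod w ^ 3 \<le> 3 * cmod w ^ 3" using e by (intro mult_right_mono) auto
    moreover have "0 \<le> 3 * cmod w ^ 3" by simp
    ultimately show ?thesis by linarith
  qed
  ultimately have a: "cmod (exp w - (1 + w + w\<^sup>2 / 2)) \<le> 3 * cmod w ^ 3"
      "cmod (exp (- w) - (1 - w + w\<^sup>2 / 2)) \<le> 3 * cmod w ^ 3"
    by (simp_all add: numeral_2_eq_2 numeral_3_eq_3)
  have eq: "sinh w - w = ((exp w - (1 + w + w\<^sup>2 / 2)) - (exp (- w) - (1 - w + w\<^sup>2 / 2))) / 2"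
    by (simp add: sinh_def scaleR_conv_of_real field_simps)
  show ?thesis unfolding eq by (rule norm_half_sum_le(2)[OF a])
qed

text \<open>The fundamental solutions of \<open>y'' = \<kappa>\<^sup>2 y\<close> at \<open>0\<close>.\<close>

definition fund_cos :: "complex \<Rightarrow> real \<Rightarrow> complex" where
  "fund_cos \<kappa> s = cosh (\<kappa> * of_real s)"

definition fund_sin :: "complex \<Rightarrow> real \<Rightarrow> complex" where
  "fund_sin \<kappa> s = sinh (\<kappa> * of_real s) / \<kappa>"

lemma fund_0 [simp]: "fund_cos \<kappa> 0 = 1" "fund_sin \<kappa> 0 = 0"
  by (simp_all add: fund_cos_def fund_sin_def)

lemma has_vector_derivative_fund_cos:
  assumes "\<kappa> \<noteq> 0"
  shows "((\<lambda>t. fund_cos \<kappa> (t - c)) has_vector_derivative \<kappa>\<^sup>2 * fund_sin \<kappa> (t - c)) (at t)"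
proof -
  have "((\<lambda>w. cosh (\<kappa> * (w - of_real c))) has_field_derivative \<kappa>\<^sup>2 * fund_sin \<kappa> (t - c)) (at (of_real t))"
    using assms by (auto intro!: derivative_eq_intros simp: fund_sin_def power2_eq_square)
  from has_vector_derivative_real_field[OF this] show ?thesis by (simp add: fund_cos_def)
qed

lemma has_vector_derivative_fund_sin:
  assumes "\<kappa> \<noteq> 0"
  shows "((\<lambda>t. fund_sin \<kappa> (t - c)) has_vector_derivative fund_cos \<kappa> (t - c)) (at t)"
proof -
  have "((\<lambda>w. sinh (\<kappa> * (w - of_real c)) / \<kappa>) has_field_derivative fund_cos \<kappa> (t - c)) (at (of_real t))"
    using assms by (auto intro!: derivative_eq_intros simp: fund_cos_def)
  from has_vector_derivative_real_field[OF this] show ?thesis by (simp add: fund_sin_def)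
qed

lemma fund_pythagoras:
  assumes "\<kappa> \<noteq> 0"
  shows "(fund_cos \<kappa> s)\<^sup>2 - \<kappa>\<^sup>2 * (fund_sin \<kappa> s)\<^sup>2 = 1"
  using assms cosh_square_eq[of "\<kappa> * of_real s"] by (simp add: fund_cos_def fund_sin_def power_divide)

text \<open>A bound of \<open>fund_sin\<close> up to a constant factor would not give a summable
  perturbation of the leading recurrence coefficient; this is why the bounds with
  \<open>1 + 3 * s\<^sup>2\<close> and \<open>1 - 3 * s\<^sup>2\<close> are kept beside the cruder
  \<open>2 * s\<close> and \<open>s / 2\<close>. The threshold 1/3 makes
  \<open>3 * s\<^sup>2\<close> at most 1/3.\<close>

lemma fund_estimates:
  assumes \<kappa>: "cmod \<kappa> = 1" and s: "0 \<le> s" "s \<le> 1 / 3"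
  shows "cmod (fund_cos \<kappa> s - 1) \<le> 3 * s\<^sup>2" "cmod (fund_sin \<kappa> s - of_real s) \<le> 3 * s ^ 3"
    "cmod (fund_cos \<kappa> s) \<le> 2" "cmod (fund_sin \<kappa> s) \<le> s * (1 + 3 * s\<^sup>2)" "cmod (fund_sin \<kappa> s) \<le> 2 * s"
    "s * (1 - 3 * s\<^sup>2) \<le> cmod (fund_sin \<kappa> s)" "s / 2 \<le> cmod (fund_sin \<kappa> s)"
proof -
  have n: "cmod (\<kappa> * of_real s) = s" using \<kappa> s by (simp add: norm_mult)
  have k0: "\<kappa> \<noteq> 0" using \<kappa> by auto
  have s2: "s\<^sup>2 \<le> 1 / 9" using power_mono[OF s(2,1), of 2] by (simp add: power2_eq_square)
  have s3: "s ^ 3 = s * s\<^sup>2" by (simp add: power3_eq_cube power2_eq_square)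
  show c: "cmod (fund_cos \<kappa> s - 1) \<le> 3 * s\<^sup>2"
    using norm_cosh_minus_1_le[of "\<kappa> * of_real s"] n s by (simp add: fund_cos_def)
  have eq: "fund_sin \<kappa> s - of_real s = (sinh (\<kappa> * of_real s) - \<kappa> * of_real s) / \<kappa>"
    using k0 by (simp add: fund_sin_def diff_divide_distrib)
  have "cmod (fund_sin \<kappa> s - of_real s) = cmod (sinh (\<kappa> * of_real s) - \<kappa> * of_real s)"
    unfolding eq norm_divide by (simp add: \<kappa>)
  then show sn: "cmod (fund_sin \<kappa> s - of_real s) \<le> 3 * s ^ 3"
    using norm_sinh_minus_le[of "\<kappa> * of_real s"] n s by simp
  have "cmod (fund_cos \<kappa> s) \<le> cmod (fund_cos \<kappa> s - 1) + 1"
    using norm_triangle_ineq[of "fund_cos \<kappa> s - 1" 1] by simp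
  then show "cmod (fund_cos \<kappa> s) \<le> 2" using c s2 by linarith
  have "cmod (fund_sin \<kappa> s) \<le> cmod (fund_sin \<kappa> s - of_real s) + s"
    using norm_triangle_ineq[of "fund_sin \<kappa> s - of_real s" "of_real s"] s by simp
  then show u: "cmod (fund_sin \<kappa> s) \<le> s * (1 + 3 * s\<^sup>2)" using sn by (simp add: s3 algebra_simps)
  have "s * (1 + 3 * s\<^sup>2) \<le> s * 2" using s s2 by (intro mult_left_mono) auto
  then show "cmod (fund_sin \<kappa> s) \<le> 2 * s" using u by linarith
  have "s \<le> cmod (fund_sin \<kappa> s) + cmod (fund_sin \<kappa> s - of_real s)"
    using norm_triangle_ineq4[of "fund_sin \<kappa> s" "fund_sin \<kappa> s - of_real s"] s by simp
  then show l: "s * (1 - 3 * s\<^sup>2) \<le> cmod (fund_sin \<kappa> s)" using sn by (simp add: s3 algebra_simps)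
  have "s * (1 / 2) \<le> s * (1 - 3 * s\<^sup>2)" using s s2 by (intro mult_left_mono) auto
  then show "s / 2 \<le> cmod (fund_sin \<kappa> s)" using l by linarith
qed

text \<open>The pole \<open>1 / s\<close> is the term that the strengths have to cancel. The
  remainder of order \<open>s\<close>, multiplied by a \<open>fund_sin\<close> over a gap, is
  summable because the gaps are square summable.\<close>

lemma fund_cot_estimate:
  assumes \<kappa>: "cmod \<kappa> = 1" and s: "0 < s" "s \<le> 1 / 3"
  shows "cmod (fund_cos \<kappa> s / fund_sin \<kappa> s - of_real (1 / s)) \<le> 12 * s"
proof -
  note E = fund_estimates[OF \<kappa> less_imp_le[OF s(1)] s(2)]
  have S0: "fund_sin \<kappa> s \<noteq> 0" using E(7) s by auto
  have "fund_cos \<kappa> s / fund_sin \<kappa> s - of_real (1 / s)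
      = (of_real s * (fund_cos \<kappa> s - 1) - (fund_sin \<kappa> s - of_real s)) / (of_real s * fund_sin \<kappa> s)"
    using S0 s by (simp add: field_simps)
  then have "cmod (fund_cos \<kappa> s / fund_sin \<kappa> s - of_real (1 / s))
      = cmod (of_real s * (fund_cos \<kappa> s - 1) - (fund_sin \<kappa> s - of_real s)) / (s * cmod (fund_sin \<kappa> s))"
    using s by (simp only: norm_divide norm_mult) simp
  also have "\<dots> \<le> (6 * s ^ 3) / (s * (s / 2))"
  proof (rule frac_le)
    have "cmod (of_real s * (fund_cos \<kappa> s - 1) - (fund_sin \<kappa> s - of_real s))
        \<le> s * cmod (fund_cos \<kappa> s - 1) + cmod (fund_sin \<kappa> s - of_real s)"
      using norm_triangle_ineq4[of "of_real s * (fund_cos \<kappa> s - 1)" "fund_sin \<kappa> s - of_real s"] s by (simp add: norm_mult)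
    also have "\<dots> \<le> s * (3 * s\<^sup>2) + 3 * s ^ 3" using E s by (intro add_mono mult_left_mono) auto
    also have "\<dots> = 6 * s ^ 3" by (simp add: power3_eq_cube power2_eq_square)
    finally show "cmod (of_real s * (fund_cos \<kappa> s - 1) - (fund_sin \<kappa> s - of_real s)) \<le> 6 * s ^ 3" .
  qed (use E s in \<open>auto intro!: mult_left_mono\<close>)
  also have "\<dots> = 12 * s" using s by (simp add: power3_eq_cube)
  finally show ?thesis .
qed

section \<open>Square integrable solutions\<close>

context delta_interactions
begin

text \<open>Indexed by the left end point of the segment: \<open>gap k\<close> is
  \<open>d (k + 1)\<close> in the numbering of the theorem.\<close>

definition gap :: "nat \<Rightarrow> real" where
  "gap k = x (Suc k) - x k"

lemma gap_pos [simp]: "0 < gap k"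
  by (simp add: gap_def)

text \<open>Value and right derivative at \<open>x\<^sub>n\<close> of the solution with Cauchy data \<open>(a, c)\<close> at \<open>0\<close>.\<close>

primrec coef :: "complex \<Rightarrow> complex \<Rightarrow> complex \<Rightarrow> nat \<Rightarrow> complex \<times> complex" where
  "coef \<kappa> a c 0 = (a, c)"
| "coef \<kappa> a c (Suc n) =
    (let A = fst (coef \<kappa> a c n); B = snd (coef \<kappa> a c n);
         y = A * fund_cos \<kappa> (gap n) + B * fund_sin \<kappa> (gap n)
     in (y, A * (\<kappa>\<^sup>2 * fund_sin \<kappa> (gap n)) + B * fund_cos \<kappa> (gap n) + of_real (\<alpha> (Suc n)) * y))"

definition sol :: "complex \<Rightarrow> complex \<Rightarrow> complex \<Rightarrow> nat \<Rightarrow> real \<Rightarrow> complex" where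
  "sol \<kappa> a c k t = fst (coef \<kappa> a c k) * fund_cos \<kappa> (t - x k) + snd (coef \<kappa> a c k) * fund_sin \<kappa> (t - x k)"

definition sol' :: "complex \<Rightarrow> complex \<Rightarrow> complex \<Rightarrow> nat \<Rightarrow> real \<Rightarrow> complex" where
  "sol' \<kappa> a c k t = fst (coef \<kappa> a c k) * (\<kappa>\<^sup>2 * fund_sin \<kappa> (t - x k)) + snd (coef \<kappa> a c k) * fund_cos \<kappa> (t - x k)"

lemma sol_deriv:
  "\<kappa> \<noteq> 0 \<Longrightarrow> (sol \<kappa> a c k has_vector_derivative sol' \<kappa> a c k t) (at t)"
  unfolding sol_def[abs_def] sol'_def
  by (intro has_vector_derivative_add has_vector_derivative_mult_right
      has_vector_derivative_fund_cos has_vector_derivative_fund_sin)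

lemma sol'_deriv:
  assumes "\<kappa> \<noteq> 0"
  shows "(sol' \<kappa> a c k has_vector_derivative \<kappa>\<^sup>2 * sol \<kappa> a c k t) (at t)"
proof -
  have "(sol' \<kappa> a c k has_vector_derivative (fst (coef \<kappa> a c k) * (\<kappa>\<^sup>2 * fund_cos \<kappa> (t - x k))
      + snd (coef \<kappa> a c k) * (\<kappa>\<^sup>2 * fund_sin \<kappa> (t - x k)))) (at t)"
    unfolding sol'_def[abs_def]
    by (intro has_vector_derivative_add has_vector_derivative_mult_right
      has_vector_derivative_fund_cos has_vector_derivative_fund_sin assms)
  then show ?thesis by (simp add: sol_def algebra_simps)
qed

lemma sol_isCont: "\<kappa> \<noteq> 0 \<Longrightarrow> isCont (sol \<kappa> a c k) t"
  using sol_deriv has_vector_derivative_continuous by blast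

lemma sol_cont: "sol \<kappa> a c (Suc k) (x (Suc k)) = sol \<kappa> a c k (x (Suc k))"
  by (simp add: sol_def gap_def Let_def)

lemma sol_jump:
  "sol' \<kappa> a c (Suc k) (x (Suc k)) - sol' \<kappa> a c k (x (Suc k)) = of_real (\<alpha> (Suc k)) * sol \<kappa> a c k (x (Suc k))"
  by (simp add: sol_def sol'_def gap_def Let_def)

lemma sol_start: "sol \<kappa> a c 0 0 = a" "sol' \<kappa> a c 0 0 = c"
  by (simp_all add: sol_def sol'_def x_zero)

lemma Wronskian_fund:
  assumes "\<kappa> \<noteq> 0"
  shows "(A * fund_cos \<kappa> s + B * fund_sin \<kappa> s) * (A' * (\<kappa>\<^sup>2 * fund_sin \<kappa> s) + B' * fund_cos \<kappa> s)
    - (A * (\<kappa>\<^sup>2 * fund_sin \<kappa> s) + B * fund_cos \<kappa> s) * (A' * fund_cos \<kappa> s + B' * fund_sin \<kappa> s) = A * B' - B * A'"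
proof -
  have "(A * fund_cos \<kappa> s + B * fund_sin \<kappa> s) * (A' * (\<kappa>\<^sup>2 * fund_sin \<kappa> s) + B' * fund_cos \<kappa> s)
    - (A * (\<kappa>\<^sup>2 * fund_sin \<kappa> s) + B * fund_cos \<kappa> s) * (A' * fund_cos \<kappa> s + B' * fund_sin \<kappa> s)
    = (A * B' - B * A') * ((fund_cos \<kappa> s)\<^sup>2 - \<kappa>\<^sup>2 * (fund_sin \<kappa> s)\<^sup>2)"
    by algebra
  then show ?thesis by (simp add: fund_pythagoras[OF assms])
qed

text \<open>Propagation along a segment has determinant one by the hyperbolic Pythagorean identity,
  and crossing an interaction point is a shear. Hence the Wronskian of the two basic solutions
  remains 1.\<close>

lemma coef_det:
  assumes "\<kappa> \<noteq> 0"
  shows "fst (coef \<kappa> 1 0 n) * snd (coef \<kappa> 0 1 n) - snd (coef \<kappa> 1 0 n) * fst (coef \<kappa> 0 1 n) = 1"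
proof (induction n)
  case (Suc n)
  define A B A' B' C S where defs: "A = fst (coef \<kappa> 1 0 n)" "B = snd (coef \<kappa> 1 0 n)"
    "A' = fst (coef \<kappa> 0 1 n)" "B' = snd (coef \<kappa> 0 1 n)" "C = fund_cos \<kappa> (gap n)" "S = fund_sin \<kappa> (gap n)"
  define al where "al = complex_of_real (\<alpha> (Suc n))"
  have "fst (coef \<kappa> 1 0 (Suc n)) * snd (coef \<kappa> 0 1 (Suc n)) - snd (coef \<kappa> 1 0 (Suc n)) * fst (coef \<kappa> 0 1 (Suc n))
     = (A * C + B * S) * (A' * (\<kappa>\<^sup>2 * S) + B' * C + al * (A' * C + B' * S))
       - (A * (\<kappa>\<^sup>2 * S) + B * C + al * (A * C + B * S)) * (A' * C + B' * S)"
    by (simp add: defs al_def Let_def)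
  also have "\<dots> = (A * C + B * S) * (A' * (\<kappa>\<^sup>2 * S) + B' * C) - (A * (\<kappa>\<^sup>2 * S) + B * C) * (A' * C + B' * S)"
    by algebra
  also have "\<dots> = A * B' - B * A'" unfolding defs by (rule Wronskian_fund[OF assms])
  finally show ?case using Suc by (simp add: defs)
qed simp

lemma sol_Wronskian:
  assumes "\<kappa> \<noteq> 0"
  shows "sol \<kappa> 1 0 k t * sol' \<kappa> 0 1 k t - sol' \<kappa> 1 0 k t * sol \<kappa> 0 1 k t = 1"
  unfolding sol_def sol'_def using Wronskian_fund[OF assms] coef_det[OF assms, of k] by simp

text \<open>The slope is eliminated in favour of the values at three consecutive points. The
  Pythagorean identity reduces the coefficient of the oldest value to a plain quotient of two
  \<open>fund_sin\<close> terms, and the middle coefficient collects the strength with the two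
  cotangent-like quotients.\<close>

lemma coef_recurrence:
  assumes \<kappa>: "\<kappa> \<noteq> 0" and S: "fund_sin \<kappa> (gap k) \<noteq> 0" "fund_sin \<kappa> (gap (Suc k)) \<noteq> 0"
  shows "fst (coef \<kappa> a c (Suc (Suc k))) =
    - (fund_sin \<kappa> (gap (Suc k)) / fund_sin \<kappa> (gap k)) * fst (coef \<kappa> a c k)
    + fund_sin \<kappa> (gap (Suc k)) * (fund_cos \<kappa> (gap (Suc k)) / fund_sin \<kappa> (gap (Suc k))
        + fund_cos \<kappa> (gap k) / fund_sin \<kappa> (gap k) + of_real (\<alpha> (Suc k))) * fst (coef \<kappa> a c (Suc k))"
proof -
  define A B C S C' S' al where defs: "A = fst (coef \<kappa> a c k)" "B = snd (coef \<kappa> a c k)"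
    "C = fund_cos \<kappa> (gap k)" "S = fund_sin \<kappa> (gap k)" "C' = fund_cos \<kappa> (gap (Suc k))" "S' = fund_sin \<kappa> (gap (Suc k))"
    "al = complex_of_real (\<alpha> (Suc k))"
  have S0: "S \<noteq> 0" "S' \<noteq> 0" using assms by (simp_all add: defs)
  have py: "C\<^sup>2 - \<kappa>\<^sup>2 * S\<^sup>2 = 1" unfolding defs by (rule fund_pythagoras[OF \<kappa>])
  define y where "y = A * C + B * S"
  have A1: "fst (coef \<kappa> a c (Suc k)) = y" by (simp add: y_def defs Let_def)
  have A2: "fst (coef \<kappa> a c (Suc (Suc k))) = y * C' + (A * (\<kappa>\<^sup>2 * S) + B * C + al * y) * S'"
    by (simp add: y_def defs Let_def)
  \<comment> \<open>Multiplying the new slope by \<open>S\<close> removes \<open>B\<close>, because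
    \<open>B * S\<close> equals \<open>y - A * C\<close>.\<close>
  have "S * (A * (\<kappa>\<^sup>2 * S) + B * C + al * y) = - A * (C\<^sup>2 - \<kappa>\<^sup>2 * S\<^sup>2) + (C + al * S) * y"
    unfolding y_def by algebra
  then have eq: "A * (\<kappa>\<^sup>2 * S) + B * C + al * y = (- A + (C + al * S) * y) / S"
    using S0 py by (simp add: field_simps)
  have "y * C' + (A * (\<kappa>\<^sup>2 * S) + B * C + al * y) * S' = - (S' / S) * A + S' * (C' / S' + C / S + al) * y"
    unfolding eq using S0 by (simp add: field_simps)
  then show ?thesis unfolding A1 A2 by (simp add: defs)
qed

end

locale decaying_interactions = delta_interactions +
  assumes gap_l2: "summable (\<lambda>k. (gap k)\<^sup>2)"
    and gap_log_convex: "\<And>k. (gap (Suc k))\<^sup>2 \<le> gap k * gap (Suc (Suc k))"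
    and strengths: "summable (\<lambda>k. gap (Suc k) * \<bar>\<alpha> (Suc k) + 1 / gap k + 1 / gap (Suc k)\<bar>)"
begin

text \<open>The initial data are arbitrary, so this is the limit circle case at \<open>b\<close>.
  Values at the interaction points of order \<open>sqrt (d k)\<close> bound the solution on the
  segment by a multiple of \<open>sqrt (d k) + sqrt (d (Suc k))\<close>, and the squares weighted by
  segment lengths are summable.\<close>

lemma sol_sq_integrable:
  assumes \<kappa>: "cmod \<kappa> = 1"
  shows "sq_integrable_on I (glue (sol \<kappa> a c))"
proof -
  have \<kappa>0: "\<kappa> \<noteq> 0" using \<kappa> by auto
  have "gap \<longlonglongrightarrow> 0"
    using tendsto_real_sqrt[OF summable_LIMSEQ_zero[OF gap_l2]] by (simp add: less_imp_le)
  then have "\<forall>\<^sub>F k in sequentially. gap k < 1 / 3" by (rule order_tendstoD) simp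
  \<comment> \<open>From this index on the small-gap estimates apply; on the finitely many earlier
    segments boundedness by continuity is enough.\<close>
  then obtain K where K: "\<And>k. K \<le> k \<Longrightarrow> gap k < 1 / 3" by (auto simp: eventually_sequentially)
  define d where "d k = gap (K + k)" for k
  define e where "e k = cmod (fst (coef \<kappa> a c (K + k)))" for k
  define \<beta> where "\<beta> k = \<alpha> (Suc (K + k)) + 1 / d k + 1 / d (Suc k)" for k
  \<comment> \<open>The coefficients 6 and 5 come from
    \<open>(1 + 3 * Q) / (1 - 3 * P) \<le> 1 + 6 * P + 5 * Q\<close> for
    \<open>0 \<le> P \<le> 1 / 9\<close> and \<open>0 \<le> Q\<close>, where \<open>P\<close> and
    \<open>Q\<close> are the squared gaps.\<close>
  define \<eta> where "\<eta> k = 6 * (d k)\<^sup>2 + 5 * (d (Suc k))\<^sup>2" for k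
  \<comment> \<open>This dominates \<open>2 * d (Suc k) * (12 * d (Suc k) + 12 * d k + \<bar>\<beta>
    k\<bar>)\<close>, with the mixed product of gaps split into squares.\<close>
  define \<epsilon> where "\<epsilon> k = 2 * (d (Suc k) * \<bar>\<beta> k\<bar>) + (36 * (d (Suc k))\<^sup>2 + 12 * (d k)\<^sup>2)" for k
  have d: "0 < d k" "d k \<le> 1 / 3" for k using K[of "K + k"] by (auto simp: d_def)
  have sm_d: "summable (\<lambda>k. (d k)\<^sup>2)"
    unfolding d_def using summable_ignore_initial_segment[OF gap_l2, of K] by (simp add: add.commute)
  then have sm_d': "summable (\<lambda>k. (d (Suc k))\<^sup>2)" by (rule summable_Suc_iff[of "\<lambda>k. (d k)\<^sup>2", THEN iffD2])
  have sm_b: "summable (\<lambda>k. d (Suc k) * \<bar>\<beta> k\<bar>)"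
    unfolding d_def \<beta>_def using summable_ignore_initial_segment[OF strengths, of K] by (simp add: add.commute)
  note E = fund_estimates[OF \<kappa> less_imp_le[OF d(1)] d(2)]
  have S_ne: "fund_sin \<kappa> (d k) \<noteq> 0" for k using E(7)[of k] d(1)[of k] by auto
  obtain M where M: "0 \<le> M" "\<And>k. e k \<le> M * sqrt (d k)"
  proof (rule three_term_growth[of d e \<eta> \<epsilon>])
    show "(d (Suc k))\<^sup>2 \<le> d k * d (Suc (Suc k))" for k
      using gap_log_convex[of "K + k"] by (simp add: d_def)
    show "0 \<le> e k" "0 \<le> \<eta> k" "0 \<le> \<epsilon> k" for k
      using d(1)[of "Suc k"] by (auto simp: e_def \<eta>_def \<epsilon>_def)
    show "summable \<eta>" unfolding \<eta>_def by (intro summable_add summable_mult sm_d sm_d')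
    show "summable \<epsilon>" unfolding \<epsilon>_def by (intro summable_add summable_mult sm_d sm_d' sm_b)
    fix k
    define S S' where "S = fund_sin \<kappa> (d k)" and "S' = fund_sin \<kappa> (d (Suc k))"
    define C C' where "C = fund_cos \<kappa> (d k)" and "C' = fund_cos \<kappa> (d (Suc k))"
    define al where "al = complex_of_real (\<alpha> (Suc (K + k)))"
    have rec: "fst (coef \<kappa> a c (K + Suc (Suc k))) = - (S' / S) * fst (coef \<kappa> a c (K + k))
        + S' * (C' / S' + C / S + al) * fst (coef \<kappa> a c (K + Suc k))"
      using coef_recurrence[OF \<kappa>0, of "K + k" a c] S_ne[of k] S_ne[of "Suc k"]
      by (simp add: S_def S'_def C_def C'_def al_def d_def)
    have c1: "cmod (S' / S) \<le> d (Suc k) / d k * (1 + \<eta> k)"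
    proof -
      define p q where "p = d k" and "q = d (Suc k)"
      have p: "0 < p" "p\<^sup>2 \<le> 1 / 9" using d[of k] power_mono[of "d k" "1 / 3" 2] by (simp_all add: p_def power2_eq_square)
      have q: "0 < q" "0 \<le> q\<^sup>2" using d[of "Suc k"] by (simp_all add: q_def)
      have "cmod (S' / S) \<le> (q * (1 + 3 * q\<^sup>2)) / (p * (1 - 3 * p\<^sup>2))"
        unfolding norm_divide S_def S'_def p_def q_def
        using E(4)[of "Suc k"] E(6)[of k] p d[of "Suc k"] by (intro frac_le) (auto simp: p_def)
      also have "\<dots> = q / p * ((1 + 3 * q\<^sup>2) / (1 - 3 * p\<^sup>2))" by simp
      also have "\<dots> \<le> q / p * (1 + 6 * p\<^sup>2 + 5 * q\<^sup>2)"
      proof (rule mult_left_mono)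
        show "(1 + 3 * q\<^sup>2) / (1 - 3 * p\<^sup>2) \<le> 1 + 6 * p\<^sup>2 + 5 * q\<^sup>2"
        proof -
        define P Q where "P = p\<^sup>2" and "Q = q\<^sup>2"
        have P: "0 \<le> P" "P \<le> 1 / 9" and Q: "0 \<le> Q" using p q by (simp_all add: P_def Q_def)
        have "0 \<le> P * (3 - 18 * P)" using P by (intro mult_nonneg_nonneg) auto
        moreover have "15 * P * Q \<le> 2 * Q" using P Q by (intro mult_right_mono) auto
        ultimately have "1 + 3 * Q \<le> (1 + 6 * P + 5 * Q) * (1 - 3 * P)" by (simp add: algebra_simps)
        then have "(1 + 3 * Q) / (1 - 3 * P) \<le> 1 + 6 * P + 5 * Q" using P by (subst pos_divide_le_eq) auto
        then show ?thesis by (simp add: P_def Q_def)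
        qed
      qed (use p q in simp)
      finally show ?thesis by (simp add: \<eta>_def p_def q_def add.assoc)
    qed
    have c2: "cmod (S' * (C' / S' + C / S + al)) \<le> \<epsilon> k"
    proof -
      have "C' / S' + C / S + al = (C' / S' - of_real (1 / d (Suc k))) + (C / S - of_real (1 / d k)) + of_real (\<beta> k)"
        by (simp add: \<beta>_def al_def)
      then have "cmod (C' / S' + C / S + al) \<le> cmod (C' / S' - of_real (1 / d (Suc k))) + cmod (C / S - of_real (1 / d k)) + cmod (of_real (\<beta> k))"
        by (metis norm_triangle_ineq norm_triangle_mono order_refl)
      also have "\<dots> \<le> 12 * d (Suc k) + 12 * d k + \<bar>\<beta> k\<bar>"
        unfolding S_def S'_def C_def C'_def
        using fund_cot_estimate[OF \<kappa> d(1) d(2)] by (intro add_mono) auto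
      finally have "cmod (S' * (C' / S' + C / S + al)) \<le> (2 * d (Suc k)) * (12 * d (Suc k) + 12 * d k + \<bar>\<beta> k\<bar>)"
        unfolding norm_mult using E(5)[of "Suc k"] d(1)[of "Suc k"] by (intro mult_mono) (auto simp: S'_def)
      also have "\<dots> = 2 * (d (Suc k) * \<bar>\<beta> k\<bar>) + (24 * (d (Suc k))\<^sup>2 + 12 * (2 * d (Suc k) * d k))"
        by (simp add: algebra_simps power2_eq_square)
      also have "\<dots> \<le> \<epsilon> k"
        using sum_squares_bound[of "d (Suc k)" "d k"] by (simp add: \<epsilon>_def)
      finally show ?thesis .
    qed
    have "e (Suc (Suc k)) \<le> cmod (S' / S) * e k + cmod (S' * (C' / S' + C / S + al)) * e (Suc k)"
      unfolding e_def rec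
      using norm_triangle_ineq[of "- (S' / S) * fst (coef \<kappa> a c (K + k))"
          "S' * (C' / S' + C / S + al) * fst (coef \<kappa> a c (K + Suc k))"]
      by (simp only: norm_mult norm_minus_cancel)
    also have "\<dots> \<le> d (Suc k) / d k * (1 + \<eta> k) * e k + \<epsilon> k * e (Suc k)"
      using c1 c2 by (intro add_mono mult_right_mono) (auto simp: e_def)
    finally show "e (Suc (Suc k)) \<le> d (Suc k) / d k * (1 + \<eta> k) * e k + \<epsilon> k * e (Suc k)" .
  qed (use d in auto)
  have cont: "continuous_on {x k..x (Suc k)} (sol \<kappa> a c k)" for k
    using sol_isCont[OF \<kappa>0] by (blast intro: continuous_at_imp_continuous_on)
  have "\<exists>B. \<forall>t\<in>{x k..x (Suc k)}. cmod (sol \<kappa> a c k t) \<le> B" for k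
    by (rule continuous_on_Icc_bounded[OF cont])
  then obtain Bd where Bd: "\<And>k t. t \<in> {x k..x (Suc k)} \<Longrightarrow> cmod (sol \<kappa> a c k t) \<le> Bd k" by metis
  \<comment> \<open>The slope may be large, of the order of the end values divided by the gap. It is
    recovered from the two end values using
    \<open>d k / 2 \<le> cmod (fund_sin \<kappa> (d k))\<close>, and on the segment it is multiplied
    by at most \<open>2 * d k\<close>, so only the end values remain in the bound.\<close>
  have tail: "cmod (sol \<kappa> a c (K + k) t) \<le> 10 * e k + 4 * e (Suc k)" if t: "t \<in> {x (K + k)..<x (Suc (K + k))}" for k t
  proof -
    define s where "s = t - x (K + k)"
    have s: "0 \<le> s" "s \<le> d k" using t by (auto simp: s_def d_def gap_def)
    define A B A1 where "A = fst (coef \<kappa> a c (K + k))" and "B = snd (coef \<kappa> a c (K + k))" and "A1 = fst (coef \<kappa> a c (K + Suc k))"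
    have eA: "cmod A = e k" "cmod A1 = e (Suc k)" by (simp_all add: A_def A1_def e_def)
    have "A1 = A * fund_cos \<kappa> (d k) + B * fund_sin \<kappa> (d k)" by (simp add: A_def B_def A1_def d_def Let_def)
    then have "B * fund_sin \<kappa> (d k) = A1 - A * fund_cos \<kappa> (d k)" by simp
    then have "cmod B * cmod (fund_sin \<kappa> (d k)) = cmod (A1 - A * fund_cos \<kappa> (d k))" by (metis norm_mult)
    also have "\<dots> \<le> cmod A1 + cmod A * cmod (fund_cos \<kappa> (d k))"
      using norm_triangle_ineq4[of A1 "A * fund_cos \<kappa> (d k)"] by (simp add: norm_mult)
    also have "\<dots> \<le> e (Suc k) + e k * 2"
      unfolding eA using E(3)[of k] by (intro add_mono mult_left_mono) (auto simp: e_def)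
    finally have "cmod B * cmod (fund_sin \<kappa> (d k)) \<le> e (Suc k) + 2 * e k" by simp
    moreover have "cmod B * (d k / 2) \<le> cmod B * cmod (fund_sin \<kappa> (d k))"
      using E(7)[of k] by (intro mult_left_mono) auto
    ultimately have "cmod B * (d k / 2) \<le> e (Suc k) + 2 * e k" by linarith
    then have Bd: "cmod B * (2 * d k) \<le> 4 * e (Suc k) + 8 * e k" by simp
    note Es = fund_estimates[OF \<kappa> s(1) order_trans[OF s(2) d(2)]]
    have "cmod (sol \<kappa> a c (K + k) t) \<le> cmod A * cmod (fund_cos \<kappa> s) + cmod B * cmod (fund_sin \<kappa> s)"
      unfolding sol_def A_def[symmetric] B_def[symmetric] s_def[symmetric] by (metis norm_mult norm_triangle_ineq)
    also have "\<dots> \<le> e k * 2 + cmod B * (2 * d k)"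
      unfolding eA using Es(3,5) s by (intro add_mono mult_left_mono) (auto simp: e_def)
    finally show ?thesis using Bd by linarith
  qed
  define b' where "b' k = (if k < K then Bd k else 10 * e (k - K) + 4 * e (Suc (k - K)))" for k
  show ?thesis
  proof (rule sq_integrable_on_glue[OF cont, of b'])
    fix k t assume t: "t \<in> {x k..<x (Suc k)}"
    show "cmod (sol \<kappa> a c k t) \<le> b' k"
    proof (cases "k < K")
      case True then show ?thesis using Bd[of t k] t by (simp add: b'_def)
    next
      case False
      then show ?thesis using tail[of t "k - K"] t by (simp add: b'_def)
    qed
  next
    have "summable (\<lambda>k. (x (Suc (k + K)) - x (k + K)) * (b' (k + K))\<^sup>2)"
    proof (rule summable_comparison_test'[where N = 0])
      \<comment> \<open>Squaring the segment bound gives at most 200 and 32 times the squared end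
        values; splitting the mixed gap product then adds 16 to 200.\<close>
      show "summable (\<lambda>k. M\<^sup>2 * (216 * (d k)\<^sup>2 + 16 * (d (Suc k))\<^sup>2))"
        by (intro summable_mult summable_add sm_d sm_d')
      fix k
      have "(b' (k + K))\<^sup>2 = (10 * e k + 4 * e (Suc k))\<^sup>2" by (simp add: b'_def)
      also have "\<dots> \<le> 200 * (e k)\<^sup>2 + 32 * (e (Suc k))\<^sup>2"
        using sum_squares_bound[of "10 * e k" "4 * e (Suc k)"] by (simp add: power2_eq_square algebra_simps)
      also have "\<dots> \<le> 200 * (M\<^sup>2 * d k) + 32 * (M\<^sup>2 * d (Suc k))"
      proof -
        have "(e j)\<^sup>2 \<le> M\<^sup>2 * d j" for j
        proof -
          have "(e j)\<^sup>2 \<le> (M * sqrt (d j))\<^sup>2" using M(2) by (intro power_mono) (auto simp: e_def)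
          then show ?thesis using d(1)[of j] by (simp add: power_mult_distrib)
        qed
        then show ?thesis by (intro add_mono mult_left_mono) auto
      qed
      finally have "d k * (b' (k + K))\<^sup>2 \<le> d k * (200 * (M\<^sup>2 * d k) + 32 * (M\<^sup>2 * d (Suc k)))"
        using d(1)[of k] by (intro mult_left_mono) auto
      also have "\<dots> = M\<^sup>2 * (200 * (d k)\<^sup>2 + 16 * (2 * d k * d (Suc k)))" by (simp add: algebra_simps power2_eq_square)
      also have "\<dots> \<le> M\<^sup>2 * (216 * (d k)\<^sup>2 + 16 * (d (Suc k))\<^sup>2)"
        using sum_squares_bound[of "d k" "d (Suc k)"] by (intro mult_left_mono) auto
      finally show "norm ((x (Suc (k + K)) - x (k + K)) * (b' (k + K))\<^sup>2) \<le> M\<^sup>2 * (216 * (d k)\<^sup>2 + 16 * (d (Suc k))\<^sup>2)"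
        using d(1)[of k] by (simp add: d_def gap_def add.commute abs_mult)
    qed
    then show "summable (\<lambda>k. (x (Suc k) - x k) * (b' k)\<^sup>2)"
      by (subst (asm) summable_iff_shift)
  qed
qed

end

section \<open>The closure is symmetric\<close>

lemma abs_cont_on_cmult:
  "abs_cont_on u v f \<Longrightarrow> abs_cont_on u v (\<lambda>t. c * f t)"
  by (rule abs_cont_on_increment_le[of u v f "cmod c"]) (simp_all add: norm_mult flip: right_diff_distrib)

lemma abs_cont_on_add:
  assumes "abs_cont_on u v f" "abs_cont_on u v g"
  shows "abs_cont_on u v (\<lambda>t. f t + g t)"
  using abs_cont_on_diff[OF assms(1) abs_cont_on_cmult[OF assms(2), of "-1"]] by simp

lemma abs_cont_on_cong:
  assumes "abs_cont_on u v f" "\<And>t. t \<in> {u..v} \<Longrightarrow> f t = g t"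
  shows "abs_cont_on u v g"
  by (rule abs_cont_on_increment_le[OF assms(1), of 1]) (simp_all add: assms(2))

lemma cscale_minus_one_add: "cscale (-1) F + G = G - F"
  by (simp only: minus_L2_def add.commute)

text \<open>Linearity and symmetry pass to limits. Single-valuedness does not do so by itself: two
  images of one vector differ by a vector that the extended symmetry makes orthogonal to the domain,
  and density forces this difference to be zero.\<close>

lemma symmetric_operator_closure:
  assumes K: "closed K" and T: "T \<subseteq> K \<times> K" and zero: "(0, 0) \<in> T"
    and lin: "\<And>F F' G G' c. (F, F') \<in> T \<Longrightarrow> (G, G') \<in> T \<Longrightarrow> (cscale c F + G, cscale c F' + G') \<in> T"
    and dense: "K \<subseteq> closure (Domain T)"
    and sym: "\<And>F F' G G'. (F, F') \<in> T \<Longrightarrow> (G, G') \<in> T \<Longrightarrow> cinner F' G = cinner F G'"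
  shows "symmetric_operator K (closure T)"
proof -
  have cK: "closure T \<subseteq> K \<times> K" by (rule closure_minimal[OF T closed_Times[OF K K]])
  have seq: "\<exists>f f'. (\<forall>n. (f n, f' n) \<in> T) \<and> f \<longlonglongrightarrow> F \<and> f' \<longlonglongrightarrow> F'" if "(F, F') \<in> closure T" for F F'
  proof -
    obtain s where s: "\<And>n. s n \<in> T" "s \<longlonglongrightarrow> (F, F')" using \<open>(F, F') \<in> closure T\<close> unfolding closure_sequential by blast
    then show ?thesis
      using tendsto_fst[OF s(2)] tendsto_snd[OF s(2)]
      by (intro exI[of _ "\<lambda>n. fst (s n)"] exI[of _ "\<lambda>n. snd (s n)"]) auto
  qed
  have lin': "(cscale c F + G, cscale c F' + G') \<in> closure T"
    if F: "(F, F') \<in> closure T" and G: "(G, G') \<in> closure T" for F F' G G' c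
  proof -
    obtain f f' where f: "\<And>n. (f n, f' n) \<in> T" "f \<longlonglongrightarrow> F" "f' \<longlonglongrightarrow> F'" using seq[OF F] by blast
    obtain g g' where g: "\<And>n. (g n, g' n) \<in> T" "g \<longlonglongrightarrow> G" "g' \<longlonglongrightarrow> G'" using seq[OF G] by blast
    have "(\<lambda>n. (cscale c (f n) + g n, cscale c (f' n) + g' n)) \<longlonglongrightarrow> (cscale c F + G, cscale c F' + G')"
      by (intro tendsto_intros f g)
    moreover have "\<forall>n. (cscale c (f n) + g n, cscale c (f' n) + g' n) \<in> T" using lin f(1) g(1) by blast
    ultimately show ?thesis unfolding closure_sequential by (intro exI conjI)
  qed
  have zero': "(0, 0) \<in> closure T" using zero closure_subset by blast
  have sym': "cinner F' G = cinner F G'" if F: "(F, F') \<in> closure T" and G: "(G, G') \<in> closure T" for F F' G G'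
  proof -
    obtain f f' where f: "\<And>n. (f n, f' n) \<in> T" "f \<longlonglongrightarrow> F" "f' \<longlonglongrightarrow> F'" using seq[OF F] by blast
    obtain g g' where g: "\<And>n. (g n, g' n) \<in> T" "g \<longlonglongrightarrow> G" "g' \<longlonglongrightarrow> G'" using seq[OF G] by blast
    have "(\<lambda>n. cinner (f' n) (g n)) \<longlonglongrightarrow> cinner F' G" by (intro tendsto_intros f g)
    moreover have "(\<lambda>n. cinner (f' n) (g n)) \<longlonglongrightarrow> cinner F G'"
      unfolding sym[OF f(1) g(1)] by (intro tendsto_intros f g)
    ultimately show ?thesis by (rule LIMSEQ_unique)
  qed
  have dense': "K \<subseteq> closure (Domain (closure T))"
    using dense closure_mono[OF Domain_mono[OF closure_subset[of T]]] by blast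
  have "single_valued (closure T)"
  proof (rule single_valuedI)
    fix F A B assume FA: "(F, A) \<in> closure T" and FB: "(F, B) \<in> closure T"
    have "(cscale (-1) F + F, cscale (-1) B + A) \<in> closure T" by (rule lin'[OF FB FA])
    then have AB: "(0, A - B) \<in> closure T" by (simp only: cscale_minus_one_add diff_self)
    have "A - B = 0"
    proof (rule orthogonal_to_dense_eq_0[OF _ dense'])
      show "A - B \<in> K" using AB cK by auto
      fix G assume "G \<in> Domain (closure T)"
      then obtain G' where "(G, G') \<in> closure T" by blast
      from sym'[OF AB this] have "cinner (A - B) G = 0" by simp
      then show "cinner G (A - B) = 0" using cinner_commute[of G "A - B"] by simp
    qed
    then show "A = B" by simp
  qed
  then show ?thesis
    unfolding symmetric_operator_def
  proof (intro conjI allI ballI)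
    show "closure T \<subseteq> K \<times> K" "(0, 0) \<in> closure T" "K \<subseteq> closure (Domain (closure T))" by fact+
    fix p q c assume p: "p \<in> closure T" and q: "q \<in> closure T"
    show "case p of (F, F') \<Rightarrow> (cscale c F, cscale c F') \<in> closure T"
      using lin'[OF _ zero', of "fst p" "snd p" c] p by (simp add: case_prod_beta)
    show "case p of (F, F') \<Rightarrow> \<forall>(G, G')\<in>closure T. (F + G, F' + G') \<in> closure T"
      using lin'[where c = 1] p by auto
    show "case p of (F, F') \<Rightarrow> \<forall>(G, G')\<in>closure T. cinner F' G = cinner F G'"
      using sym' p by auto
  qed
qed

text \<open>The pairing condition is closed in the tested element, so passing to the closure imposes
  nothing new and test functions from the minimal domain suffice.\<close>

lemma eigenspace_adjoint_closure:
  "eigenspace (adjoint_op K (closure T)) z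
    = {G \<in> K. cscale z G \<in> K \<and> (\<forall>(F, F')\<in>T. cinner F' G = cinner F (cscale z G))}"
proof -
  have "(\<forall>(F, F')\<in>closure T. cinner F' G = cinner F (cscale z G)) \<longleftrightarrow> (\<forall>(F, F')\<in>T. cinner F' G = cinner F (cscale z G))" for G
  proof
    assume "\<forall>(F, F')\<in>T. cinner F' G = cinner F (cscale z G)"
    then have "T \<subseteq> {p. cinner (snd p) G = cinner (fst p) (cscale z G)}" by auto
    moreover have "closed {p. cinner (snd p) G = cinner (fst p) (cscale z G)}"
      by (intro closed_Collect_eq continuous_intros)
    ultimately have "closure T \<subseteq> {p. cinner (snd p) G = cinner (fst p) (cscale z G)}" by (rule closure_minimal)
    then show "\<forall>(F, F')\<in>closure T. cinner F' G = cinner F (cscale z G)" by auto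
  qed (use closure_subset in blast)
  then show ?thesis by (auto simp: eigenspace_def adjoint_op_def)
qed

section \<open>Linearity of the minimal operator and symmetry of its closure\<close>

context delta_interactions
begin

lemma interface_lincomb:
  assumes f: "f \<in> W22 I X" "interface f" and g: "g \<in> W22 I X" "interface g"
    and Dh: "\<And>t. t \<in> I - X \<Longrightarrow> D (\<lambda>t. c * f t + g t) t = c * D f t + D g t"
  shows "interface (\<lambda>t. c * f t + g t)"
  unfolding interface_def
proof (intro conjI allI impI)
  show "D (\<lambda>t. c * f t + g t) 0 = 0"
    using Dh[OF zero_in_I_minus_X] f(2) g(2) by (simp add: interface_def)
  fix n :: nat assume n: "1 \<le> n"
  obtain k where k: "n = Suc k" using n by (cases n) auto
  obtain y p q where fl: "(f \<longlongrightarrow> y) (at_left (x n))" "(f \<longlongrightarrow> y) (at_right (x n))"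
    "(D f \<longlongrightarrow> p) (at_left (x n))" "(D f \<longlongrightarrow> q) (at_right (x n))" "q - p = of_real (\<alpha> n) * y"
    using f(2) n unfolding interface_def by blast
  obtain y' p' q' where gl: "(g \<longlongrightarrow> y') (at_left (x n))" "(g \<longlongrightarrow> y') (at_right (x n))"
    "(D g \<longlongrightarrow> p') (at_left (x n))" "(D g \<longlongrightarrow> q') (at_right (x n))" "q' - p' = of_real (\<alpha> n) * y'"
    using g(2) n unfolding interface_def by blast
  have left: "\<forall>\<^sub>F t in at_left (x n). c * D f t + D g t = D (\<lambda>t. c * f t + g t) t"
    unfolding k using eventually_at_left_x[of k] by eventually_elim (metis Dh)
  have right: "\<forall>\<^sub>F t in at_right (x n). c * D f t + D g t = D (\<lambda>t. c * f t + g t) t"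
    using eventually_at_right_x[of n] by eventually_elim (metis Dh)
  show "\<exists>y p q. ((\<lambda>t. c * f t + g t) \<longlongrightarrow> y) (at_left (x n)) \<and> ((\<lambda>t. c * f t + g t) \<longlongrightarrow> y) (at_right (x n)) \<and>
        (D (\<lambda>t. c * f t + g t) \<longlongrightarrow> p) (at_left (x n)) \<and> (D (\<lambda>t. c * f t + g t) \<longlongrightarrow> q) (at_right (x n)) \<and>
        q - p = of_real (\<alpha> n) * y"
  proof (intro exI conjI)
    show "((\<lambda>t. c * f t + g t) \<longlongrightarrow> c * y + y') (at_left (x n))" by (intro tendsto_intros fl gl)
    show "((\<lambda>t. c * f t + g t) \<longlongrightarrow> c * y + y') (at_right (x n))" by (intro tendsto_intros fl gl)
    show "(D (\<lambda>t. c * f t + g t) \<longlongrightarrow> c * p + p') (at_left (x n))"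
      by (rule Lim_transform_eventually[OF _ left]) (intro tendsto_intros fl gl)
    show "(D (\<lambda>t. c * f t + g t) \<longlongrightarrow> c * q + q') (at_right (x n))"
      by (rule Lim_transform_eventually[OF _ right]) (intro tendsto_intros fl gl)
    have "c * q + q' - (c * p + p') = c * (q - p) + (q' - p')" by (simp add: algebra_simps)
    then show "c * q + q' - (c * p + p') = of_real (\<alpha> n) * (c * y + y')"
      unfolding fl(5) gl(5) by (simp add: algebra_simps)
  qed
qed

text \<open>First derivatives combine linearly on all of \<open>I - X\<close>. Second derivatives do
  so only almost everywhere, since \<open>deriv_on\<close> takes an arbitrary value where the
  derivative is missing; this still determines the element of the Hilbert space.\<close>

lemma delta_domain_lincomb:
  fixes c :: complex
  assumes f: "f \<in> delta_domain b x \<alpha>" and g: "g \<in> delta_domain b x \<alpha>"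
  defines "h \<equiv> \<lambda>t. c * f t + g t"
  shows "h \<in> delta_domain b x \<alpha>"
    and "AE t in lebesgue. t \<in> I \<longrightarrow> D (D h) t = c * D (D f) t + D (D g) t"
proof -
  have fW: "f \<in> W22 I X" "interface f" and gW: "g \<in> W22 I X" "interface g"
    using f g by (auto simp: delta_domain_iff W22_comp_def)
  have dh: "(h has_vector_derivative c * D f t + D g t) (at t within (I - X))" if "t \<in> I - X" for t
    unfolding h_def
    by (intro has_vector_derivative_add has_vector_derivative_mult_right W22_derivative[OF _ that] fW gW)
  have Dh: "D h t = c * D f t + D g t" if "t \<in> I - X" for t by (rule deriv_on_eqI[OF that dh[OF that]])
  have DDh: "D (D h) t = c * D (D f) t + D (D g) t"
    if "t \<in> I - X" "(D f has_vector_derivative D (D f) t) (at t)" "(D g has_vector_derivative D (D g) t) (at t)" for t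
  proof (rule deriv_on_eqI[OF that(1)])
    have "((\<lambda>t. c * D f t + D g t) has_vector_derivative c * D (D f) t + D (D g) t) (at t within (I - X))"
      by (rule has_vector_derivative_add[OF has_vector_derivative_mult_right[OF has_vector_derivative_at_within[OF that(2)]]
            has_vector_derivative_at_within[OF that(3)]])
    then show "(D h has_vector_derivative c * D (D f) t + D (D g) t) (at t within (I - X))"
      by (rule has_vector_derivative_transform[OF that(1), rotated]) (rule Dh)
  qed
  have ae: "AE t in lebesgue. t \<in> I - X \<longrightarrow> (D f has_vector_derivative D (D f) t) (at t)" if "f \<in> W22 I X" for f
    using AE_not_in[OF W22_second_derivative_ae[OF that, unfolded negligible_iff_null_sets]]
    by eventually_elim blast
  show AE_DDh: "AE t in lebesgue. t \<in> I \<longrightarrow> D (D h) t = c * D (D f) t + D (D g) t"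
    using ae[OF fW(1)] ae[OF gW(1)] AE_not_X by eventually_elim (use DDh in blast)
  have sq: "sq_integrable_on I f" "sq_integrable_on I (D (D f))" "sq_integrable_on I g" "sq_integrable_on I (D (D g))"
    using fW gW by (auto simp: W22_def)
  have sqh: "sq_integrable_on I h" unfolding h_def by (intro sq_integrable_on_add sq_integrable_on_cmult sq)
  have "sq_integrable_on I (\<lambda>t. c * D (D f) t + D (D g) t)"
    by (intro sq_integrable_on_add sq_integrable_on_cmult sq)
  then have sqh2: "sq_integrable_on I (D (D h))"
    unfolding sq_integrable_on_def
    by (rule sq_integrable_cong_AE) (use AE_DDh in \<open>eventually_elim, simp\<close>)
  have ac: "AC_loc (I - X) h" "AC_loc (I - X) (D h)"
  proof -
    show "AC_loc (I - X) h"
      using fW(1) gW(1) unfolding h_def W22_def AC_loc_def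
      by (auto intro!: abs_cont_on_add abs_cont_on_cmult)
    have "abs_cont_on u v (D h)" if uv: "u \<le> v" "{u..v} \<subseteq> I - X" for u v
    proof (rule abs_cont_on_cong)
      have "abs_cont_on u v (D f)" "abs_cont_on u v (D g)"
        using fW(1) gW(1) uv unfolding W22_def AC_loc_def by blast+
      then show "abs_cont_on u v (\<lambda>t. c * D f t + D g t)" by (intro abs_cont_on_add abs_cont_on_cmult)
      show "c * D f t + D g t = D h t" if "t \<in> {u..v}" for t using Dh[of t] uv that by auto
    qed
    then show "AC_loc (I - X) (D h)" by (simp add: AC_loc_def)
  qed
  have "h differentiable (at t within I - X)" if "t \<in> I - X" for t
    using dh[OF that] by (rule differentiableI_vector)
  then have hW: "h \<in> W22 I X" using sqh sqh2 ac by (simp add: W22_def)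
  have cf: "compact (closure {t \<in> I - X. f t \<noteq> 0})" "closure {t \<in> I - X. f t \<noteq> 0} \<subseteq> I"
    and cg: "compact (closure {t \<in> I - X. g t \<noteq> 0})" "closure {t \<in> I - X. g t \<noteq> 0} \<subseteq> I"
    using f g unfolding delta_domain_iff W22_comp_def by blast+
  have "{t \<in> I - X. h t \<noteq> 0} \<subseteq> {t \<in> I - X. f t \<noteq> 0} \<union> {t \<in> I - X. g t \<noteq> 0}" by (auto simp: h_def)
  then have sub: "closure {t \<in> I - X. h t \<noteq> 0} \<subseteq> closure {t \<in> I - X. f t \<noteq> 0} \<union> closure {t \<in> I - X. g t \<noteq> 0}"
    unfolding closure_Un[symmetric] by (rule closure_mono)
  have "compact (closure {t \<in> I - X. h t \<noteq> 0})"
    using compact_Int_closed[OF compact_Un[OF cf(1) cg(1)] closed_closure[of "{t \<in> I - X. h t \<noteq> 0}"]] sub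
    by (simp only: Int_absorb1)
  moreover have "closure {t \<in> I - X. h t \<noteq> 0} \<subseteq> I" using sub cf(2) cg(2) by blast
  moreover have "interface h" using interface_lincomb[OF fW gW, of c] Dh by (simp add: h_def)
  ultimately show "h \<in> delta_domain b x \<alpha>" using hW unfolding delta_domain_iff W22_comp_def by blast
qed

lemma H_min_lincomb:
  assumes "(F, F') \<in> H_min" "(G, G') \<in> H_min"
  shows "(cscale c F + G, cscale c F' + G') \<in> H_min"
proof -
  obtain f where f: "f \<in> delta_domain b x \<alpha>" "F = to_L2 I f" "F' = to_L2 I (\<lambda>t. - D (D f) t)"
    using assms(1) unfolding H_min_eq by auto
  obtain g where g: "g \<in> delta_domain b x \<alpha>" "G = to_L2 I g" "G' = to_L2 I (\<lambda>t. - D (D g) t)"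
    using assms(2) unfolding H_min_eq by auto
  define h where "h = (\<lambda>t. c * f t + g t)"
  have h: "h \<in> delta_domain b x \<alpha>" and DDh: "AE t in lebesgue. t \<in> I \<longrightarrow> D (D h) t = c * D (D f) t + D (D g) t"
    unfolding h_def by (rule delta_domain_lincomb[OF f(1) g(1)])+
  have sq: "sq_integrable_on I u" "sq_integrable_on I (\<lambda>t. - D (D u) t)" if "u \<in> delta_domain b x \<alpha>" for u
    using that sq_integrable_on_cmult[of I "D (D u)" "-1"] by (auto simp: delta_domain_iff W22_comp_def W22_def)
  note sq' = sq(1)[OF f(1)] sq(2)[OF f(1)] sq(1)[OF g(1)] sq(2)[OF g(1)]
  have "cscale c F + G = to_L2 I h"
    unfolding f(2) g(2) h_def to_L2_cscale[OF sq'(1)] by (rule to_L2_add[OF sq_integrable_on_cmult[OF sq'(1)] sq'(3)])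
  moreover have "cscale c F' + G' = to_L2 I (\<lambda>t. - D (D h) t)"
  proof -
    have "cscale c F' + G' = to_L2 I (\<lambda>t. c * - D (D f) t + - D (D g) t)"
      unfolding f(3) g(3) to_L2_cscale[OF sq'(2)] by (rule to_L2_add[OF sq_integrable_on_cmult[OF sq'(2)] sq'(4)])
    also have "\<dots> = to_L2 I (\<lambda>t. - D (D h) t)"
      using sq_integrable_on_add[OF sq_integrable_on_cmult[OF sq'(2), of c] sq'(4)] sq(2)[OF h] DDh
      by (subst to_L2_eq_iff) (auto elim!: eventually_mono)
    finally show ?thesis .
  qed
  ultimately show ?thesis unfolding H_min_eq using h by auto
qed

lemma H_min_zero: "(0, 0) \<in> H_min"
proof -
  obtain F F' where F: "(F, F') \<in> H_min" using bump_in_domain[of "\<lambda>_. 0"] polynomial_function_const by blast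
  from H_min_lincomb[OF F F, of "-1"] show ?thesis by (simp only: cscale_minus_one_add diff_self)
qed

lemma H_min_subset: "H_min \<subseteq> K \<times> K"
proof -
  have "sq_integrable_on I u \<and> sq_integrable_on I (\<lambda>t. - D (D u) t)" if "u \<in> delta_domain b x \<alpha>" for u
    using that sq_integrable_on_cmult[of I "D (D u)" "-1"] by (auto simp: delta_domain_iff W22_comp_def W22_def)
  then show ?thesis unfolding H_min_eq by (auto intro!: to_L2_in_L2_on)
qed

lemma symmetric_H_delta: "symmetric_operator K (H_delta b x \<alpha>)"
  unfolding H_delta_def
proof (rule symmetric_operator_closure[OF closed_L2_on[OF I_lebesgue] H_min_subset H_min_zero H_min_lincomb dense_domain])
  fix F F' G G' assume F: "(F, F') \<in> H_min" and G: "(G, G') \<in> H_min"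
  obtain g where g: "g \<in> delta_domain b x \<alpha>" "G = to_L2 I g" "G' = to_L2 I (\<lambda>t. - D (D g) t)"
    using G unfolding H_min_eq by auto
  then show "cinner F' G = cinner F G'"
    using H_min_Green[OF F, of g] by (auto simp: delta_domain_iff W22_comp_def)
qed

end

section \<open>The deficiency spaces\<close>

lemma fund_cnj: "fund_cos (cnj \<kappa>) s = cnj (fund_cos \<kappa> s)" "fund_sin (cnj \<kappa>) s = cnj (fund_sin \<kappa> s)"
  by (simp_all add: fund_cos_def fund_sin_def cosh_def sinh_def exp_cnj)

context interaction_points
begin

text \<open>Negative arguments are included because piece 0 extends to the left; 0 thus becomes an
  interior point at which integrals of the glued function have two-sided derivatives.\<close>

lemma glue_isCont_everywhere:
  assumes t: "ereal t < b" and F: "\<And>k t. isCont (F k) t"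
    and match: "\<And>k. F (Suc k) (x (Suc k)) = F k (x (Suc k))"
  shows "isCont (glue F) t"
proof (cases "t < 0 \<or> t \<in> I - X")
  case True
  have "\<forall>\<^sub>F s in nhds t. seg s = seg t"
  proof (cases "t < 0")
    case True
    have 0: "seg s = 0" if s: "s < 0" for s
    proof -
      have "s < x (Suc 0)" using s x_pos[of 0] by linarith
      then show ?thesis by (intro seg_eq) auto
    qed
    have "\<forall>\<^sub>F s in nhds t. s < 0"
      using eventually_nhds_in_open[of "{..<0}" t] True by auto
    then show ?thesis by eventually_elim (use 0 True in simp)
  qed (use True seg_eventually in blast)
  then have "\<forall>\<^sub>F s in nhds t. glue F s = F (seg t) s"
    by eventually_elim (simp add: glue_def)
  then show ?thesis using F by (simp add: isCont_cong)
next
  case False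
  then have "t \<in> X" using t by (auto simp: halfopen_interval_def)
  then obtain n where n: "t = x n" "1 \<le> n" by auto
  then obtain k where k: "t = x (Suc k)" by (cases n) auto
  have v: "glue F t = F (Suc k) t"
    unfolding glue_def k by (subst seg_eq[of "Suc k"]) auto
  have "(glue F \<longlongrightarrow> glue F t) (at_left t)"
    unfolding v using match[of k] glue_at_left[where F = F and n = k, OF F] by (simp add: k)
  moreover have "(glue F \<longlongrightarrow> glue F t) (at_right t)"
    unfolding v using glue_at_right[where F = F and n = "Suc k", OF F] by (simp add: k)
  ultimately show ?thesis unfolding isCont_def by (rule filterlim_split_at)
qed

text \<open>At the right end point \<open>seg\<close> already selects the next piece; matching
  values make this choice immaterial, so formulas for one piece hold on the closed segment.\<close>

lemma glue_at_segment:
  assumes "t \<in> {x k..x (Suc k)}" "\<And>k. F (Suc k) (x (Suc k)) = F k (x (Suc k))"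
  shows "glue F t = F k t"
proof (cases "t = x (Suc k)")
  case True
  have "seg (x (Suc k)) = Suc k" by (rule seg_eq) auto
  then show ?thesis using assms(2)[of k] True by (simp add: glue_def)
next
  case False
  then have "seg t = k" using assms(1) by (intro seg_eq) auto
  then show ?thesis by (simp add: glue_def)
qed

end

context delta_interactions
begin

text \<open>Because the strengths are real, conjugation of solutions amounts to conjugating \<kappa>
  and the data. This turns orthogonality to a solution for \<open>z\<close> into the solvability
  condition for \<open>cnj z\<close>.\<close>

lemma coef_cnj:
  "fst (coef (cnj \<kappa>) (cnj a) (cnj c) n) = cnj (fst (coef \<kappa> a c n)) \<and>
   snd (coef (cnj \<kappa>) (cnj a) (cnj c) n) = cnj (snd (coef \<kappa> a c n))"
  by (induction n) (simp_all add: Let_def fund_cnj)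

lemma sol_cnj: "sol (cnj \<kappa>) (cnj a) (cnj c) k t = cnj (sol \<kappa> a c k t)"
  by (simp add: sol_def coef_cnj fund_cnj)

definition phi :: "complex \<Rightarrow> real \<Rightarrow> complex" where
  "phi \<kappa> = glue (sol \<kappa> 1 0)"

lemma phi_cnj: "phi (cnj \<kappa>) t = cnj (phi \<kappa> t)"
  using sol_cnj[of \<kappa> 1 0] by (simp add: phi_def glue_def)

text \<open>
  Variation of constants: \<open>f = \<phi> P + \<psi> Q\<close> with \<open>P' = \<psi> h\<close>, \<open>Q' = - \<phi> h\<close> solves \<open>f'' = \<kappa>\<^sup>2 f - h\<close>. The
  factors \<open>P\<close>, \<open>Q\<close> are continuous across the interaction points, so \<open>f\<close> inherits the interface
  conditions of \<open>\<phi>\<close> and \<open>\<psi>\<close>, and orthogonality of \<open>h\<close> to \<open>\<phi>\<close> makes the support of \<open>f\<close> compact.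
\<close>

lemma inhomogeneous_solution:
  assumes \<kappa>: "\<kappa> \<noteq> 0" and h: "continuous_on UNIV h" "\<And>t. t \<le> 0 \<or> x N \<le> t \<Longrightarrow> h t = 0"
    and orth: "integral {-1..x N} (\<lambda>t. phi \<kappa> t * h t) = 0"
  obtains f where "sq_integrable_on I f" "(to_L2 I f, to_L2 I (\<lambda>t. - (\<kappa>\<^sup>2 * f t - h t))) \<in> H_min"
proof -
  define psi where "psi = glue (sol \<kappa> 0 1)"
  have hC: "isCont h t" for t using h(1) by (simp add: continuous_on_eq_continuous_at)
  have phC: "isCont (phi \<kappa>) t" "isCont psi t" if "ereal t < b" for t
    unfolding phi_def psi_def by (rule glue_isCont_everywhere[OF that sol_isCont[OF \<kappa>] sol_cont])+
  \<comment> \<open>Integration starts at -1 so that 0 is interior. As \<open>h\<close> vanishes on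
    the negative axis, this changes no value on \<open>I\<close>.\<close>
  define J where "J u t = integral {-1..t} (\<lambda>s. u s * h s)" for u :: "real \<Rightarrow> complex" and t
  have cont_uh: "continuous_on {-1..x n} (\<lambda>s. u s * h s)" if "\<And>t. ereal t < b \<Longrightarrow> isCont u t" for u n
    by (intro continuous_at_imp_continuous_on ballI continuous_intros hC that) (use less_b in auto)
  have J_deriv: "(J u has_vector_derivative u t * h t) (at t)"
    if u: "\<And>t. ereal t < b \<Longrightarrow> isCont u t" and t: "t \<in> {x k..x (Suc k)}" for u k t
  proof -
    \<comment> \<open>One point further than the segment, so that its right end is interior and the
      derivative there is two-sided as well.\<close>
    define T where "T = x (Suc (Suc k))"
    have tT: "-1 < t" "t < T"
    proof -
      show "-1 < t" using t x_nonneg[of k] unfolding atLeastAtMost_iff by linarith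
      have "x (Suc k) < T" by (simp add: T_def)
      then show "t < T" using t by auto
    qed
    have "(J u has_vector_derivative u t * h t) (at t within {-1..T})"
      unfolding J_def by (rule integral_has_vector_derivative) (use cont_uh[OF u] tT in \<open>auto simp: T_def\<close>)
    then show ?thesis using tT by (simp add: at_within_Icc_at)
  qed
  have J_const: "J u t = J u (x N)" if u: "\<And>t. ereal t < b \<Longrightarrow> isCont u t" and t: "x N \<le> t" "ereal t < b" for u t
  proof -
    obtain n where n: "t < x n" using ex_greater[OF t(2)] by blast
    have "(\<lambda>s. u s * h s) integrable_on {-1..x n}" by (rule integrable_continuous_interval[OF cont_uh[OF u]])
    then have int: "(\<lambda>s. u s * h s) integrable_on {-1..t}"
      by (rule integrable_on_subinterval) (use n in auto)
    have "-1 \<le> x N" using x_nonneg[of N] by linarith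
    then have "J u (x N) + integral {x N..t} (\<lambda>s. u s * h s) = J u t"
      unfolding J_def using t int by (intro Henstock_Kurzweil_Integration.integral_combine) auto
    moreover have "integral {x N..t} (\<lambda>s. u s * h s) = integral {x N..t} (\<lambda>s. 0)"
      by (rule Henstock_Kurzweil_Integration.integral_cong) (use h(2) in auto)
    ultimately show ?thesis by simp
  qed
  have J0: "J u 0 = 0" for u
  proof -
    have "J u 0 = integral {-1..0::real} (\<lambda>s. 0)" unfolding J_def by (rule Henstock_Kurzweil_Integration.integral_cong) (use h(2) in auto)
    then show ?thesis by simp
  qed
  \<comment> \<open>The constant in \<open>P\<close> is free and is chosen to make \<open>P\<close>
    vanish beyond \<open>x N\<close>. That of \<open>Q\<close> is not: the second basic solution has
    derivative 1 at 0, so the Neumann condition requires \<open>Q 0 = 0\<close>. The vanishing of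
    \<open>Q\<close> beyond \<open>x N\<close> is therefore where orthogonality enters.\<close>
  define P where "P t = J psi t - J psi (x N)" for t
  define Q where "Q t = - J (phi \<kappa>) t" for t
  have JN: "J (phi \<kappa>) (x N) = 0" using orth by (simp add: J_def)
  have PQ_zero: "P t = 0" "Q t = 0" if "x N \<le> t" "ereal t < b" for t
    using J_const[OF phC(2) that] J_const[OF phC(1) that] JN by (simp_all add: P_def Q_def)
  have dP: "(P has_vector_derivative sol \<kappa> 0 1 k t * h t) (at t)" if "t \<in> {x k..x (Suc k)}" for k t
    using has_vector_derivative_diff[OF J_deriv[OF phC(2) that] has_vector_derivative_const]
      glue_at_segment[where F = "sol \<kappa> 0 1", OF that sol_cont]
    by (simp add: P_def[abs_def] psi_def)
  have dQ: "(Q has_vector_derivative - (sol \<kappa> 1 0 k t * h t)) (at t)" if "t \<in> {x k..x (Suc k)}" for k t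
    using has_vector_derivative_minus[OF J_deriv[OF phC(1) that]] glue_at_segment[where F = "sol \<kappa> 1 0", OF that sol_cont]
    by (simp add: Q_def[abs_def] phi_def)
  define F where "F k t = sol \<kappa> 1 0 k t * P t + sol \<kappa> 0 1 k t * Q t" for k t
  define F1 where "F1 k t = sol' \<kappa> 1 0 k t * P t + sol' \<kappa> 0 1 k t * Q t" for k t
  define F2 where "F2 k t = \<kappa>\<^sup>2 * F k t - h t" for k t
  have d1: "(F k has_vector_derivative F1 k t) (at t)" if t: "t \<in> {x k..x (Suc k)}" for k t
  proof -
    have "(F k has_vector_derivative
        (sol \<kappa> 1 0 k t * (sol \<kappa> 0 1 k t * h t) + sol' \<kappa> 1 0 k t * P t)
        + (sol \<kappa> 0 1 k t * (- (sol \<kappa> 1 0 k t * h t)) + sol' \<kappa> 0 1 k t * Q t)) (at t)"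
      unfolding F_def[abs_def]
      by (intro has_vector_derivative_add has_vector_derivative_mult sol_deriv[OF \<kappa>] dP[OF t] dQ[OF t])
    then show ?thesis by (simp add: F1_def algebra_simps)
  qed
  have d2: "(F1 k has_vector_derivative F2 k t) (at t)" if t: "t \<in> {x k..x (Suc k)}" for k t
  proof -
    have "(F1 k has_vector_derivative
        (sol' \<kappa> 1 0 k t * (sol \<kappa> 0 1 k t * h t) + \<kappa>\<^sup>2 * sol \<kappa> 1 0 k t * P t)
        + (sol' \<kappa> 0 1 k t * (- (sol \<kappa> 1 0 k t * h t)) + \<kappa>\<^sup>2 * sol \<kappa> 0 1 k t * Q t)) (at t)"
      unfolding F1_def[abs_def]
      by (intro has_vector_derivative_add has_vector_derivative_mult sol'_deriv[OF \<kappa>] dP[OF t] dQ[OF t])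
    also have "(sol' \<kappa> 1 0 k t * (sol \<kappa> 0 1 k t * h t) + \<kappa>\<^sup>2 * sol \<kappa> 1 0 k t * P t)
        + (sol' \<kappa> 0 1 k t * (- (sol \<kappa> 1 0 k t * h t)) + \<kappa>\<^sup>2 * sol \<kappa> 0 1 k t * Q t)
        = \<kappa>\<^sup>2 * F k t - (sol \<kappa> 1 0 k t * sol' \<kappa> 0 1 k t - sol' \<kappa> 1 0 k t * sol \<kappa> 0 1 k t) * h t"
      by (simp add: F_def algebra_simps)
    also have "\<dots> = F2 k t" by (simp add: F2_def sol_Wronskian[OF \<kappa>])
    finally show ?thesis .
  qed
  have zero: "F k t = 0 \<and> F2 k t = 0" if k: "N \<le> k" and t: "t \<in> {x k..x (Suc k)}" for k t
  proof -
    have "x N \<le> x k" using k by simp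
    then have "x N \<le> t" using t unfolding atLeastAtMost_iff by linarith
    moreover have "ereal t < b" using t less_b[of t "Suc k"] by auto
    ultimately have "x N \<le> t" "ereal t < b" .
    then show ?thesis using PQ_zero h(2)[of t] by (simp add: F_def F2_def)
  qed
  have c2: "isCont (F2 k) t" if t: "t \<in> {x k..x (Suc k)}" for k t
    unfolding F2_def[abs_def]
    using has_vector_derivative_continuous[OF d1[OF t]] hC by (intro continuous_intros)
  have F0: "F1 0 0 = 0" using sol_start[of \<kappa>] J0 by (simp add: F1_def Q_def)
  have cont: "F (Suc k) (x (Suc k)) = F k (x (Suc k))" for k by (simp add: F_def sol_cont)
  have jump: "F1 (Suc k) (x (Suc k)) - F1 k (x (Suc k)) = of_real (\<alpha> (Suc k)) * F k (x (Suc k))" for k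
  proof -
    have "F1 (Suc k) (x (Suc k)) - F1 k (x (Suc k))
       = (sol' \<kappa> 1 0 (Suc k) (x (Suc k)) - sol' \<kappa> 1 0 k (x (Suc k))) * P (x (Suc k))
       + (sol' \<kappa> 0 1 (Suc k) (x (Suc k)) - sol' \<kappa> 0 1 k (x (Suc k))) * Q (x (Suc k))"
      by (simp add: F1_def algebra_simps)
    then show ?thesis unfolding sol_jump by (simp add: F_def algebra_simps)
  qed
  note G = glue_delta_domain[where F = F and ?F1.0 = F1 and ?F2.0 = F2 and N = N, OF d1 d2 c2 F0 cont jump zero]
  have "glue F2 = (\<lambda>t. \<kappa>\<^sup>2 * glue F t - h t)" by (rule ext) (simp add: glue_def F2_def)
  with G(2,4) show ?thesis by (intro that[of "glue F"]) auto
qed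

end

section \<open>One-dimensionality of the deficiency spaces\<close>

context decaying_interactions
begin

lemma phi_sq_integrable: "cmod \<kappa> = 1 \<Longrightarrow> sq_integrable_on I (phi \<kappa>)"
  unfolding phi_def by (rule sol_sq_integrable)

lemma phi_neq_0:
  assumes \<kappa>: "cmod \<kappa> = 1"
  shows "to_L2 I (phi \<kappa>) \<noteq> 0"
proof
  assume "to_L2 I (phi \<kappa>) = 0"
  then have "to_L2 I (phi \<kappa>) = to_L2 I (\<lambda>t. 0)" by (simp add: to_L2_def zero_L2.abs_eq)
  then have ae: "AE t in lebesgue. t \<in> I \<longrightarrow> phi \<kappa> t = 0"
    using phi_sq_integrable[OF \<kappa>] by (subst (asm) to_L2_eq_iff) (auto simp: sq_integrable_on_def)
  have \<kappa>0: "\<kappa> \<noteq> 0" using \<kappa> by auto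
  have "isCont (phi \<kappa>) 0"
    unfolding phi_def by (rule glue_isCont_everywhere[OF _ sol_isCont[OF \<kappa>0] sol_cont]) (use less_b[of 0 0] x_zero in simp)
  moreover have "phi \<kappa> 0 = 1"
    using glue_at_segment[of 0 0 "sol \<kappa> 1 0", OF _ sol_cont] sol_start(1) x_zero less_imp_le[OF x_pos[of 0]]
    by (simp add: phi_def)
  ultimately have "(phi \<kappa> \<longlongrightarrow> 1) (at_right 0)" by (simp add: isCont_def filterlim_at_split)
  then have "\<forall>\<^sub>F t in at_right 0. phi \<kappa> t \<noteq> 0" by (rule tendsto_imp_eventually_ne) simp
  then obtain \<delta> where \<delta>: "\<delta> > 0" "\<And>t. 0 < t \<Longrightarrow> t < \<delta> \<Longrightarrow> phi \<kappa> t \<noteq> 0"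
    unfolding eventually_at_right_field by blast
  define e where "e = min \<delta> (x (Suc 0))"
  have "AE t in lebesgue. t \<notin> {0<..<e}"
    using ae
  proof eventually_elim
    case (elim t)
    then show ?case using \<delta>(2)[of t] in_I[of t "Suc 0"] by (auto simp: e_def)
  qed
  then have "negligible {0<..<e}"
    unfolding negligible_iff_null_sets completion.null_sets_iff_AE by simp
  moreover have "e > 0" using \<delta>(1) x_pos[of 0] by (simp add: e_def)
  ultimately show False using open_not_negligible[of "{0<..<e}"] by (auto simp: open_greaterThanLessThan)
qed

lemma phi_in_eigenspace:
  assumes \<kappa>: "cmod \<kappa> = 1" "\<kappa>\<^sup>2 = - z"
  shows "to_L2 I (phi \<kappa>) \<in> eigenspace (adjoint_op K (H_delta b x \<alpha>)) z"
proof -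
  have \<kappa>0: "\<kappa> \<noteq> 0" using \<kappa> by auto
  note sq = phi_sq_integrable[OF \<kappa>(1)]
  have glue2: "glue (\<lambda>k t. \<kappa>\<^sup>2 * sol \<kappa> 1 0 k t) = (\<lambda>t. \<kappa>\<^sup>2 * phi \<kappa> t)" by (rule ext) (simp add: glue_def phi_def)
  have c2: "isCont (\<lambda>t. \<kappa>\<^sup>2 * sol \<kappa> 1 0 k t) t" for k t by (intro continuous_intros sol_isCont[OF \<kappa>0])
  have sq2: "sq_integrable_on I (glue (\<lambda>k t. \<kappa>\<^sup>2 * sol \<kappa> 1 0 k t))"
    unfolding glue2 by (rule sq_integrable_on_cmult[OF sq])
  note W = glue_W22_interface[where F = "sol \<kappa> 1 0" and ?F1.0 = "sol' \<kappa> 1 0" and ?F2.0 = "\<lambda>k t. \<kappa>\<^sup>2 * sol \<kappa> 1 0 k t",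
      OF sol_deriv[OF \<kappa>0] sol'_deriv[OF \<kappa>0] c2 sol_start(2) sol_cont sol_jump sq[unfolded phi_def] sq2]
  have phiW: "phi \<kappa> \<in> W22 I X" "interface (phi \<kappa>)" using W(1,2) by (simp_all add: phi_def)
  have DD: "D (D (phi \<kappa>)) t = \<kappa>\<^sup>2 * phi \<kappa> t" if "t \<in> I - X" for t
    unfolding glue2[symmetric, THEN fun_cong] unfolding phi_def by (rule W(4)[OF that])
  have zphi: "cscale z (to_L2 I (phi \<kappa>)) = to_L2 I (\<lambda>t. - D (D (phi \<kappa>)) t)"
    unfolding to_L2_cscale[OF sq]
  proof (subst to_L2_eq_iff)
    show "sq_integrable_on I (\<lambda>t. z * phi \<kappa> t)" by (rule sq_integrable_on_cmult[OF sq])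
    show "sq_integrable_on I (\<lambda>t. - D (D (phi \<kappa>)) t)"
      using phiW sq_integrable_on_cmult[of I "D (D (phi \<kappa>))" "-1"] by (simp add: W22_def)
    show "AE t in lebesgue. t \<in> I \<longrightarrow> z * phi \<kappa> t = - D (D (phi \<kappa>)) t"
      using AE_not_X
    proof eventually_elim
      case (elim t)
      have "z = - (\<kappa>\<^sup>2)" using \<kappa>(2) by simp
      then show ?case using DD[of t] elim by simp
    qed
  qed
  have "cinner F' (to_L2 I (phi \<kappa>)) = cinner F (cscale z (to_L2 I (phi \<kappa>)))" if "(F, F') \<in> H_min" for F F'
    unfolding zphi by (rule H_min_Green[OF that phiW])
  moreover have "cscale z (to_L2 I (phi \<kappa>)) \<in> K"
    unfolding to_L2_cscale[OF sq] by (rule to_L2_in_L2_on[OF sq_integrable_on_cmult[OF sq]])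
  ultimately show ?thesis
    unfolding H_delta_def eigenspace_adjoint_closure using to_L2_in_L2_on[OF sq] by auto
qed

lemma eigenvector_orthogonal:
  assumes \<kappa>: "cmod \<kappa> = 1" "\<kappa>\<^sup>2 = - z"
    and G: "G \<in> eigenspace (adjoint_op K (H_delta b x \<alpha>)) z"
    and h: "continuous_on UNIV h" "\<And>t. t \<le> 0 \<or> x N \<le> t \<Longrightarrow> h t = 0"
    and orth: "cinner (to_L2 I h) (to_L2 I (phi \<kappa>)) = 0"
  shows "cinner (to_L2 I h) G = 0"
proof -
  \<comment> \<open>Moving \<open>z\<close> from the second argument of the inner product to the
    first conjugates it, so the inhomogeneous equation is solved for \<open>cnj z\<close>, with
    \<open>\<mu>\<^sup>2 = - cnj z\<close>. Its solution \<open>phi \<mu>\<close> is the conjugate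
    of \<open>phi \<kappa>\<close>, as the orthogonality integral demands.\<close>
  define \<mu> where "\<mu> = cnj \<kappa>"
  have \<mu>: "\<mu> \<noteq> 0" "\<mu>\<^sup>2 = - cnj z" using \<kappa> by (auto simp: \<mu>_def simp flip: complex_cnj_power complex_cnj_minus)
  have sqh: "sq_integrable_on I h" by (rule sq_integrable_on_I_continuous[OF h(1), of N]) (use h(2) in auto)
  note sq = phi_sq_integrable[OF \<kappa>(1)]
  have int0: "integrable lebesgue (\<lambda>t. if t \<in> I then h t * cnj (phi \<kappa> t) else 0)"
    using sq_integrable_prod_integrable[OF sqh[unfolded sq_integrable_on_def] sq[unfolded sq_integrable_on_def]]
    by (rule back_subst[of "integrable lebesgue"]) auto
  have "integral {-1..x N} (\<lambda>t. phi \<mu> t * h t) = integral UNIV (\<lambda>t. if t \<in> {-1..x N} then phi \<mu> t * h t else 0)"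
    by (rule integral_restrict_UNIV[symmetric])
  also have "(\<lambda>t. if t \<in> {-1..x N} then phi \<mu> t * h t else 0) = (\<lambda>t. if t \<in> I then h t * cnj (phi \<kappa> t) else 0)"
  proof
    fix t
    show "(if t \<in> {-1..x N} then phi \<mu> t * h t else 0) = (if t \<in> I then h t * cnj (phi \<kappa> t) else 0)"
    proof (cases "0 < t \<and> t < x N")
      case True
      then have "t \<in> I" using in_I[of t N] by auto
      then show ?thesis using True by (simp add: \<mu>_def phi_cnj)
    next
      case False
      then have "h t = 0" using h(2)[of t] by auto
      then show ?thesis by simp
    qed
  qed
  also have "integral UNIV \<dots> = (\<integral>t. (if t \<in> I then h t * cnj (phi \<kappa> t) else 0) \<partial>lebesgue)"
    by (rule integral_unique[OF has_integral_integral_lebesgue[OF int0]])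
  also have "\<dots> = 0" using orth unfolding cinner_to_L2[OF sqh sq] .
  finally obtain f where f: "sq_integrable_on I f" "(to_L2 I f, to_L2 I (\<lambda>t. - (\<mu>\<^sup>2 * f t - h t))) \<in> H_min"
    using inhomogeneous_solution[OF \<mu>(1) h] by blast
  have "to_L2 I (\<lambda>t. - (\<mu>\<^sup>2 * f t - h t)) = cscale (cnj z) (to_L2 I f) + to_L2 I h"
    unfolding to_L2_cscale[OF f(1)] to_L2_add[OF sq_integrable_on_cmult[OF f(1)] sqh] by (simp add: \<mu>(2) add.commute)
  moreover have "cinner (to_L2 I (\<lambda>t. - (\<mu>\<^sup>2 * f t - h t))) G = cinner (to_L2 I f) (cscale z G)"
    using G f(2) unfolding H_delta_def eigenspace_adjoint_closure by blast
  ultimately show ?thesis by (simp add: cinner_add_left cinner_cscale_left cinner_cscale_right)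
qed

text \<open>On the dense set of test vectors the functional given by \<open>G\<close> vanishes
  wherever the one given by \<Phi> does, hence it is a multiple of it. Concretely, a fixed
  \<open>W\<close> not orthogonal to \<Phi> is used to correct each test vector to one orthogonal to
  \<Phi>.\<close>

lemma eigenspace_eq_span:
  assumes \<kappa>: "cmod \<kappa> = 1" "\<kappa>\<^sup>2 = - z"
  shows "eigenspace (adjoint_op K (H_delta b x \<alpha>)) z \<subseteq> range (\<lambda>c. cscale c (to_L2 I (phi \<kappa>)))"
proof
  define \<Phi> where "\<Phi> = to_L2 I (phi \<kappa>)"
  define S where "S = {to_L2 I (\<lambda>t. bump N t *\<^sub>R p t) |N p. polynomial_function (p :: real \<Rightarrow> complex)}"
  have dense: "K \<subseteq> closure S" unfolding S_def by (rule L2_on_subset_closure_bump)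
  fix G assume G: "G \<in> eigenspace (adjoint_op K (H_delta b x \<alpha>)) z"
  have GK: "G \<in> K" using G unfolding H_delta_def eigenspace_adjoint_closure by blast
  have \<Phi>K: "\<Phi> \<in> K" unfolding \<Phi>_def by (rule to_L2_in_L2_on[OF phi_sq_integrable[OF \<kappa>(1)]])
  have test: "\<exists>h N. H = to_L2 I h \<and> continuous_on UNIV h \<and> (\<forall>t. t \<le> 0 \<or> x N \<le> t \<longrightarrow> h t = 0) \<and> sq_integrable_on I h"
    if H: "H \<in> S" for H
  proof -
    obtain N p where p: "H = to_L2 I (\<lambda>t. bump N t *\<^sub>R p t)" "polynomial_function p" using H unfolding S_def by blast
    then have "continuous_on UNIV p" by (intro continuous_on_polymonial_function)
    then show ?thesis
      using p(1) by (intro exI[of _ "\<lambda>t. bump N t *\<^sub>R p t"] exI[of _ N])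
        (auto intro!: continuous_intros sq_integrable_on_bump simp: bump_eq_0)
  qed
  have "\<exists>W\<in>S. cinner W \<Phi> \<noteq> 0"
    using orthogonal_to_dense_eq_0[OF \<Phi>K dense] phi_neq_0[OF \<kappa>(1)] by (auto simp: \<Phi>_def)
  then obtain W where W: "W \<in> S" "cinner W \<Phi> \<noteq> 0" by blast
  obtain w M where w: "W = to_L2 I w" "continuous_on UNIV w" "\<And>t. t \<le> 0 \<or> x M \<le> t \<Longrightarrow> w t = 0" "sq_integrable_on I w"
    using test[OF W(1)] by blast
  \<comment> \<open>The conjugate compensates for antilinearity of the inner product in its second
    argument.\<close>
  define c where "c = cnj (cinner W G / cinner W \<Phi>)"
  have "G - cscale c \<Phi> = 0"
  proof (rule orthogonal_to_dense_eq_0[OF _ dense])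
    show "G - cscale c \<Phi> \<in> K"
    proof -
      obtain g where g: "sq_integrable_on I g" "G = to_L2 I g" using GK by (rule L2_on_obtain)
      note sq = phi_sq_integrable[OF \<kappa>(1)]
      show ?thesis
        unfolding g(2) \<Phi>_def to_L2_cscale[OF sq] to_L2_diff[OF g(1) sq_integrable_on_cmult[OF sq]]
        by (rule to_L2_in_L2_on[OF sq_integrable_on_diff[OF g(1) sq_integrable_on_cmult[OF sq]]])
    qed
    fix H assume "H \<in> S"
    then obtain h N where h: "H = to_L2 I h" "continuous_on UNIV h" "\<And>t. t \<le> 0 \<or> x N \<le> t \<Longrightarrow> h t = 0" "sq_integrable_on I h"
      using test by blast
    define l where "l = cinner H \<Phi> / cinner W \<Phi>"
    have eq: "to_L2 I (\<lambda>t. h t - l * w t) = H - cscale l W"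
      unfolding h(1) w(1) to_L2_cscale[OF w(4)] by (rule to_L2_diff[OF h(4) sq_integrable_on_cmult[OF w(4)], symmetric])
    have "cinner (to_L2 I (\<lambda>t. h t - l * w t)) G = 0"
    proof (rule eigenvector_orthogonal[OF \<kappa> G, of _ "max N M"])
      show "continuous_on UNIV (\<lambda>t. h t - l * w t)" by (intro continuous_intros h w)
      show "h t - l * w t = 0" if "t \<le> 0 \<or> x (max N M) \<le> t" for t
      proof -
        have "x N \<le> x (max N M)" "x M \<le> x (max N M)" by simp_all
        then have "t \<le> 0 \<or> x N \<le> t" "t \<le> 0 \<or> x M \<le> t" using that by linarith+
        then show ?thesis using h(3) w(3) by simp
      qed
      show "cinner (to_L2 I (\<lambda>t. h t - l * w t)) (to_L2 I (phi \<kappa>)) = 0"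
        unfolding eq \<Phi>_def[symmetric] cinner_diff_left cinner_cscale_left using W(2) by (simp add: l_def)
    qed
    then have "cinner H G = l * cinner W G" unfolding eq cinner_diff_left cinner_cscale_left by simp
    then show "cinner H (G - cscale c \<Phi>) = 0"
      by (simp add: cinner_diff_right cinner_cscale_right c_def l_def)
  qed
  then have "G = cscale c \<Phi>" by simp
  then show "G \<in> range (\<lambda>c. cscale c (to_L2 I (phi \<kappa>)))" unfolding \<Phi>_def by (rule range_eqI)
qed

lemma dim_eigenspace:
  assumes z: "cmod z = 1"
  shows "cL2.dim (eigenspace (adjoint_op K (H_delta b x \<alpha>)) z) = 1"
proof -
  \<comment> \<open>The choice of the root is immaterial: both fundamental solutions are even in
    \<kappa>.\<close>
  define \<kappa> where "\<kappa> = csqrt (- z)"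
  have \<kappa>2: "\<kappa>\<^sup>2 = - z" by (simp add: \<kappa>_def)
  have "(cmod \<kappa>)\<^sup>2 = 1" using \<kappa>2 z by (simp flip: norm_power)
  then have \<kappa>1: "cmod \<kappa> = 1" by (simp add: power2_eq_1_iff) (smt (verit) norm_ge_zero)
  define \<Phi> where "\<Phi> = to_L2 I (phi \<kappa>)"
  show ?thesis
  proof (rule cL2.dim_unique[of "{\<Phi>}"])
    show "{\<Phi>} \<subseteq> eigenspace (adjoint_op K (H_delta b x \<alpha>)) z"
      using phi_in_eigenspace[OF \<kappa>1 \<kappa>2] by (simp add: \<Phi>_def)
    show "eigenspace (adjoint_op K (H_delta b x \<alpha>)) z \<subseteq> cL2.span {\<Phi>}"
      using eigenspace_eq_span[OF \<kappa>1 \<kappa>2] by (simp add: \<Phi>_def cL2.span_singleton)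
    show "\<not> cL2.dependent {\<Phi>}" using phi_neq_0[OF \<kappa>1] by (simp add: \<Phi>_def cL2.dependent_single)
  qed simp
qed

end

theorem proposition5p9:
  fixes b :: ereal and x d \<alpha> :: "nat \<Rightarrow> real"
  assumes b_pos: "0 < b"
    and x_zero: "x 0 = 0"
    and x_incr: "strict_mono x"
    and x_less: "\<And>n. ereal (x n) < b"
    and x_lim: "(\<lambda>n. ereal (x n)) \<longlonglongrightarrow> b"
    and d_def: "\<And>n. 1 \<le> n \<Longrightarrow> d n = x n - x (n - 1)"
    and d_l2: "summable (\<lambda>n. (d (n + 1))\<^sup>2)"
    and d_log_convex: "\<And>n. 2 \<le> n \<Longrightarrow> d (n - 1) * d (n + 1) \<ge> (d n)\<^sup>2"
    and alpha_summable:
      "summable (\<lambda>n. d (n + 2) * \<bar>\<alpha> (n + 1) + 1 / d (n + 1) + 1 / d (n + 2)\<bar>)"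
  shows "symmetric_operator (L2_on (halfopen_interval b)) (H_delta b x \<alpha>) \<and>
         deficiency_plus (L2_on (halfopen_interval b)) (H_delta b x \<alpha>) = 1 \<and>
         deficiency_minus (L2_on (halfopen_interval b)) (H_delta b x \<alpha>) = 1"
proof -
  interpret P: delta_interactions b x \<alpha>
    by unfold_locales (fact x_zero x_incr x_less x_lim)+
  \<comment> \<open>The default normal form of successors is restored so that indices written with
    \<open>+ 1\<close> and with \<open>Suc\<close> agree.\<close>
  note One_nat_def [simp]
  have gap: "P.gap n = d (n + 1)" for n
    using d_def[of "n + 1"] by (simp add: P.gap_def)
  interpret P: decaying_interactions b x \<alpha>
  proof unfold_locales
    show "summable (\<lambda>k. (P.gap k)\<^sup>2)" using d_l2 by (simp only: gap)
    \<comment> \<open>The shift \<open>n = k + 2\<close> makes the middle gap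
      \<open>d (k + 2)\<close>, so that \<open>k = 0\<close> corresponds to the first admissible
      index 2.\<close>
    show "(P.gap (Suc k))\<^sup>2 \<le> P.gap k * P.gap (Suc (Suc k))" for k
      using d_log_convex[of "k + 2"] by (simp add: gap)
    show "summable (\<lambda>k. P.gap (Suc k) * \<bar>\<alpha> (Suc k) + 1 / P.gap k + 1 / P.gap (Suc k)\<bar>)"
      using alpha_summable by (simp add: gap)
  qed
  show ?thesis
    unfolding deficiency_plus_def deficiency_minus_def
    using P.symmetric_H_delta P.dim_eigenspace[of \<i>] P.dim_eigenspace[of "- \<i>"] by simp
qed

end
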